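(* Let $\Psi=(X,A,q,g)$ be a standard MDP where $X$ is a compact subset of a simplex $\Delta(K)$ ($K$ finite), $A$ is a nonempty set, $q:X\times A\to\Delta_f(X)$ and $g:X\times A\to[0,1]$. Assume that for all $x,y\in X$, $a\in A$, $f\in D_1$ and $\alpha,\beta\ge0$: - $|\alpha f(q(x,a))-\beta f(q(y,a))|\le\|\alpha x-\beta y\|_1$, and - $|\alpha g(x,a)-\beta g(y,a)|\le\|\alpha x-\beta y\|_1$. Then $\Psi$ has a general uniform value $v^*$, given for each $x\in X$ by $$v^*(x)=\inf\Big\{w(\delta_x):\ w:\Delta(X)\to[0,1]\text{ affine and weak-* continuous, such that (1) and (2) hold}\Big\},$$ where the two conditions on $w$ are: - (1) $w(\delta_{x'})\ge\sup_{a\in A}w(q(x',a))$ for all $x'\in X$; - (2) $w(u)\ge y$ for all $(u,y)\in RR$.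
   Context: **Test functions.** $D_1=\{f\in\mathcal C(\Delta(K)):\ \forall x,y\in\Delta(K),\ \forall a,b\ge0,\ af(x)-bf(y)\le\|ax-by\|_1\}$, where $\|p\|_1=\sum_k|p^k|$. Such $f$ is extended linearly to finitely supported probabilities: $f(u)=\sum_xu(x)f(x)$. **Play and values.** At each stage the player observes the current state $x$ and chooses an action $a$, gets $g(x,a)$, and the next state is drawn from $q(x,a)$. - A (behavior) strategy is a sequence $\sigma_t:(X\times A)^{t-1}\to\Delta_f(A)$. - For an evaluation $\theta\in\Delta(\mathbb N^* )$, $\gamma_\theta(x_1,\sigma)=\mathbb E_{x_1,\sigma}\big(\sum_t\theta_tg(x_t,a_t)\big)$ and $v_\theta(x_1)=\sup_\sigma\gamma_\theta(x_1,\sigma)$. - Impatience is $I(\theta)=\sum_t|\theta_{t+1}-\theta_t|$. **General values.** A general limit value $v^*$ exists if $\sup_x|v_\theta(x)-v^*(x)|\to0$ as $I(\theta)\to0$. A general uniform value exists if moreover, for every $\varepsilon>0$, there exist $\alpha>0$ and strategies $\sigma(x)$ such that $I(\theta)\le\alpha$ implies $\gamma_\theta(x,\sigma(x))\ge v^*(x)-\varepsilon$ for all $x$. **Invariant couples.** For $(u,y)\in\Delta_f(X)\times[0,1]$ define $$\hat F(u,y)=\Big\{\Big(\sum_xu(x)q(x,\sigma(x)),\ \sum_xu(x)g(x,\sigma(x))\Big):\ \sigma:X\to\Delta_f(A)\Big\},$$ with $q(x,\cdot)$ and $g(x,\cdot)$ extended linearly to $\Delta_f(A)$. Then $$RR=\{(u,y)\in\Delta(X)\times[0,1]:\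 ((u,y),(u,y))\in\mathrm{cl}(\mathrm{Graph}\,\hat F)\},$$ where the closure is taken in $(\Delta(X)\times[0,1])^2$ with the weak-* topology on $\Delta(X)$. *)

theory Defs
  imports "HOL-Probability.Probability"
begin

type_synonym 'k state = "real ^ 'k"

definition norm1 :: "real ^ 'k::finite \<Rightarrow> real" where
  "norm1 p = (\<Sum>k\<in>UNIV. \<bar>p $ k\<bar>)"

definition DeltaK :: "(real ^ 'k::finite) set" where
  "DeltaK = {p. (\<forall>k. 0 \<le> p $ k) \<and> (\<Sum>k\<in>UNIV. p $ k) = 1}"

definition D1 :: "(real ^ 'k::finite \<Rightarrow> real) set" where
  "D1 = {f. continuous_on DeltaK f \<and>
         (\<forall>x\<in>DeltaK. \<forall>y\<in>DeltaK. \<forall>a::real. \<forall>b::real. 0 \<le> a \<longrightarrow> 0 \<le> b \<longrightarrow>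
            a * f x - b * f y \<le> norm1 (a *\<^sub>R x - b *\<^sub>R y))}"

definition lin_ext :: "('s \<Rightarrow> real) \<Rightarrow> 's pmf \<Rightarrow> real" where
  "lin_ext f u = measure_pmf.expectation u f"

text \<open>Behaviour strategy: given the past history (x_1,a_1,...,x_{t-1},a_{t-1}) and the
  current state x_t, a finitely supported probability on A.\<close>
definition strategies :: "'a set \<Rightarrow> (('s \<times> 'a) list \<Rightarrow> 's \<Rightarrow> 'a pmf) set" where
  "strategies A = {\<sigma>. \<forall>h x. finite (set_pmf (\<sigma> h x)) \<and> set_pmf (\<sigma> h x) \<subseteq> A}"

text \<open>Law of (past history, current state) at stage n+1.\<close>
primrec hist :: "('s \<Rightarrow> 'a \<Rightarrow> 's pmf) \<Rightarrow> 's \<Rightarrow> (('s \<times> 'a) list \<Rightarrow> 's \<Rightarrow> 'a pmf)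
                 \<Rightarrow> nat \<Rightarrow> (('s \<times> 'a) list \<times> 's) pmf" where
  "hist q x1 \<sigma> 0 = return_pmf ([], x1)"
| "hist q x1 \<sigma> (Suc n) = bind_pmf (hist q x1 \<sigma> n)
      (\<lambda>(h, x). bind_pmf (\<sigma> h x) (\<lambda>a. map_pmf (\<lambda>x'. (h @ [(x, a)], x')) (q x a)))"

text \<open>Expected payoff at stage n+1.\<close>
definition stage_payoff :: "('s \<Rightarrow> 'a \<Rightarrow> 's pmf) \<Rightarrow> ('s \<Rightarrow> 'a \<Rightarrow> real) \<Rightarrow> 's
      \<Rightarrow> (('s \<times> 'a) list \<Rightarrow> 's \<Rightarrow> 'a pmf) \<Rightarrow> nat \<Rightarrow> real" where
  "stage_payoff q g x1 \<sigma> n = measure_pmf.expectation (hist q x1 \<sigma> n)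
      (\<lambda>(h, x). measure_pmf.expectation (\<sigma> h x) (g x))"

text \<open>An evaluation theta in Delta(N*); theta n is the weight of stage n+1.\<close>
definition evaluation :: "(nat \<Rightarrow> real) \<Rightarrow> bool" where
  "evaluation \<theta> \<longleftrightarrow> (\<forall>n. 0 \<le> \<theta> n) \<and> \<theta> sums 1"

definition impatience :: "(nat \<Rightarrow> real) \<Rightarrow> real" where
  "impatience \<theta> = (\<Sum>n. \<bar>\<theta> (Suc n) - \<theta> n\<bar>)"

definition gamma :: "('s \<Rightarrow> 'a \<Rightarrow> 's pmf) \<Rightarrow> ('s \<Rightarrow> 'a \<Rightarrow> real) \<Rightarrow> (nat \<Rightarrow> real) \<Rightarrow> 's
      \<Rightarrow> (('s \<times> 'a) list \<Rightarrow> 's \<Rightarrow> 'a pmf) \<Rightarrow> real" where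
  "gamma q g \<theta> x1 \<sigma> = (\<Sum>n. \<theta> n * stage_payoff q g x1 \<sigma> n)"

definition val :: "'a set \<Rightarrow> ('s \<Rightarrow> 'a \<Rightarrow> 's pmf) \<Rightarrow> ('s \<Rightarrow> 'a \<Rightarrow> real) \<Rightarrow> (nat \<Rightarrow> real)
      \<Rightarrow> 's \<Rightarrow> real" where
  "val A q g \<theta> x1 = (SUP \<sigma>\<in>strategies A. gamma q g \<theta> x1 \<sigma>)"

definition general_limit_value :: "'s set \<Rightarrow> 'a set \<Rightarrow> ('s \<Rightarrow> 'a \<Rightarrow> 's pmf)
      \<Rightarrow> ('s \<Rightarrow> 'a \<Rightarrow> real) \<Rightarrow> ('s \<Rightarrow> real) \<Rightarrow> bool" where
  "general_limit_value X A q g v \<longleftrightarrow>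
     (\<forall>\<epsilon>>0. \<exists>\<alpha>>0. \<forall>\<theta>. evaluation \<theta> \<and> impatience \<theta> \<le> \<alpha> \<longrightarrow>
        (\<forall>x\<in>X. \<bar>val A q g \<theta> x - v x\<bar> \<le> \<epsilon>))"

definition general_uniform_value :: "'s set \<Rightarrow> 'a set \<Rightarrow> ('s \<Rightarrow> 'a \<Rightarrow> 's pmf)
      \<Rightarrow> ('s \<Rightarrow> 'a \<Rightarrow> real) \<Rightarrow> ('s \<Rightarrow> real) \<Rightarrow> bool" where
  "general_uniform_value X A q g v \<longleftrightarrow> general_limit_value X A q g v \<and>
     (\<forall>\<epsilon>>0. \<exists>\<alpha>>0. \<exists>\<sigma>. (\<forall>x\<in>X. \<sigma> x \<in> strategies A) \<and>
        (\<forall>\<theta>. evaluation \<theta> \<and> impatience \<theta> \<le> \<alpha> \<longrightarrow>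
          (\<forall>x\<in>X. gamma q g \<theta> x (\<sigma> x) \<ge> v x - \<epsilon>)))"

text \<open>Borel probability measures on X, represented as Borel probability measures on
  R^K concentrated on X.\<close>
definition DeltaX :: "(real ^ 'k::finite) set \<Rightarrow> (real ^ 'k) measure set" where
  "DeltaX X = {\<mu>. prob_space \<mu> \<and> sets \<mu> = sets borel \<and> emeasure \<mu> X = 1}"

definition weak_star :: "(real ^ 'k::finite) set \<Rightarrow> (real ^ 'k) measure topology" where
  "weak_star X = topology_generated_by
     {{\<mu> \<in> DeltaX X. (set_lebesgue_integral \<mu> X h) \<in> U} | h U.
        continuous_on X h \<and> open (U :: real set)}"

definition emb :: "(real ^ 'k::finite) pmf \<Rightarrow> (real ^ 'k) measure" where
  "emb u = measure_of UNIV (sets borel) (\<lambda>B. emeasure (measure_pmf u) B)"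

definition mix :: "real \<Rightarrow> (real ^ 'k::finite) measure \<Rightarrow> (real ^ 'k) measure \<Rightarrow> (real ^ 'k) measure" where
  "mix l \<mu> \<nu> = measure_of UNIV (sets borel)
     (\<lambda>B. ennreal l * emeasure \<mu> B + ennreal (1 - l) * emeasure \<nu> B)"

definition affine_on_DeltaX :: "(real ^ 'k::finite) set \<Rightarrow> ((real ^ 'k) measure \<Rightarrow> real) \<Rightarrow> bool" where
  "affine_on_DeltaX X w \<longleftrightarrow> (\<forall>\<mu>\<in>DeltaX X. \<forall>\<nu>\<in>DeltaX X. \<forall>l\<in>{0..1}.
      w (mix l \<mu> \<nu>) = l * w \<mu> + (1 - l) * w \<nu>)"

definition graphF :: "(real ^ 'k::finite) set \<Rightarrow> 'a set \<Rightarrow> (real ^ 'k \<Rightarrow> 'a \<Rightarrow> (real ^ 'k) pmf)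
      \<Rightarrow> (real ^ 'k \<Rightarrow> 'a \<Rightarrow> real)
      \<Rightarrow> (((real ^ 'k) measure \<times> real) \<times> ((real ^ 'k) measure \<times> real)) set" where
  "graphF X A q g =
     {((emb u, y), (emb (bind_pmf u (\<lambda>x. bind_pmf (\<sigma> x) (q x))),
                    measure_pmf.expectation u (\<lambda>x. measure_pmf.expectation (\<sigma> x) (g x))))
      | u y \<sigma>. finite (set_pmf u) \<and> set_pmf u \<subseteq> X \<and> y \<in> {0..1} \<and>
              (\<forall>x\<in>X. finite (set_pmf (\<sigma> x)) \<and> set_pmf (\<sigma> x) \<subseteq> A)}"

definition RR :: "(real ^ 'k::finite) set \<Rightarrow> 'a set \<Rightarrow> (real ^ 'k \<Rightarrow> 'a \<Rightarrow> (real ^ 'k) pmf)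
      \<Rightarrow> (real ^ 'k \<Rightarrow> 'a \<Rightarrow> real) \<Rightarrow> ((real ^ 'k) measure \<times> real) set" where
  "RR X A q g =
     (let P = prod_topology (weak_star X) (top_of_set {0..1::real}) in
      {(u, y). u \<in> DeltaX X \<and> y \<in> {0..1} \<and>
               ((u, y), (u, y)) \<in> (prod_topology P P) closure_of (graphF X A q g)})"

definition vstar :: "(real ^ 'k::finite) set \<Rightarrow> 'a set \<Rightarrow> (real ^ 'k \<Rightarrow> 'a \<Rightarrow> (real ^ 'k) pmf)
      \<Rightarrow> (real ^ 'k \<Rightarrow> 'a \<Rightarrow> real) \<Rightarrow> real ^ 'k \<Rightarrow> real" where
  "vstar X A q g x = Inf {w (return borel x) | w.
      (\<forall>\<mu>\<in>DeltaX X. w \<mu> \<in> {0..1}) \<and>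
      affine_on_DeltaX X w \<and>
      continuous_map (weak_star X) euclideanreal w \<and>
      (\<forall>x'\<in>X. (SUP a\<in>A. w (emb (q x' a))) \<le> w (return borel x')) \<and>
      (\<forall>(u, y)\<in>RR X A q g. y \<le> w u)}"

end

theory Submission
  imports Defs
begin

text \<open>
  State-action laws of play are handled as flows: sequences of finitely supported laws \<open>J t\<close> on
  \<open>X \<times> A\<close> whose next-state law is the state marginal of \<open>J (t + 1)\<close>. By disintegration, flows are
  the same as Markov strategies and have the same stage payoffs as behaviour strategies, and they
  are stable under mixing.

  The hypotheses say that the one-step operators preserve \<open>D1\<close>. A finite-dimensional minimax argument
  turns this into a tracking property: a sequence of laws that is consistent up to summable errors,
  measured by the test functions \<open>D1\<close>, is followed by a true flow from any nearby initial law with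
  almost the same stage payoffs.

  Let \<open>V x\<close> be the limsup of \<open>v\<^sub>\<theta> x\<close> as the impatience of \<open>\<theta>\<close> tends to 0. Averaging nearly optimal flows
  from \<open>x\<close> over time gives almost invariant laws; a weak-* limit \<open>\<mu>\<close> of them satisfies \<open>(\<mu>, y) \<in> RR\<close>
  for some \<open>y \<ge> V x\<close>. Hence \<open>V x \<le> w \<mu> \<le> w (\<delta>\<^sub>x)\<close> for every \<open>w\<close> as in the statement. Moreover, stopping
  the nearly optimal flow at a random time produces a law close to \<open>\<mu>\<close>, and tracking allows the player
  to stay near \<open>\<mu>\<close> forever with stage payoff almost \<open>y\<close>; this strategy is good for all patient
  evaluations at once. Finally \<open>w = (\<mu> \<mapsto> \<integral> V d\<mu>)\<close> is itself admissible, again by tracking, so the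
  infimum is attained at \<open>V\<close>.
\<close>

section \<open>Finite minimax and finitely supported laws\<close>

text \<open>The actions carry no topology and the kernels of better and better play need not
  converge, so \<mu> need not be invariant under any strategy, and no play is ever run from \<mu>
  itself. Play follows approximants of \<mu> that change with the stage, and the question is how the
  mismatches between consecutive approximants accumulate. The hypotheses let a mismatch pass through
  a stage with factor 1, so errors add instead of growing: errors of order 2^-t are harmless over
  infinitely many stages, while a constant error is affordable only over a fixed horizon. The latter
  is enough for the Cesaro values, through which the integral of \<open>V\<close> is shown to be
  admissible.

  The test class fits because it is stable under the operations that the minimax step needs
  (averaging through \<open>q\<close>, convex combinations, suprema over actions) and because it is
  totally bounded in the sup norm on \<open>X\<close>, so that finitely many functions represent
  it.\<close>

text \<open>The family \<open>C\<close> may fail to be closed, so instead of using a minimiser, a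
  quantitative descent shows that the penalty \<open>\<phi>\<close>, the sum of squared negative
  parts, has infimum 0. At a point of positive penalty the normalised negative parts serve as
  weights in \<open>sup\<close>, and the point obtained there gives a direction of descent.\<close>

lemma convex_family_approaches_orthant:
  fixes C :: "('i \<Rightarrow> real) set"
  assumes I: "finite I" and ne: "C \<noteq> {}"
    and bnd: "\<And>c i. c \<in> C \<Longrightarrow> i \<in> I \<Longrightarrow> \<bar>c i\<bar> \<le> B"
    and conv: "\<And>c c' s. c \<in> C \<Longrightarrow> c' \<in> C \<Longrightarrow> 0 \<le> s \<Longrightarrow> s \<le> 1 \<Longrightarrow>
        \<exists>c''\<in>C. \<forall>i\<in>I. c'' i = (1 - s) * c i + s * c' i"
    and sup: "\<And>l \<epsilon>. (\<And>i. i \<in> I \<Longrightarrow> 0 \<le> l i) \<Longrightarrow> sum l I = 1 \<Longrightarrow> 0 < \<epsilon> \<Longrightarrow>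
        \<exists>c\<in>C. - \<epsilon> \<le> (\<Sum>i\<in>I. l i * c i)"
    and \<eta>: "0 < \<eta>"
  shows "\<exists>c\<in>C. \<forall>i\<in>I. - \<eta> \<le> c i"
proof -
  define r where "r c i = max 0 (- c i)" for c :: "'i \<Rightarrow> real" and i
  define \<phi> where "\<phi> c = (\<Sum>i\<in>I. (r c i)\<^sup>2)" for c
  \<comment> \<open>\<open>Q\<close> bounds both the penalty and the squared length of a
    displacement inside \<open>C\<close>; the added 1 keeps it positive in degenerate cases.\<close>
  define Q where "Q = card I * (2 * B)\<^sup>2 + 1"
  define m where "m = Inf (\<phi> ` C)"
  have \<phi>0: "0 \<le> \<phi> c" for c by (auto simp: \<phi>_def intro!: sum_nonneg)
  have bdd: "bdd_below (\<phi> ` C)" using \<phi>0 by (auto intro!: bdd_belowI2)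
  have m0: "0 \<le> m" unfolding m_def using ne \<phi>0 by (auto intro!: cINF_greatest)
  have mle: "m \<le> \<phi> c" if "c \<in> C" for c unfolding m_def using bdd that by (auto intro!: cINF_lower)
  have Q1: "1 \<le> Q" by (simp add: Q_def)
  have descent: "\<exists>c'\<in>C. \<phi> c' \<le> \<phi> c - (\<phi> c)\<^sup>2 / (4 * Q)" if c: "c \<in> C" and p0: "0 < \<phi> c" for c
  proof -
    define p where "p = \<phi> c"
    define R where "R = (\<Sum>i\<in>I. r c i)"
    have r0: "0 \<le> r c i" for i by (simp add: r_def)
    have "R \<noteq> 0"
    proof
      assume "R = 0"
      then have "\<forall>i\<in>I. r c i = 0" using I r0 by (simp add: R_def sum_nonneg_eq_0_iff)
      then show False using p0 by (simp add: \<phi>_def)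
    qed
    then have R0: "0 < R" using r0 by (simp add: R_def less_le sum_nonneg)
    have "(\<Sum>i\<in>I. r c i / R) = 1" using R0 by (simp add: sum_divide_distrib[symmetric] R_def)
    \<comment> \<open>Multiplied back by \<open>R\<close>, this tolerance gives away only half of
      the slope \<open>p\<close>.\<close>
    moreover have "0 < p / (2 * R)" using R0 p0 by (simp add: p_def)
    moreover have "0 \<le> r c i / R" for i using R0 r0 by simp
    ultimately obtain c' where c': "c' \<in> C" "- (p / (2 * R)) \<le> (\<Sum>i\<in>I. r c i / R * c' i)"
      using sup[of "\<lambda>i. r c i / R" "p / (2 * R)"] by blast
    have "(\<Sum>i\<in>I. r c i / R * c' i) = (\<Sum>i\<in>I. r c i * c' i) / R" by (simp add: sum_divide_distrib)
    with c'(2) have "- (p / (2 * R)) * R \<le> (\<Sum>i\<in>I. r c i * c' i)" using R0 by (simp add: field_simps)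
    then have rc': "- p / 2 \<le> (\<Sum>i\<in>I. r c i * c' i)" using R0 by simp
    have "(\<Sum>i\<in>I. r c i * c i) = - p"
      unfolding p_def \<phi>_def sum_negf[symmetric] by (rule sum.cong) (auto simp: r_def power2_eq_square max_def)
    then have rd: "p / 2 \<le> (\<Sum>i\<in>I. r c i * (c' i - c i))"
      using rc' by (simp add: algebra_simps sum_subtractf)
    have dQ: "(\<Sum>i\<in>I. (c' i - c i)\<^sup>2) \<le> Q"
    proof -
      have "(c' i - c i)\<^sup>2 \<le> (2 * B)\<^sup>2" if "i \<in> I" for i
      proof -
        have "\<bar>c' i - c i\<bar> \<le> \<bar>2 * B\<bar>" using bnd[OF c that] bnd[OF c'(1) that] by linarith
        then show ?thesis by (simp add: abs_le_square_iff)
      qed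
      from sum_bounded_above[of I "\<lambda>i. (c' i - c i)\<^sup>2", OF this] show ?thesis by (simp add: Q_def)
    qed
    have pQ: "p \<le> Q"
    proof -
      have "(r c i)\<^sup>2 \<le> (2 * B)\<^sup>2" if "i \<in> I" for i
      proof -
        have "\<bar>r c i\<bar> \<le> \<bar>2 * B\<bar>" using bnd[OF c that] by (simp add: r_def)
        then show ?thesis by (simp add: abs_le_square_iff)
      qed
      from sum_bounded_above[of I "\<lambda>i. (r c i)\<^sup>2", OF this] show ?thesis by (simp add: Q_def p_def \<phi>_def)
    qed
    \<comment> \<open>This step length minimises \<open>p - s * p + s\<^sup>2 * Q\<close>, and
      \<open>p \<le> Q\<close> keeps it in the unit interval.\<close>
    define s where "s = p / (2 * Q)"
    have s: "0 \<le> s" "s \<le> 1" using p0 pQ Q1 by (auto simp: s_def p_def)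
    obtain c'' where c'': "c'' \<in> C" "\<And>i. i \<in> I \<Longrightarrow> c'' i = (1 - s) * c i + s * c' i"
      using conv[OF c c'(1) s] by blast
    have "\<phi> c'' \<le> (\<Sum>i\<in>I. (r c i - s * (c' i - c i))\<^sup>2)"
      unfolding \<phi>_def
    proof (rule sum_mono)
      fix i assume i: "i \<in> I"
      \<comment> \<open>Only \<open>- c i \<le> r c i\<close> enters, so coordinates that are
        already positive need no separate case.\<close>
      have "\<bar>r c'' i\<bar> \<le> \<bar>r c i - s * (c' i - c i)\<bar>"
      proof -
        have "- c i \<le> r c i" "c'' i = c i + s * (c' i - c i)"
          using c''(2)[OF i] by (simp_all add: r_def algebra_simps)
        then show ?thesis unfolding r_def[of c''] by linarith
      qed
      then show "(r c'' i)\<^sup>2 \<le> (r c i - s * (c' i - c i))\<^sup>2" by (simp add: abs_le_square_iff)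
    qed
    also have "\<dots> = p - 2 * s * (\<Sum>i\<in>I. r c i * (c' i - c i)) + s\<^sup>2 * (\<Sum>i\<in>I. (c' i - c i)\<^sup>2)"
      unfolding p_def \<phi>_def sum_distrib_left sum_subtractf[symmetric] sum.distrib[symmetric]
      by (rule sum.cong) (auto simp: power2_eq_square algebra_simps)
    also have "\<dots> \<le> p - 2 * s * (p / 2) + s\<^sup>2 * Q"
      using rd dQ s by (intro add_mono diff_mono mult_left_mono) auto
    also have "\<dots> = p - p\<^sup>2 / (4 * Q)"
      using Q1 by (simp add: s_def power2_eq_square field_simps)
    finally show ?thesis using c''(1) p_def by blast
  qed
  have "m = 0"
  proof (rule ccontr)
    assume "m \<noteq> 0"
    then have mp: "0 < m" using m0 by simp
    have "m < m + m\<^sup>2 / (4 * Q)" using mp Q1 by simp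
    then obtain c where c: "c \<in> C" "\<phi> c < m + m\<^sup>2 / (4 * Q)"
      using cINF_less_iff[OF ne bdd, of "m + m\<^sup>2 / (4 * Q)"] unfolding m_def by blast
    then obtain c' where c': "c' \<in> C" "\<phi> c' \<le> \<phi> c - (\<phi> c)\<^sup>2 / (4 * Q)"
      using descent[of c] less_le_trans[OF mp mle[of c]] by blast
    have "m\<^sup>2 / (4 * Q) \<le> (\<phi> c)\<^sup>2 / (4 * Q)"
      using mle[OF c(1)] mp Q1 by (intro divide_right_mono power_mono) auto
    then show False using c(2) c' mle[OF c'(1)] by linarith
  qed
  then have "Inf (\<phi> ` C) < \<eta>\<^sup>2" using \<eta> by (simp add: m_def)
  then obtain c where c: "c \<in> C" "\<phi> c < \<eta>\<^sup>2"
    using cINF_less_iff[OF ne bdd] by auto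
  have "- \<eta> \<le> c i" if i: "i \<in> I" for i
  proof -
    have "(r c i)\<^sup>2 \<le> \<phi> c" unfolding \<phi>_def using I i by (intro member_le_sum) auto
    then have "(r c i)\<^sup>2 \<le> \<eta>\<^sup>2" using c by simp
    then have "r c i \<le> \<eta>" by (rule power2_le_imp_le) (use \<eta> in simp)
    then show ?thesis by (simp add: r_def)
  qed
  then show ?thesis using c(1) by blast
qed

section \<open>Expectations, mixtures and disintegration of finitely supported laws\<close>

definition fin_on :: "'b set \<Rightarrow> 'b pmf \<Rightarrow> bool" where
  "fin_on S u \<longleftrightarrow> finite (set_pmf u) \<and> set_pmf u \<subseteq> S"

abbreviation expect :: "'b pmf \<Rightarrow> ('b \<Rightarrow> real) \<Rightarrow> real" where
  "expect u f \<equiv> measure_pmf.expectation u f"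

lemma expect_sum: "finite (set_pmf u) \<Longrightarrow> expect u f = (\<Sum>x\<in>set_pmf u. pmf u x * f x)"
  by (subst integral_measure_pmf_real[of "set_pmf u"]) (auto simp: mult.commute)

lemma expect_cong: "(\<And>x. x \<in> set_pmf u \<Longrightarrow> f x = f' x) \<Longrightarrow> expect u f = expect u f'"
  by (intro integral_cong_AE) (auto simp: AE_measure_pmf_iff)

lemma expect_mono: "finite (set_pmf u) \<Longrightarrow> (\<And>x. x \<in> set_pmf u \<Longrightarrow> f x \<le> f' x) \<Longrightarrow> expect u f \<le> expect u f'"
  by (simp add: expect_sum sum_mono mult_left_mono)

lemma expect_add: "finite (set_pmf u) \<Longrightarrow> expect u (\<lambda>x. f x + f' x) = expect u f + expect u f'"
  by (simp add: expect_sum sum.distrib algebra_simps)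

lemma expect_diff: "finite (set_pmf u) \<Longrightarrow> expect u (\<lambda>x. f x - f' x) = expect u f - expect u f'"
  by (simp add: expect_sum sum_subtractf algebra_simps)

lemma expect_cmult: "expect u (\<lambda>x. c * f x) = c * expect u f"
  by simp

lemma expect_sum_fun: "finite (set_pmf u) \<Longrightarrow> expect u (\<lambda>x. \<Sum>i\<in>I. F i x) = (\<Sum>i\<in>I. expect u (F i))"
  by (simp add: expect_sum sum_distrib_left) (rule sum.swap)

lemma expect_abs_le:
  assumes "finite (set_pmf u)" "\<And>x. x \<in> set_pmf u \<Longrightarrow> \<bar>f x\<bar> \<le> c"
  shows "\<bar>expect u f\<bar> \<le> c"
proof -
  have "expect u f \<le> expect u (\<lambda>x. c)"
    using assms by (intro expect_mono) (auto simp: abs_le_iff)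
  moreover have "expect u (\<lambda>x. - c) \<le> expect u f"
    using assms by (intro expect_mono) (auto simp: abs_le_iff minus_le_iff)
  ultimately show ?thesis by simp
qed

lemma expect_bind:
  assumes "finite (set_pmf p)" "\<And>x. x \<in> set_pmf p \<Longrightarrow> finite (set_pmf (f x))"
  shows "expect (bind_pmf p f) h = expect p (\<lambda>x. expect (f x) h)"
  by (subst pmf_expectation_bind[of "set_pmf p"]) (use assms in \<open>auto simp: expect_sum\<close>)

lemma fin_on_bind:
  "fin_on S p \<Longrightarrow> (\<And>x. x \<in> S \<Longrightarrow> fin_on T (f x)) \<Longrightarrow> fin_on T (bind_pmf p f)"
  unfolding fin_on_def by (auto simp: subset_iff)

lemma fin_on_map: "fin_on S p \<Longrightarrow> (\<And>x. x \<in> S \<Longrightarrow> f x \<in> T) \<Longrightarrow> fin_on T (map_pmf f p)"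
  unfolding fin_on_def by auto

lemma fin_on_return: "x \<in> S \<Longrightarrow> fin_on S (return_pmf x)"
  by (simp add: fin_on_def)

definition two_mix :: "real \<Rightarrow> 'b pmf \<Rightarrow> 'b pmf \<Rightarrow> 'b pmf" where
  "two_mix l u v = bind_pmf (bernoulli_pmf l) (\<lambda>b. if b then u else v)"

lemma expect_two_mix:
  assumes "0 \<le> l" "l \<le> 1" "finite (set_pmf u)" "finite (set_pmf v)"
  shows "expect (two_mix l u v) f = l * expect u f + (1 - l) * expect v f"
  unfolding two_mix_def using assms by (subst expect_bind) auto

lemma pmf_two_mix:
  assumes "0 \<le> l" "l \<le> 1"
  shows "pmf (two_mix l u v) y = l * pmf u y + (1 - l) * pmf v y"
  unfolding two_mix_def using assms by (simp add: pmf_bind)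

text \<open>Peeling off one atom writes \<open>u\<close> as a mixture of a Dirac law and of
  \<open>u\<close> conditioned on the remaining points. The rule upgrades affinity, which speaks of
  two-term mixtures only, to finite averages.\<close>

lemma finite_pmf_two_mix_induct [consumes 2, case_names return mix]:
  assumes S: "finite S" "set_pmf u \<subseteq> S"
    and ret: "\<And>x. x \<in> S \<Longrightarrow> P (return_pmf x)"
    and mix: "\<And>l u v. 0 \<le> l \<Longrightarrow> l \<le> 1 \<Longrightarrow> fin_on S u \<Longrightarrow> fin_on S v \<Longrightarrow> P u \<Longrightarrow> P v \<Longrightarrow> P (two_mix l u v)"
  shows "P u"
proof -
  have "finite T \<Longrightarrow> T \<subseteq> S \<Longrightarrow> set_pmf u \<subseteq> T \<Longrightarrow> P u" for T u
  proof (induction T arbitrary: u rule: finite_induct)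
    case empty then show ?case by (simp add: set_pmf_not_empty)
  next
    case (insert x T)
    show ?case
    proof (cases "set_pmf u \<inter> - {x} = {}")
      case True
      then have "set_pmf u \<subseteq> {x}" by auto
      then have "u = return_pmf x" by (simp add: set_pmf_subset_singleton)
      then show ?thesis using ret insert by auto
    next
      case False
      define v where "v = cond_pmf u (- {x})"
      have setv: "set_pmf v = set_pmf u \<inter> - {x}" unfolding v_def by (rule set_cond_pmf[OF False])
      have Pv: "P v" using setv insert by (intro insert.IH) auto
      have mx: "measure u (- {x}) = 1 - pmf u x"
        using measure_pmf.prob_compl[of "{x}" u] by (simp add: measure_pmf_single Compl_eq_Diff_UNIV)
      have pos: "1 - pmf u x > 0"
        using False mx by (metis measure_measure_pmf_not_zero measure_nonneg less_le)
      have "u = two_mix (pmf u x) (return_pmf x) v"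
        by (rule pmf_eqI) (use pos in \<open>auto simp: pmf_two_mix pmf_le_1 v_def pmf_cond[OF False] mx indicator_def\<close>)
      moreover have "fin_on S v" using setv insert finite_subset[OF insert.prems(2)] by (auto simp: fin_on_def)
      ultimately show ?thesis
        using mix[OF pmf_nonneg pmf_le_1 fin_on_return _ ret Pv, of x u x] insert by auto
    qed
  qed
  then show ?thesis using S by blast
qed

text \<open>\<open>\<sigma> x\<close> is the conditional law of the action given the state. A joint
  law is thereby turned back into a kernel, the form in which strategies and \<open>graphF\<close>
  are stated; the default action \<open>a\<close> makes the kernel legal off the support as
  well.\<close>

lemma pmf_disintegration:
  fixes K :: "('a \<times> 'b) pmf"
  assumes K: "fin_on (X \<times> A) K" and a: "a \<in> A"
  obtains \<sigma> where "\<And>x. fin_on A (\<sigma> x)"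
    "K = bind_pmf (map_pmf fst K) (\<lambda>x. map_pmf (Pair x) (\<sigma> x))"
proof
  define \<sigma> where "\<sigma> x = (if x \<in> fst ` set_pmf K then map_pmf snd (cond_pmf K {xa. x = fst xa}) else return_pmf a)" for x
  have set: "set_pmf (cond_pmf K {xa. x = fst xa}) = set_pmf K \<inter> {xa. x = fst xa}" if "x \<in> fst ` set_pmf K" for x
    by (rule set_cond_pmf) (use that in auto)
  show "fin_on A (\<sigma> x)" for x
    using K a set[of x] by (auto simp: \<sigma>_def fin_on_def)
  have "bind_pmf (map_pmf fst K) (\<lambda>x. map_pmf (Pair x) (\<sigma> x)) = bind_pmf (map_pmf fst K) (\<lambda>x. cond_pmf K {xa. x = fst xa})"
  proof (intro bind_pmf_cong refl)
    fix x assume "x \<in> set_pmf (map_pmf fst K)"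
    then have x: "x \<in> fst ` set_pmf K" by simp
    have "map_pmf (Pair x) (\<sigma> x) = map_pmf (\<lambda>xa. (x, snd xa)) (cond_pmf K {xa. x = fst xa})"
      using x by (simp add: \<sigma>_def map_pmf_comp)
    also have "\<dots> = map_pmf (\<lambda>xa. xa) (cond_pmf K {xa. x = fst xa})"
      by (rule map_pmf_cong) (auto simp: set[OF x])
    finally show "map_pmf (Pair x) (\<sigma> x) = cond_pmf K {xa. x = fst xa}" by simp
  qed
  also have "\<dots> = K"
  proof (rule bind_cond_pmf_cancel)
    fix x and y :: "'a \<times> 'b" assume "x = fst y"
    then show "measure (measure_pmf K) {y. x = fst y} = measure (measure_pmf (map_pmf fst K)) {x. x = fst y}"
      by (simp add: vimage_def eq_commute)
  qed auto
  finally show "K = bind_pmf (map_pmf fst K) (\<lambda>x. map_pmf (Pair x) (\<sigma> x))" by simp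
qed

section \<open>Weak sequential compactness\<close>

text \<open>Base-3 expansions with digits 0 and 1 have gaps, so the code of a point determines,
  uniformly, a long initial segment of its digits.\<close>
lemma ternary_code:
  fixes d :: "nat \<Rightarrow> 'b \<Rightarrow> bool"
  defines "s \<equiv> \<lambda>x. \<Sum>j. (if d j x then 1 else 0) * (1/3::real)^j"
  shows "0 \<le> s x" "s x \<le> 3/2"
    and "\<bar>s x - s y\<bar> < (1/3)^J / 2 \<Longrightarrow> j < J \<Longrightarrow> d j x = d j y"
proof -
  have geo: "(\<lambda>j. (1/3::real)^j) sums (3/2)" using geometric_sums[of "1/3::real"] by simp
  have sm: "summable (\<lambda>j. (if d j x then 1 else 0) * (1/3::real)^j)" for x
    by (rule summable_comparison_test'[OF sums_summable[OF geo]]) auto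
  show "0 \<le> s x" unfolding s_def by (intro suminf_nonneg sm) auto
  have "s x \<le> (\<Sum>j. (1/3::real)^j)" unfolding s_def
    by (intro suminf_le sm sums_summable[OF geo]) auto
  then show "s x \<le> 3/2" using sums_unique[OF geo] by simp
  \<comment> \<open>At the first differing digit \<open>i\<close> the difference gains
    \<open>(1/3)^i\<close>, and all later digits together can cancel at most
    \<open>(1/3)^Suc i * (3/2)\<close>, which is half of it.\<close>
  have sep: "(1/3)^i / 2 \<le> s x - s y" if ag: "\<And>l. l < i \<Longrightarrow> d l x = d l y" and di: "d i x" "\<not> d i y" for i x y
  proof -
    define c where "c j = ((if d j x then 1 else 0) - (if d j y then 1 else 0)) * (1/3::real)^j" for j
    have cs: "c sums (s x - s y)"
      unfolding s_def c_def left_diff_distrib by (intro sums_diff summable_sums sm)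
    have z: "(\<Sum>j<Suc i. c j) = (1/3)^i"
    proof -
      have "(\<Sum>j<i. c j) = 0" by (rule sum.neutral) (auto simp: c_def ag)
      then show ?thesis using di by (simp add: c_def)
    qed
    have tail: "(\<lambda>j. c (j + Suc i)) sums (s x - s y - (1/3)^i)"
      using sums_split_initial_segment[OF cs, of "Suc i"] z by simp
    have g2: "(\<lambda>j. - ((1/3::real)^Suc i * (1/3)^j)) sums (- ((1/3)^Suc i * (3/2)))"
      by (intro sums_minus sums_mult geo)
    have "- ((1/3)^Suc i * (3/2)) \<le> s x - s y - (1/3::real)^i"
    proof (rule sums_le[OF _ g2 tail])
      fix j
      have "- (1 * (1/3::real)^(j + Suc i)) \<le> c (j + Suc i)" by (auto simp: c_def)
      then show "- ((1/3::real)^Suc i * (1/3)^j) \<le> c (j + Suc i)" by (simp add: power_add mult_ac)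
    qed
    then show ?thesis by simp
  qed
  show "d j x = d j y" if c: "\<bar>s x - s y\<bar> < (1/3)^J / 2" and j: "j < J"
  proof (rule ccontr)
    assume ne: "d j x \<noteq> d j y"
    define i where "i = (LEAST i. d i x \<noteq> d i y)"
    have i: "d i x \<noteq> d i y" unfolding i_def by (rule LeastI[of "\<lambda>i. d i x \<noteq> d i y", OF ne])
    have ag: "d l x = d l y" if "l < i" for l using not_less_Least[of l "\<lambda>i. d i x \<noteq> d i y"] that i_def by auto
    have "i \<le> j" unfolding i_def by (rule Least_le) (rule ne)
    then have "(1/3::real)^J \<le> (1/3)^i" using j by (intro power_decreasing) auto
    moreover have "(1/3)^i / 2 \<le> \<bar>s x - s y\<bar>"
      using sep[of i x y] sep[of i y x] i ag by (cases "d i x") (auto simp: abs_real_def)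
    ultimately show False using c by linarith
  qed
qed

text \<open>The digits of a point record its membership in balls of radii \<open>1 / Suc m\<close>
  around a countable dense set. For given \<delta>, compactness selects finitely many balls of one
  small radius that cover \<open>X\<close>, so a bounded number of digits decides closeness
  uniformly on \<open>X\<close>.\<close>

lemma compact_separating_digits:
  fixes X :: "'b::euclidean_space set"
  assumes "compact X"
  obtains d :: "nat \<Rightarrow> 'b \<Rightarrow> bool" where
    "\<And>\<delta>. 0 < \<delta> \<Longrightarrow> \<exists>J. \<forall>x\<in>X. \<forall>y\<in>X. (\<forall>j<J. d j x = d j y) \<longrightarrow> dist x y < \<delta>"
proof -
  obtain D :: "'b set" where D: "countable D" "\<And>U. open U \<Longrightarrow> U \<noteq> {} \<Longrightarrow> \<exists>c\<in>D. c \<in> U"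
    using countable_dense_exists by blast
  have "D \<noteq> {}" using D(2)[of UNIV] by auto
  define c where "c = from_nat_into D"
  define d where "d j x = (dist (c (fst (prod_decode j))) x < 1 / Suc (snd (prod_decode j)))" for j x
  have "\<exists>J. \<forall>x\<in>X. \<forall>y\<in>X. (\<forall>j<J. d j x = d j y) \<longrightarrow> dist x y < \<delta>" if \<delta>: "0 < \<delta>" for \<delta>
  proof -
    obtain m where m: "1 / Suc m < \<delta> / 2" using \<delta> by (metis half_gt_zero nat_approx_posE)
    have "X \<subseteq> (\<Union>i. ball (c i) (1 / Suc m))"
    proof
      fix x assume "x \<in> X"
      obtain z where z: "z \<in> D" "z \<in> ball x (1 / Suc m)" using D(2)[of "ball x (1 / Suc m)"] by auto
      then obtain i where "z = c i" using D(1) \<open>D \<noteq> {}\<close> by (metis c_def from_nat_into_surj)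
      then show "x \<in> (\<Union>i. ball (c i) (1 / Suc m))" using z by (auto simp: dist_commute)
    qed
    then obtain I where I: "finite I" "X \<subseteq> (\<Union>i\<in>I. ball (c i) (1 / Suc m))"
      using compactE_image[OF assms, of UNIV "\<lambda>i. ball (c i) (1 / Suc m)"] by auto
    define J where "J = Suc (Max (insert 0 ((\<lambda>i. prod_encode (i, m)) ` I)))"
    have "dist x y < \<delta>" if x: "x \<in> X" and y: "y \<in> X" and ag: "\<forall>j<J. d j x = d j y" for x y
    proof -
      obtain i where i: "i \<in> I" "dist (c i) x < 1 / Suc m" using I(2) x by auto
      have "prod_encode (i, m) < J" unfolding J_def less_Suc_eq_le using I(1) i by (intro Max_ge) auto
      then have "d (prod_encode (i, m)) y" using ag i by (auto simp: d_def)
      then have "dist (c i) y < 1 / Suc m" by (simp add: d_def)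
      then show ?thesis using i m dist_triangle3[of x y "c i"] by linarith
    qed
    then show ?thesis by blast
  qed
  then show ?thesis using that by blast
qed

text \<open>Sequential weak compactness in several dimensions is reduced to Helly's selection
  theorem on the line by coding the points of the compact set as reals.\<close>
lemma finite_pmf_weak_limit:
  fixes X :: "(real ^ 'k::finite) set" and u :: "nat \<Rightarrow> (real ^ 'k) pmf"
  assumes X: "compact X" and u: "\<And>n. fin_on X (u n)"
  obtains r :: "nat \<Rightarrow> nat" and \<mu> where "strict_mono r" "\<mu> \<in> DeltaX X"
    "\<And>h. continuous_on X h \<Longrightarrow> (\<lambda>n. expect (u (r n)) h) \<longlonglongrightarrow> set_lebesgue_integral \<mu> X h"
proof -
  obtain x0 where x0: "x0 \<in> X" using u[of 0] set_pmf_not_empty[of "u 0"] by (auto simp: fin_on_def)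
  obtain d :: "nat \<Rightarrow> real ^ 'k \<Rightarrow> bool" where d:
    "\<And>\<delta>. 0 < \<delta> \<Longrightarrow> \<exists>J. \<forall>x\<in>X. \<forall>y\<in>X. (\<forall>j<J. d j x = d j y) \<longrightarrow> dist x y < \<delta>"
    using compact_separating_digits[OF X] by blast
  define s where "s x = (\<Sum>j. (if d j x then 1 else 0) * (1/3::real)^j)" for x
  note s = ternary_code[of d, folded s_def]
  have s_close: "\<exists>e>0. \<forall>x\<in>X. \<forall>y\<in>X. \<bar>s x - s y\<bar> < e \<longrightarrow> dist x y < \<delta>" if \<delta>: "0 < \<delta>" for \<delta>
  proof -
    obtain J where J: "\<forall>x\<in>X. \<forall>y\<in>X. (\<forall>j<J. d j x = d j y) \<longrightarrow> dist x y < \<delta>" using d[OF \<delta>] by blast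
    have "dist x y < \<delta>" if "x \<in> X" "y \<in> X" "\<bar>s x - s y\<bar> < (1/3)^J / 2" for x y
      using J s(3)[OF that(3)] that by blast
    moreover have "(0::real) < (1/3)^J / 2" by simp
    ultimately show ?thesis by blast
  qed
  have inj: "inj_on s X"
  proof (rule inj_onI)
    fix x y assume xy: "x \<in> X" "y \<in> X" "s x = s y"
    show "x = y"
    proof (rule ccontr)
      assume "x \<noteq> y"
      then obtain e where "e > 0" "\<forall>x'\<in>X. \<forall>y'\<in>X. \<bar>s x' - s y'\<bar> < e \<longrightarrow> dist x' y' < dist x y"
        using s_close[of "dist x y"] by auto
      then show False using xy by (metis abs_zero diff_self less_irrefl)
    qed
  qed
  \<comment> \<open>The code \<open>s\<close> may be discontinuous; what matters is its inverse,
    along which test functions are pulled back to the line. By \<open>s_close\<close> the inverse is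
    uniformly continuous, hence extends to the closure of the codes.\<close>
  define f where "f = inv_into X s"
  have fs: "f (s x) = x" if "x \<in> X" for x using inj that by (simp add: f_def)
  have "uniformly_continuous_on (s ` X) f"
    unfolding uniformly_continuous_on_def
  proof (intro allI impI)
    fix \<delta> :: real assume "0 < \<delta>"
    from s_close[OF this] show "\<exists>e>0. \<forall>a\<in>s ` X. \<forall>b\<in>s ` X. dist b a < e \<longrightarrow> dist (f b) (f a) < \<delta>"
      by (auto simp: fs dist_real_def)
  qed
  then obtain \<phi> where \<phi>: "uniformly_continuous_on (closure (s ` X)) \<phi>" "\<And>t. t \<in> s ` X \<Longrightarrow> f t = \<phi> t"
    using uniformly_continuous_on_extension_on_closure by metis
  define C where "C = closure (s ` X)"
  have C: "closed C" "C \<noteq> {}" "s ` X \<subseteq> C" using x0 closure_subset[of "s ` X"] by (auto simp: C_def)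
  have \<phi>c: "continuous_on C \<phi>" using \<phi>(1) by (simp add: C_def uniformly_continuous_imp_continuous)
  have \<phi>s: "\<phi> (s x) = x" if "x \<in> X" for x using \<phi>(2)[of "s x"] fs that by auto
  have \<phi>X: "\<phi> t \<in> X" if "t \<in> C" for t
  proof -
    have "\<phi> ` C \<subseteq> X" unfolding C_def
      by (rule image_closure_subset) (use \<phi>c \<phi>s X compact_imp_closed in \<open>auto simp: C_def\<close>)
    then show ?thesis using that by auto
  qed
  define \<nu> where "\<nu> n = distr (measure_pmf (u n)) borel s" for n
  have rd: "real_distribution (\<nu> n)" for n
    unfolding \<nu>_def by (rule prob_space.real_distribution_distr) (simp_all add: measure_pmf.prob_space_axioms)
  have int\<nu>: "integral\<^sup>L (\<nu> n) F = expect (u n) (\<lambda>x. F (s x))" if "F \<in> borel_measurable borel" for F :: "real \<Rightarrow> real" and n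
    unfolding \<nu>_def using that by (subst integral_distr) auto
  have "tight \<nu>"
    unfolding tight_def
  proof (intro conjI allI impI rd)
    fix \<epsilon> :: real assume "0 < \<epsilon>"
    have "measure (\<nu> n) {-1<..2} = 1" for n
    proof -
      have "s x \<in> {-1<..2}" for x using s(1)[of x] s(2)[of x] by simp
      then have "s -` {-1<..2} = UNIV" by auto
      then show ?thesis unfolding \<nu>_def by (subst measure_distr) auto
    qed
    then show "\<exists>a b. a < b \<and> (\<forall>n. 1 - \<epsilon> < measure (\<nu> n) {a<..b})"
      using \<open>0 < \<epsilon>\<close> by (intro exI[of _ "-1"] exI[of _ 2]) auto
  qed
  from tight_imp_convergent_subsubsequence[OF this strict_mono_id]
  obtain r M where r: "strict_mono (r :: nat \<Rightarrow> nat)" and M: "real_distribution M" and wc: "weak_conv_m (\<nu> \<circ> id \<circ> r) M"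
    by blast
  interpret M: real_distribution M by (rule M)
  have conv: "(\<lambda>n. expect (u (r n)) (\<lambda>x. F (s x))) \<longlonglongrightarrow> integral\<^sup>L M F"
    if F: "continuous_on UNIV F" and b: "\<And>t. \<bar>F t\<bar> \<le> B" for F :: "real \<Rightarrow> real" and B
  proof -
    have "(\<lambda>n. integral\<^sup>L ((\<nu> \<circ> id \<circ> r) n) F) \<longlonglongrightarrow> integral\<^sup>L M F"
      by (rule weak_conv_imp_integral_bdd_continuous_conv[where B=B])
        (use wc rd M F b in \<open>auto simp: continuous_on_eq_continuous_at o_def\<close>)
    moreover have "F \<in> borel_measurable borel" using F by (rule borel_measurable_continuous_onI)
    ultimately show ?thesis by (simp add: int\<nu>)
  qed
  \<comment> \<open>The truncated distance to \<open>C\<close> is bounded and continuous and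
    vanishes at every code, so its integral under the limit \<open>M\<close> is 0.\<close>
  have MC: "AE t in M. t \<in> C"
  proof -
    define D where "D t = min 1 (infdist t C)" for t :: real
    have Dc: "continuous_on UNIV D" unfolding D_def by (intro continuous_intros)
    have Db: "\<bar>D t\<bar> \<le> 1" for t using infdist_nonneg[of t C] by (simp add: D_def)
    have "expect (u n) (\<lambda>x. D (s x)) = expect (u n) (\<lambda>x. 0)" for n
      by (rule expect_cong) (use u[of n] C in \<open>auto simp: D_def fin_on_def image_subset_iff subset_iff\<close>)
    with conv[OF Dc Db] have "(\<lambda>n::nat. 0) \<longlonglongrightarrow> integral\<^sup>L M D" by simp
    then have "integral\<^sup>L M D = 0" by (simp add: LIMSEQ_const_iff)
    moreover have Dm: "D \<in> borel_measurable M" using borel_measurable_continuous_onI[OF Dc] by simp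
    moreover have "integrable M D" by (rule M.integrable_const_bound[where B=1]) (use Db Dm in auto)
    ultimately have "AE t in M. D t = 0"
      by (subst (asm) integral_nonneg_eq_0_iff_AE) (auto simp: D_def infdist_nonneg)
    then show ?thesis
      by eventually_elim (use C in_closed_iff_infdist_zero[of C] in \<open>auto simp: D_def min_def split: if_splits\<close>)
  qed
  \<comment> \<open>The complement of \<open>C\<close> is null for \<open>M\<close>; the value
    \<open>x0\<close> there makes \<open>\<psi>\<close> map the whole line into
    \<open>X\<close>.\<close>
  define \<psi> where "\<psi> t = (if t \<in> C then \<phi> t else x0)" for t
  have \<psi>X: "\<psi> t \<in> X" for t using \<phi>X x0 by (simp add: \<psi>_def)
  have \<psi>m: "\<psi> \<in> measurable M borel"
  proof -
    have "(\<lambda>t. if t \<in> C then \<phi> t else x0) \<in> borel_measurable borel"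
      by (rule borel_measurable_continuous_on_if) (use C \<phi>c in auto)
    then show ?thesis by (simp add: \<psi>_def[abs_def])
  qed
  define \<mu> where "\<mu> = distr M borel \<psi>"
  have Xb: "X \<in> sets borel" using compact_imp_closed[OF X] by auto
  have "prob_space \<mu>" unfolding \<mu>_def by (rule M.prob_space_distr[OF \<psi>m])
  moreover have "emeasure \<mu> X = 1"
  proof -
    have "\<psi> -` X \<inter> space M = space M" using \<psi>X by auto
    then show ?thesis unfolding \<mu>_def using \<psi>m Xb by (subst emeasure_distr) (auto simp: M.emeasure_space_1[simplified])
  qed
  ultimately have \<mu>: "\<mu> \<in> DeltaX X" by (simp add: DeltaX_def \<mu>_def)
  have "(\<lambda>n. expect (u (r n)) h) \<longlonglongrightarrow> set_lebesgue_integral \<mu> X h" if h: "continuous_on X h" for h :: "real ^ 'k \<Rightarrow> real"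
  proof -
    have "bounded (h ` X)" using X h compact_continuous_image compact_imp_bounded by blast
    then obtain B where B: "\<And>x. x \<in> X \<Longrightarrow> \<bar>h x\<bar> \<le> B" by (auto simp: bounded_iff)
    have B0: "0 \<le> B" using B[OF x0] by simp
    have "continuous_on C (\<lambda>t. h (\<phi> t))"
      by (rule continuous_on_compose2[OF h \<phi>c]) (use \<phi>X in auto)
    \<comment> \<open>Weak convergence on the line tests bounded continuous functions on all of it,
      so the pullback of \<open>h\<close> is extended from \<open>C\<close> with the same
      bound.\<close>
    then obtain F where F: "continuous_on UNIV F" "\<And>t. t \<in> C \<Longrightarrow> F t = h (\<phi> t)" "\<And>t. norm (F t) \<le> B"
      using Tietze[of C "\<lambda>t. h (\<phi> t)" UNIV B] C(1) B B0 \<phi>X by (metis UNIV_I closed_closedin real_norm_def subtopology_UNIV)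
    have "expect (u n) (\<lambda>x. F (s x)) = expect (u n) h" for n
    proof (rule expect_cong)
      fix x assume "x \<in> set_pmf (u n)"
      then have "x \<in> X" using u[of n] by (auto simp: fin_on_def)
      then show "F (s x) = h x" using F(2)[of "s x"] C(3) \<phi>s by auto
    qed
    moreover have "integral\<^sup>L M F = set_lebesgue_integral \<mu> X h"
    proof -
      have "(\<lambda>x. indicator X x *\<^sub>R h x) \<in> borel_measurable borel"
        using borel_measurable_continuous_on_indicator[OF Xb h] by simp
      then have "set_lebesgue_integral \<mu> X h = integral\<^sup>L M (\<lambda>t. indicator X (\<psi> t) *\<^sub>R h (\<psi> t))"
        unfolding set_lebesgue_integral_def \<mu>_def using \<psi>m by (subst integral_distr) auto
      also have "\<dots> = integral\<^sup>L M F"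
      proof (rule integral_cong_AE)
        show "(\<lambda>t. indicat_real X (\<psi> t) *\<^sub>R h (\<psi> t)) \<in> borel_measurable M"
          using measurable_compose[OF \<psi>m \<open>(\<lambda>x. indicator X x *\<^sub>R h x) \<in> borel_measurable borel\<close>] by simp
        show "F \<in> borel_measurable M" using borel_measurable_continuous_onI[OF F(1)] by simp
        show "AE t in M. indicat_real X (\<psi> t) *\<^sub>R h (\<psi> t) = F t"
          using MC by eventually_elim (use \<phi>X F(2) in \<open>auto simp: \<psi>_def\<close>)
      qed
      finally show ?thesis by simp
    qed
    ultimately show ?thesis using conv[OF F(1), of B] F(3) by simp
  qed
  then show ?thesis using that[OF r \<mu>] by blast
qed

section \<open>The space of probabilities on X\<close>

lemma sigma_sets_borel: "sigma_sets UNIV (sets borel) = sets borel"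
  by (metis sets.sigma_sets_eq space_borel)

lemma emb_eq_distr: "emb u = distr (measure_pmf u) borel (\<lambda>x. x)"
proof -
  have "emb u = measure_of UNIV (sets borel) (emeasure (distr (measure_pmf u) borel (\<lambda>x. x)))"
    unfolding emb_def by (rule measure_of_eq) (auto simp: emeasure_distr sigma_sets_borel)
  also have "\<dots> = distr (measure_pmf u) borel (\<lambda>x. x)"
    using measure_of_of_measure[of "distr (measure_pmf u) borel (\<lambda>x. x)"] by simp
  finally show ?thesis .
qed

lemma emeasure_emb: "B \<in> sets borel \<Longrightarrow> emeasure (emb u) B = emeasure (measure_pmf u) B"
  unfolding emb_eq_distr by (subst emeasure_distr) auto

lemma return_eq_emb: "return borel x = emb (return_pmf x)"
  by (rule measure_eqI) (auto simp: emeasure_emb emb_eq_distr emeasure_distr)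

lemma compact_borel: "compact X \<Longrightarrow> X \<in> sets (borel :: 'b::euclidean_space measure)"
  using compact_imp_closed[of X] by auto

lemma emb_in_DeltaX:
  assumes "compact X" "fin_on X u"
  shows "emb u \<in> DeltaX X"
proof -
  have "prob_space (emb u)" unfolding emb_eq_distr by (rule measure_pmf.prob_space_distr) simp
  moreover have "emeasure (emb u) X = 1"
    using assms by (simp add: emeasure_emb compact_borel fin_on_def measure_pmf.emeasure_eq_1_AE AE_measure_pmf_iff subset_iff)
  ultimately show ?thesis by (simp add: DeltaX_def emb_eq_distr)
qed

lemma indicator_continuous_measurable:
  fixes h :: "'b::euclidean_space \<Rightarrow> real"
  assumes "compact X" "continuous_on X h"
  shows "(\<lambda>x. indicator X x *\<^sub>R h x) \<in> borel_measurable borel"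
  using borel_measurable_continuous_on_indicator[OF compact_borel[OF assms(1)] assms(2)] by simp

lemma set_integral_emb:
  assumes "compact X" "continuous_on X h" "fin_on X u"
  shows "set_lebesgue_integral (emb u) X h = expect u h"
proof -
  have "set_lebesgue_integral (emb u) X h = expect u (\<lambda>x. indicator X x *\<^sub>R h x)"
    unfolding set_lebesgue_integral_def emb_eq_distr
    using indicator_continuous_measurable[OF assms(1,2)] by (subst integral_distr) auto
  also have "\<dots> = expect u h"
    by (rule expect_cong) (use assms(3) in \<open>auto simp: fin_on_def\<close>)
  finally show ?thesis .
qed

context
  fixes X :: "(real ^ 'k::finite) set" and \<mu> :: "(real ^ 'k) measure"
  assumes X: "compact X" and \<mu>: "\<mu> \<in> DeltaX X"
begin

interpretation \<mu>: prob_space \<mu> using \<mu> by (simp add: DeltaX_def)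

lemma DeltaX_measurable:
  fixes h :: "real ^ 'k \<Rightarrow> real"
  assumes "continuous_on X h" shows "(\<lambda>x. indicator X x *\<^sub>R h x) \<in> borel_measurable \<mu>"
proof -
  have "sets \<mu> = sets borel" using \<mu> by (simp add: DeltaX_def)
  then show ?thesis using indicator_continuous_measurable[OF X assms] measurable_cong_sets[of \<mu> borel] by blast
qed

lemma DeltaX_AE: "AE x in \<mu>. x \<in> X"
  by (rule \<mu>.AE_in_set_eq_1[THEN iffD2]) (use \<mu> X compact_borel in \<open>auto simp: DeltaX_def \<mu>.emeasure_eq_measure\<close>)

lemma DeltaX_integrable:
  assumes h: "continuous_on X h" shows "integrable \<mu> (\<lambda>x. indicator X x *\<^sub>R (h x :: real))"
proof -
  have "bounded (h ` X)" using X h compact_continuous_image compact_imp_bounded by blast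
  then obtain B where B: "\<And>x. x \<in> X \<Longrightarrow> \<bar>h x\<bar> \<le> B" by (auto simp: bounded_iff)
  show ?thesis
    by (rule \<mu>.integrable_const_bound[where B=B])
      (use DeltaX_AE DeltaX_measurable[OF h] in \<open>auto elim!: eventually_mono simp: B\<close>)
qed

lemma DeltaX_integral_bounds:
  fixes h :: "real ^ 'k \<Rightarrow> real"
  assumes h: "continuous_on X h"
  shows "(\<And>x. x \<in> X \<Longrightarrow> h x \<le> c) \<Longrightarrow> set_lebesgue_integral \<mu> X h \<le> c"
    and "(\<And>x. x \<in> X \<Longrightarrow> c \<le> h x) \<Longrightarrow> c \<le> set_lebesgue_integral \<mu> X h"
proof -
  show "set_lebesgue_integral \<mu> X h \<le> c" if "\<And>x. x \<in> X \<Longrightarrow> h x \<le> c"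
    unfolding set_lebesgue_integral_def
    by (rule \<mu>.integral_le_const[OF DeltaX_integrable[OF h]])
      (use DeltaX_AE that in \<open>auto elim!: eventually_mono\<close>)
  show "c \<le> set_lebesgue_integral \<mu> X h" if "\<And>x. x \<in> X \<Longrightarrow> c \<le> h x"
    unfolding set_lebesgue_integral_def
    by (rule \<mu>.integral_ge_const[OF DeltaX_integrable[OF h]])
      (use DeltaX_AE that in \<open>auto elim!: eventually_mono\<close>)
qed

lemma DeltaX_integral_close:
  fixes h h' :: "real ^ 'k \<Rightarrow> real"
  assumes h: "continuous_on X h" "continuous_on X h'" and close: "\<And>x. x \<in> X \<Longrightarrow> \<bar>h x - h' x\<bar> \<le> c"
  shows "\<bar>set_lebesgue_integral \<mu> X h - set_lebesgue_integral \<mu> X h'\<bar> \<le> c"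
proof -
  have eq: "set_lebesgue_integral \<mu> X h - set_lebesgue_integral \<mu> X h' = set_lebesgue_integral \<mu> X (\<lambda>x. h x - h' x)"
    unfolding set_lebesgue_integral_def
    by (subst Bochner_Integration.integral_diff[OF DeltaX_integrable[OF h(1)] DeltaX_integrable[OF h(2)], symmetric])
      (simp add: right_diff_distrib)
  have c: "continuous_on X (\<lambda>x. h x - h' x)" using h by (intro continuous_intros)
  have "set_lebesgue_integral \<mu> X (\<lambda>x. h x - h' x) \<le> c"
    using close by (intro DeltaX_integral_bounds(1)[OF c]) (auto simp: abs_le_iff)
  moreover have "- c \<le> set_lebesgue_integral \<mu> X (\<lambda>x. h x - h' x)"
    using close by (intro DeltaX_integral_bounds(2)[OF c]) (force simp: abs_le_iff)
  ultimately show ?thesis unfolding eq by linarith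
qed

lemma DeltaX_dominated_convergence:
  fixes f :: "nat \<Rightarrow> real ^ 'k \<Rightarrow> real"
  assumes f: "\<And>n. continuous_on X (f n)" "\<And>n x. x \<in> X \<Longrightarrow> \<bar>f n x\<bar> \<le> c" and h: "continuous_on X h"
    and lim: "\<And>x. x \<in> X \<Longrightarrow> (\<lambda>n. f n x) \<longlonglongrightarrow> h x"
  shows "(\<lambda>n. set_lebesgue_integral \<mu> X (f n)) \<longlonglongrightarrow> set_lebesgue_integral \<mu> X h"
  unfolding set_lebesgue_integral_def
proof (rule integral_dominated_convergence[where w="\<lambda>_. c"])
  show "AE x in \<mu>. (\<lambda>n. indicat_real X x *\<^sub>R f n x) \<longlonglongrightarrow> indicat_real X x *\<^sub>R h x"
    using DeltaX_AE by eventually_elim (auto intro: lim)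
  show "AE x in \<mu>. norm (indicat_real X x *\<^sub>R f n x) \<le> c" for n
    using DeltaX_AE by eventually_elim (auto intro: f)
qed (rule DeltaX_measurable f h integrable_const \<mu>.integrable_const)+

end

lemma mix_emb:
  assumes "0 \<le> l" "l \<le> 1"
  shows "mix l (emb u) (emb v) = emb (two_mix l u v)"
  unfolding mix_def emb_def[of "two_mix l u v"]
  by (rule measure_of_eq)
    (use assms in \<open>auto simp: two_mix_def sigma_sets_borel emeasure_emb emeasure_bind_pmf mult.commute\<close>)

text \<open>A mixture is a coin toss followed by a draw. In this form the integration rule for
  \<open>bind\<close> applies to it.\<close>

lemma mix_eq_bind:
  fixes \<mu> \<nu> :: "(real ^ 'k::finite) measure"
  assumes "prob_space \<mu>" "sets \<mu> = sets borel" "prob_space \<nu>" "sets \<nu> = sets borel" "0 \<le> l" "l \<le> 1"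
  shows "mix l \<mu> \<nu> = measure_pmf (bernoulli_pmf l) \<bind> (\<lambda>b. if b then \<mu> else \<nu>)" (is "_ = ?N")
    and "(\<lambda>b. if b then \<mu> else \<nu>) \<in> measure_pmf (bernoulli_pmf l) \<rightarrow>\<^sub>M subprob_algebra borel"
proof -
  show m: "(\<lambda>b. if b then \<mu> else \<nu>) \<in> measure_pmf (bernoulli_pmf l) \<rightarrow>\<^sub>M subprob_algebra borel"
    using assms by (auto simp: space_subprob_algebra prob_space_imp_subprob_space)
  have s: "sets ?N = sets borel" by (rule sets_bind) (use assms in auto)
  have "mix l \<mu> \<nu> = measure_of UNIV (sets borel) (emeasure ?N)"
    unfolding mix_def
    by (rule measure_of_eq)
      (use assms in \<open>auto simp: sigma_sets_borel emeasure_bind[OF _ m] mult.commute\<close>)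
  also have "\<dots> = ?N"
    using measure_of_of_measure[of ?N] s sets_eq_imp_space_eq[OF s] by simp
  finally show "mix l \<mu> \<nu> = ?N" .
qed

lemma integral_mix:
  fixes X :: "(real ^ 'k::finite) set"
  assumes X: "compact X" and \<mu>: "\<mu> \<in> DeltaX X" and \<nu>: "\<nu> \<in> DeltaX X" and l: "0 \<le> l" "l \<le> 1"
    and h: "continuous_on X h" "\<And>x. x \<in> X \<Longrightarrow> 0 \<le> h x"
  shows "set_lebesgue_integral (mix l \<mu> \<nu>) X h = l * set_lebesgue_integral \<mu> X h + (1 - l) * set_lebesgue_integral \<nu> X h"
proof -
  define f where "f x = indicat_real X x *\<^sub>R h x" for x
  have f0: "0 \<le> f x" for x using h(2) by (auto simp: f_def indicator_def)
  have m: "f \<in> borel_measurable borel" using indicator_continuous_measurable[OF X h(1)] by (simp add: f_def[abs_def])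
  have P: "prob_space \<mu>" "sets \<mu> = sets borel" "prob_space \<nu>" "sets \<nu> = sets borel"
    using \<mu> \<nu> by (auto simp: DeltaX_def)
  note B = mix_eq_bind[OF P l]
  have sN: "sets (mix l \<mu> \<nu>) = sets borel" by (simp add: mix_def sigma_sets_borel)
  have mN: "f \<in> borel_measurable (mix l \<mu> \<nu>)" using m measurable_cong_sets[OF sN refl] by blast
  have nn: "(\<integral>\<^sup>+x. ennreal (f x) \<partial>\<rho>) = ennreal (integral\<^sup>L \<rho> f)" if "\<rho> \<in> DeltaX X" for \<rho>
    using f0 by (intro nn_integral_eq_integral) (use DeltaX_integrable[OF X that h(1)] in \<open>auto simp: f_def[abs_def]\<close>)
  have i0: "0 \<le> integral\<^sup>L \<rho> f" for \<rho> by (intro Bochner_Integration.integral_nonneg f0)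
  have "(\<integral>\<^sup>+x. ennreal (f x) \<partial>mix l \<mu> \<nu>) = (\<integral>\<^sup>+b. \<integral>\<^sup>+x. ennreal (f x) \<partial>(if b then \<mu> else \<nu>) \<partial>measure_pmf (bernoulli_pmf l))"
    unfolding B(1) by (rule nn_integral_bind[OF _ B(2)]) (use m in simp)
  also have "\<dots> = ennreal (l * integral\<^sup>L \<mu> f + (1 - l) * integral\<^sup>L \<nu> f)"
    using l i0 by (simp add: nn[OF \<mu>] nn[OF \<nu>] ennreal_mult ennreal_plus mult.commute)
  finally have "integral\<^sup>L (mix l \<mu> \<nu>) f = l * integral\<^sup>L \<mu> f + (1 - l) * integral\<^sup>L \<nu> f"
    using l i0 f0 mN by (subst integral_eq_nn_integral) (auto simp flip: ennreal_plus)
  then show ?thesis unfolding set_lebesgue_integral_def f_def .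
qed

text \<open>Two-term affinity propagates through \<open>finite_pmf_two_mix_induct\<close>. On
  finitely supported laws \<open>w\<close> is thus governed by its values at Dirac measures.\<close>

lemma affine_emb:
  assumes X: "compact X" and w: "affine_on_DeltaX X w" and u: "fin_on X u"
  shows "w (emb u) = expect u (\<lambda>x. w (return borel x))"
proof -
  from u have "finite (set_pmf u)" "set_pmf u \<subseteq> X" by (auto simp: fin_on_def)
  from this(1) subset_refl[of "set_pmf u"] show ?thesis
  proof (induction u rule: finite_pmf_two_mix_induct)
    case (return x) then show ?case by (simp add: return_eq_emb)
  next
    case (mix l v v')
    then have v: "fin_on X v" "fin_on X v'" using u by (auto simp: fin_on_def)
    have "w (emb (two_mix l v v')) = w (mix l (emb v) (emb v'))" using mix by (simp add: mix_emb)
    also have "\<dots> = l * w (emb v) + (1 - l) * w (emb v')"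
      using w emb_in_DeltaX[OF X v(1)] emb_in_DeltaX[OF X v(2)] mix by (auto simp: affine_on_DeltaX_def)
    finally show ?case using mix by (simp add: expect_two_mix fin_on_def)
  qed
qed

lemma openin_weak_star_basic:
  fixes h :: "real ^ 'k::finite \<Rightarrow> real"
  shows "continuous_on X h \<Longrightarrow> open U \<Longrightarrow> openin (weak_star X) {\<mu> \<in> DeltaX X. set_lebesgue_integral \<mu> X h \<in> U}"
  unfolding weak_star_def by (rule topology_generated_by_Basis, rule CollectI, intro exI conjI) auto

lemma topspace_weak_star [simp]: "topspace (weak_star X) = DeltaX X"
proof -
  have "DeltaX X \<subseteq> topspace (weak_star X)"
    using openin_subset[OF openin_weak_star_basic[of X "\<lambda>_. 0" UNIV]] by auto
  moreover have "topspace (weak_star X) \<subseteq> DeltaX X"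
    unfolding weak_star_def topology_generated_by_topspace by auto
  ultimately show ?thesis by blast
qed

text \<open>The property that a set containing the limit is eventually entered is stable under
  finite intersections and arbitrary unions, so it suffices to check the generating sets.\<close>

lemma limitin_weak_star:
  fixes X :: "(real ^ 'a::finite) set"
  assumes \<mu>: "\<mu> \<in> DeltaX X" and \<nu>: "\<And>n. \<nu> n \<in> DeltaX X"
    and lim: "\<And>h :: _ \<Rightarrow> real. continuous_on X h \<Longrightarrow> (\<lambda>n. set_lebesgue_integral (\<nu> n) X h) \<longlonglongrightarrow> set_lebesgue_integral \<mu> X h"
  shows "limitin (weak_star X) \<nu> \<mu> sequentially"
  unfolding limitin_def
proof (intro conjI allI impI)
  show "\<mu> \<in> topspace (weak_star X)" using \<mu> by simp
  fix U assume U: "openin (weak_star X) U \<and> \<mu> \<in> U"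
  have "generate_topology_on {{\<mu> \<in> DeltaX X. set_lebesgue_integral \<mu> X h \<in> U} | h U. continuous_on X h \<and> open (U :: real set)} U"
    using U by (simp add: weak_star_def openin_topology_generated_by_iff)
  then have "\<mu> \<in> U \<longrightarrow> (\<forall>\<^sub>F n in sequentially. \<nu> n \<in> U)"
  proof induction
    case (Int a b) then show ?case by (auto simp: eventually_conj_iff)
  next
    case (UN K)
    show ?case
    proof
      assume "\<mu> \<in> \<Union>K"
      then obtain k where "k \<in> K" "\<mu> \<in> k" by blast
      then have "\<forall>\<^sub>F n in sequentially. \<nu> n \<in> k" using UN by blast
      then show "\<forall>\<^sub>F n in sequentially. \<nu> n \<in> \<Union>K"
        by (rule eventually_mono) (use \<open>k \<in> K\<close> in blast)
    qed
  next
    case (Basis s)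
    then obtain h :: "real ^ 'a \<Rightarrow> real" and V where "s = {\<mu> \<in> DeltaX X. set_lebesgue_integral \<mu> X h \<in> V}" "continuous_on X h" "open V"
      by blast
    then show ?case using topological_tendstoD[OF lim[of h], of V] \<nu> by simp
  qed simp
  then show "\<forall>\<^sub>F n in sequentially. \<nu> n \<in> U" using U by blast
qed

section \<open>Test functions and the one-step comparison\<close>

lemma norm1_nonneg: "0 \<le> norm1 x"
  by (auto simp: norm1_def intro!: sum_nonneg)

lemma norm1_zero: "norm1 0 = 0"
  by (simp add: norm1_def)

lemma norm1_triangle: "norm1 (x + y) \<le> norm1 x + norm1 y"
  unfolding norm1_def sum.distrib[symmetric] by (rule sum_mono) simp

lemma norm1_scale: "norm1 (c *\<^sub>R x) = \<bar>c\<bar> * norm1 x"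
  by (simp add: norm1_def abs_mult sum_distrib_left)

lemma norm1_minus_commute: "norm1 (x - y) = norm1 (y - x)"
  by (simp add: norm1_def abs_minus_commute)

lemma norm1_DeltaK: "x \<in> DeltaK \<Longrightarrow> norm1 x = 1"
  by (simp add: norm1_def DeltaK_def)

lemma norm1_le_norm: "norm1 (x :: real ^ 'k::finite) \<le> CARD('k) * norm x"
  unfolding norm1_def by (rule sum_bounded_above) (rule component_le_norm_cart)

lemma norm1_net:
  fixes X :: "(real ^ 'k::finite) set"
  assumes "compact X" "0 < \<delta>"
  obtains P where "finite P" "P \<subseteq> X" "\<And>x. x \<in> X \<Longrightarrow> \<exists>p\<in>P. norm1 (x - p) < \<delta>"
proof -
  define r where "r = \<delta> / CARD('k)"
  have "0 < r" using assms by (simp add: r_def)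
  then have "X \<subseteq> (\<Union>p\<in>X. ball p r)" by auto
  then obtain P where P: "P \<subseteq> X" "finite P" "X \<subseteq> (\<Union>p\<in>P. ball p r)"
    using compactE_image[OF assms(1), of X "\<lambda>p. ball p r"] by auto
  have "\<exists>p\<in>P. norm1 (x - p) < \<delta>" if x: "x \<in> X" for x
  proof -
    obtain p where p: "p \<in> P" "dist p x < r" using P x by auto
    have "norm1 (x - p) \<le> CARD('k) * norm (x - p)" by (rule norm1_le_norm)
    also have "\<dots> < CARD('k) * r" using p by (simp add: dist_norm norm_minus_commute)
    finally show ?thesis using p by (auto simp: r_def)
  qed
  then show ?thesis using that P by blast
qed

locale nonexpansive_mdp =
  fixes X :: "(real ^ 'k::finite) set" and A :: "'a set"
    and q :: "real ^ 'k \<Rightarrow> 'a \<Rightarrow> (real ^ 'k) pmf" and g :: "real ^ 'k \<Rightarrow> 'a \<Rightarrow> real"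
  assumes compact_X: "compact X" and X_sub: "X \<subseteq> DeltaK" and A_ne: "A \<noteq> {}"
    and q_fin: "\<And>x a. x \<in> X \<Longrightarrow> a \<in> A \<Longrightarrow> fin_on X (q x a)"
    and g_range: "\<And>x a. x \<in> X \<Longrightarrow> a \<in> A \<Longrightarrow> g x a \<in> {0..1}"
    and q_nonexp: "\<And>x y a f \<alpha> \<beta>. x \<in> X \<Longrightarrow> y \<in> X \<Longrightarrow> a \<in> A \<Longrightarrow> f \<in> D1 \<Longrightarrow> 0 \<le> \<alpha> \<Longrightarrow> 0 \<le> \<beta> \<Longrightarrow>
           \<bar>\<alpha> * lin_ext f (q x a) - \<beta> * lin_ext f (q y a)\<bar> \<le> norm1 (\<alpha> *\<^sub>R x - \<beta> *\<^sub>R y)"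
    and g_nonexp: "\<And>x y a \<alpha> \<beta>. x \<in> X \<Longrightarrow> y \<in> X \<Longrightarrow> a \<in> A \<Longrightarrow> 0 \<le> \<alpha> \<Longrightarrow> 0 \<le> \<beta> \<Longrightarrow>
           \<bar>\<alpha> * g x a - \<beta> * g y a\<bar> \<le> norm1 (\<alpha> *\<^sub>R x - \<beta> *\<^sub>R y)"
begin

text \<open>The inequality of \<open>D1\<close>, imposed on \<open>X\<close> only: functions built
  from suprema over actions are controlled only at states in \<open>X\<close>, where the assumptions
  on \<open>q\<close> and \<open>g\<close> apply. \<open>D1X_extend\<close> leads back to
  \<open>D1\<close>.\<close>

definition D1X :: "(real ^ 'k \<Rightarrow> real) set" where
  "D1X = {f. \<forall>x\<in>X. \<forall>y\<in>X. \<forall>a b. 0 \<le> a \<longrightarrow> 0 \<le> b \<longrightarrow> a * f x - b * f y \<le> norm1 (a *\<^sub>R x - b *\<^sub>R y)}"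

lemma D1XD: "f \<in> D1X \<Longrightarrow> x \<in> X \<Longrightarrow> y \<in> X \<Longrightarrow> 0 \<le> a \<Longrightarrow> 0 \<le> b \<Longrightarrow> a * f x - b * f y \<le> norm1 (a *\<^sub>R x - b *\<^sub>R y)"
  by (simp add: D1X_def)

lemma norm1_X: "x \<in> X \<Longrightarrow> norm1 x = 1"
  using X_sub norm1_DeltaK by auto

lemma D1X_abs: "f \<in> D1X \<Longrightarrow> x \<in> X \<Longrightarrow> \<bar>f x\<bar> \<le> 1"
  using D1XD[of f x x 1 0] D1XD[of f x x 0 1] norm1_X[of x] norm1_scale[of "-1" x] by (auto simp: abs_le_iff)

lemma D1X_lip: "f \<in> D1X \<Longrightarrow> x \<in> X \<Longrightarrow> y \<in> X \<Longrightarrow> \<bar>f x - f y\<bar> \<le> norm1 (x - y)"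
  using D1XD[of f x y 1 1] D1XD[of f y x 1 1] norm1_minus_commute[of x y] by (auto simp: abs_le_iff)

lemma lip_continuous:
  assumes "\<And>x y. x \<in> X \<Longrightarrow> y \<in> X \<Longrightarrow> \<bar>f x - f y\<bar> \<le> norm1 (x - y)"
  shows "continuous_on X f"
  unfolding continuous_on_iff
proof (intro ballI allI impI)
  fix x and e :: real assume x: "x \<in> X" and e: "0 < e"
  have "dist (f y) (f x) < e" if y: "y \<in> X" "dist y x < e / CARD('k)" for y
  proof -
    have "dist (f y) (f x) \<le> CARD('k) * norm (y - x)"
      using assms[OF y(1) x] norm1_le_norm[of "y - x"] by (simp add: dist_real_def)
    also have "\<dots> < e" using y(2) by (simp add: dist_norm pos_less_divide_eq mult.commute)
    finally show ?thesis .
  qed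
  then show "\<exists>d>0. \<forall>x'\<in>X. dist x' x < d \<longrightarrow> dist (f x') (f x) < e"
    using e by (intro exI[of _ "e / CARD('k)"]) auto
qed

lemma D1X_continuous: "f \<in> D1X \<Longrightarrow> continuous_on X f"
  by (rule lip_continuous) (rule D1X_lip)

text \<open>A function in \<open>D1X\<close> is a 1-Lipschitz positively homogeneous function on the cone over \<open>X\<close>;
  its inf-convolution with \<open>norm1\<close> extends it to the whole space.\<close>
lemma D1X_extend:
  assumes f: "f \<in> D1X"
  obtains f' where "f' \<in> D1" "\<And>x. x \<in> X \<Longrightarrow> f' x = f x"
proof (cases "X = {}")
  case True
  have "(\<lambda>_. 0) \<in> D1" by (simp add: D1_def norm1_nonneg)
  then show ?thesis using that True by auto
next
  case False
  then obtain x0 where x0: "x0 \<in> X" by blast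
  define T where "T = {0::real..} \<times> X"
  define \<psi> where "\<psi> z p = fst p * f (snd p) + norm1 (z - fst p *\<^sub>R snd p)" for z p
  define F where "F z = (INF p\<in>T. \<psi> z p)" for z
  have Tne: "T \<noteq> {}" using x0 by (auto simp: T_def)
  \<comment> \<open>The defining inequality with first coefficient 0 bounds \<open>- b * f y\<close>
    by \<open>norm1 (b *\<^sub>R y)\<close>; this keeps the infimum finite.\<close>
  have lb: "- norm1 z \<le> \<psi> z p" if pT: "p \<in> T" for z p
  proof -
    obtain b y where p: "p = (b, y)" "0 \<le> b" "y \<in> X" using pT by (auto simp: T_def)
    have "0 * f x0 - b * f y \<le> norm1 (0 *\<^sub>R x0 - b *\<^sub>R y)" using D1XD[OF f x0 p(3) _ p(2), of 0] by simp
    also have "\<dots> = norm1 (b *\<^sub>R y)" using norm1_scale[of "-1" "b *\<^sub>R y"] by simp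
    also have "\<dots> \<le> norm1 (b *\<^sub>R y - z) + norm1 z" using norm1_triangle[of "b *\<^sub>R y - z" z] by simp
    finally show ?thesis using p norm1_minus_commute[of z "b *\<^sub>R y"] by (simp add: \<psi>_def)
  qed
  have bdd: "bdd_below (\<psi> z ` T)" for z using lb by (auto intro!: bdd_belowI2[where m="- norm1 z"])
  have Fle: "F z \<le> \<psi> z p" if "p \<in> T" for z p unfolding F_def by (rule cINF_lower[OF bdd that])
  have Fge: "c \<le> F z" if "\<And>p. p \<in> T \<Longrightarrow> c \<le> \<psi> z p" for c z unfolding F_def by (rule cINF_greatest[OF Tne that])
  have lip: "F z \<le> F z' + norm1 (z - z')" for z z'
  proof -
    have "F z - norm1 (z - z') \<le> F z'"
    proof (rule Fge)
      fix p assume p: "p \<in> T"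
      have "\<psi> z p \<le> \<psi> z' p + norm1 (z - z')"
        using norm1_triangle[of "z - z'" "z' - fst p *\<^sub>R snd p"] by (simp add: \<psi>_def)
      then show "F z - norm1 (z - z') \<le> \<psi> z' p" using Fle[OF p, of z] by linarith
    qed
    then show ?thesis by simp
  qed
  have hom_le: "F (a *\<^sub>R z) \<le> a * F z" if a: "0 < a" for a z
  proof -
    have "F (a *\<^sub>R z) / a \<le> F z"
    proof (rule Fge)
      fix p assume p: "p \<in> T"
      have "F (a *\<^sub>R z) \<le> \<psi> (a *\<^sub>R z) (a * fst p, snd p)"
        by (rule Fle) (use p a in \<open>auto simp: T_def\<close>)
      also have "\<dots> = a * \<psi> z p"
      proof -
        have "a *\<^sub>R z - (a * fst p) *\<^sub>R snd p = a *\<^sub>R (z - fst p *\<^sub>R snd p)" by (simp add: scaleR_diff_right)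
        then have "norm1 (a *\<^sub>R z - (a * fst p) *\<^sub>R snd p) = a * norm1 (z - fst p *\<^sub>R snd p)"
          using a by (simp add: norm1_scale)
        then show ?thesis by (simp add: \<psi>_def distrib_left mult.assoc)
      qed
      finally show "F (a *\<^sub>R z) / a \<le> \<psi> z p" using a by (simp add: field_simps)
    qed
    then show ?thesis using a by (simp add: field_simps)
  qed
  \<comment> \<open>The reverse inequality is \<open>hom_le\<close> for the factor
    \<open>1/a\<close>.\<close>
  have hom: "F (a *\<^sub>R z) = a * F z" if a: "0 < a" for a z
  proof -
    have "F ((1/a) *\<^sub>R a *\<^sub>R z) \<le> (1/a) * F (a *\<^sub>R z)" using a by (intro hom_le) simp
    then have "a * F z \<le> F (a *\<^sub>R z)" using a by (simp add: field_simps)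
    then show ?thesis using hom_le[OF a, of z] by simp
  qed
  have F0: "F 0 = 0"
  proof (rule antisym)
    show "F 0 \<le> 0" using Fle[of "(0, x0)" 0] x0 by (simp add: T_def \<psi>_def norm1_zero)
    show "0 \<le> F 0" by (rule Fge) (use lb[of _ 0] in \<open>simp add: norm1_zero\<close>)
  qed
  have hom0: "F (a *\<^sub>R z) = a * F z" if "0 \<le> a" for a z
    using hom[of a z] that F0 by (cases "a = 0") auto
  have "continuous_on DeltaK F"
  proof (rule continuous_on_subset[of UNIV])
    show "continuous_on UNIV F"
      unfolding continuous_on_iff
    proof (intro ballI allI impI)
      fix x and e :: real assume e: "0 < e"
      have "dist (F y) (F x) < e" if y: "dist y x < e / CARD('k)" for y
      proof -
        have "dist (F y) (F x) \<le> CARD('k) * norm (y - x)"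
          using lip[of y x] lip[of x y] norm1_minus_commute[of x y] norm1_le_norm[of "y - x"] by (simp add: dist_real_def)
        also have "\<dots> < e" using y by (simp add: dist_norm pos_less_divide_eq mult.commute)
        finally show ?thesis .
      qed
      then show "\<exists>d>0. \<forall>x'\<in>UNIV. dist x' x < d \<longrightarrow> dist (F x') (F x) < e"
        using e by (intro exI[of _ "e / CARD('k)"]) auto
    qed
  qed simp
  moreover have "a * F x - b * F y \<le> norm1 (a *\<^sub>R x - b *\<^sub>R y)" if "0 \<le> a" "0 \<le> b" for a b x y
    using lip[of "a *\<^sub>R x" "b *\<^sub>R y"] hom0 that by simp
  ultimately have "F \<in> D1" by (simp add: D1_def)
  moreover have "F x = f x" if x: "x \<in> X" for x
  proof (rule antisym)
    show "F x \<le> f x" using Fle[of "(1, x)" x] x by (simp add: T_def \<psi>_def norm1_zero)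
    show "f x \<le> F x"
    proof (rule Fge)
      fix p assume "p \<in> T"
      then show "f x \<le> \<psi> x p" using D1XD[OF f x, of "snd p" 1 "fst p"] by (auto simp: T_def \<psi>_def)
    qed
  qed
  ultimately show ?thesis using that by blast
qed

text \<open>An elementary Arzela-Ascoli argument: values are rounded to multiples of \<delta> on a
  finite net of \<open>X\<close>, which leaves finitely many patterns. Two functions with the same
  pattern differ by at most 3 \<delta> on \<open>X\<close>, and one representative in
  \<open>D1X\<close> is kept for each pattern that occurs.\<close>

lemma D1X_net:
  assumes \<eta>: "0 < \<eta>"
  obtains F where "finite F" "F \<subseteq> D1X" "\<And>f. f \<in> D1X \<Longrightarrow> \<exists>f'\<in>F. \<forall>x\<in>X. \<bar>f x - f' x\<bar> \<le> \<eta>"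
proof -
  define \<delta> where "\<delta> = \<eta> / 4"
  have \<delta>: "0 < \<delta>" using \<eta> by (simp add: \<delta>_def)
  obtain P where P: "finite P" "P \<subseteq> X" "\<And>x. x \<in> X \<Longrightarrow> \<exists>p\<in>P. norm1 (x - p) < \<delta>"
    using norm1_net[OF compact_X \<delta>] by blast
  define R where "R f = (\<lambda>p\<in>P. \<lfloor>f p / \<delta>\<rfloor>)" for f :: "real ^ 'k \<Rightarrow> real"
  define S where "S = PiE P (\<lambda>_. {\<lfloor>- 1 / \<delta>\<rfloor>..\<lfloor>1 / \<delta>\<rfloor>})"
  have finS: "finite S" unfolding S_def using P(1) by (intro finite_PiE) auto
  have "R ` D1X \<subseteq> S"
  proof
    fix \<rho> assume "\<rho> \<in> R ` D1X"
    then obtain f where f: "f \<in> D1X" "\<rho> = R f" by blast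
    have "\<lfloor>- 1 / \<delta>\<rfloor> \<le> \<lfloor>f p / \<delta>\<rfloor> \<and> \<lfloor>f p / \<delta>\<rfloor> \<le> \<lfloor>1 / \<delta>\<rfloor>" if "p \<in> P" for p
    proof -
      have "\<bar>f p\<bar> \<le> 1" using D1X_abs[OF f(1)] that P(2) by blast
      then show ?thesis using \<delta> by (intro conjI floor_mono divide_right_mono) auto
    qed
    then show "\<rho> \<in> S" by (auto simp: f(2) R_def S_def)
  qed
  then have fin: "finite (R ` D1X)" using finS finite_subset by blast
  define rep where "rep \<rho> = (SOME f. f \<in> D1X \<and> R f = \<rho>)" for \<rho>
  have rep: "rep (R f) \<in> D1X" "R (rep (R f)) = R f" if "f \<in> D1X" for f
    using someI[of "\<lambda>f'. f' \<in> D1X \<and> R f' = R f" f] that by (auto simp: rep_def)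
  have "\<exists>f'\<in>rep ` R ` D1X. \<forall>x\<in>X. \<bar>f x - f' x\<bar> \<le> \<eta>" if f: "f \<in> D1X" for f
  proof (intro bexI ballI)
    let ?f = "rep (R f)"
    fix x assume x: "x \<in> X"
    obtain p where p: "p \<in> P" "norm1 (x - p) < \<delta>" using P(3)[OF x] by blast
    then have pX: "p \<in> X" using P by blast
    have "R ?f p = R f p" using rep(2)[OF f] by simp
    then have fl: "\<lfloor>?f p / \<delta>\<rfloor> = \<lfloor>f p / \<delta>\<rfloor>" using p by (simp add: R_def)
    have "\<bar>?f p / \<delta> - f p / \<delta>\<bar> < 1"
      using fl floor_correct[of "?f p / \<delta>"] floor_correct[of "f p / \<delta>"] by linarith
    then have "\<bar>?f p - f p\<bar> < \<delta>" using \<delta> by (simp add: diff_divide_distrib[symmetric] field_simps)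
    moreover have "\<bar>f x - f p\<bar> \<le> \<delta>" "\<bar>?f x - ?f p\<bar> \<le> \<delta>"
      using D1X_lip[OF f x pX] D1X_lip[OF rep(1)[OF f] x pX] p by auto
    ultimately show "\<bar>f x - ?f x\<bar> \<le> \<eta>" using \<delta>_def by linarith
  qed (use f in auto)
  moreover have "rep ` R ` D1X \<subseteq> D1X" using rep by auto
  ultimately show ?thesis using that[of "rep ` R ` D1X"] fin by blast
qed

section \<open>State-action laws and the one-step comparison\<close>

definition nxt :: "((real ^ 'k) \<times> 'a) pmf \<Rightarrow> (real ^ 'k) pmf" where
  "nxt K = bind_pmf K (\<lambda>(x, a). q x a)"

definition pay :: "((real ^ 'k) \<times> 'a) pmf \<Rightarrow> real" where
  "pay K = expect K (\<lambda>(x, a). g x a)"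

abbreviation adm :: "((real ^ 'k) \<times> 'a) pmf \<Rightarrow> bool" where
  "adm K \<equiv> fin_on (X \<times> A) K"

lemma fin_on_fst: "adm K \<Longrightarrow> fin_on X (map_pmf fst K)"
  by (rule fin_on_map) auto

lemma fin_on_nxt: "adm K \<Longrightarrow> fin_on X (nxt K)"
  unfolding nxt_def by (rule fin_on_bind) (auto intro: q_fin)

lemma expect_nxt: "adm K \<Longrightarrow> expect (nxt K) f = expect K (\<lambda>(x, a). expect (q x a) f)"
  unfolding nxt_def using q_fin
  by (subst expect_bind) (auto simp: fin_on_def case_prod_unfold subset_iff mem_Times_iff)

lemma pay_range: "adm K \<Longrightarrow> 0 \<le> pay K" "adm K \<Longrightarrow> pay K \<le> 1"
proof -
  assume K: "adm K"
  then have "0 \<le> g x a \<and> g x a \<le> 1" if "(x, a) \<in> set_pmf K" for x a using that g_range[of x a] by (auto simp: fin_on_def)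
  then have g: "0 \<le> (case p of (x, a) \<Rightarrow> g x a) \<and> (case p of (x, a) \<Rightarrow> g x a) \<le> 1" if "p \<in> set_pmf K" for p
    using that by (cases p) auto
  have "finite (set_pmf K)" using K by (simp add: fin_on_def)
  then have "expect K (\<lambda>_. 0) \<le> pay K" "pay K \<le> expect K (\<lambda>_. 1)"
    unfolding pay_def using g by (intro expect_mono; blast)+
  then show "0 \<le> pay K" "pay K \<le> 1" by simp_all
qed

text \<open>Two states are compared under the same action, as in the assumptions on \<open>q\<close>
  and \<open>g\<close>. This class contains every quantity that the one-step comparison has to
  transfer: the payoff and the expected next value of each test function.\<close>

definition D1A :: "((real ^ 'k) \<times> 'a \<Rightarrow> real) set" where
  "D1A = {\<phi>. \<forall>x\<in>X. \<forall>y\<in>X. \<forall>a\<in>A. \<forall>\<alpha> \<beta>. 0 \<le> \<alpha> \<longrightarrow> 0 \<le> \<beta> \<longrightarrow>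
     \<alpha> * \<phi> (x, a) - \<beta> * \<phi> (y, a) \<le> norm1 (\<alpha> *\<^sub>R x - \<beta> *\<^sub>R y)}"

lemma g_D1A: "(\<lambda>(x, a). g x a) \<in> D1A"
  using g_nonexp by (auto simp: D1A_def abs_le_iff)

text \<open>The assumption on \<open>q\<close> concerns functions in \<open>D1\<close>, so
  \<open>f\<close> is first extended; the extension changes nothing on the support of
  \<open>q x a\<close>.\<close>

lemma q_D1A: assumes f: "f \<in> D1X" shows "(\<lambda>(x, a). expect (q x a) f) \<in> D1A"
proof -
  obtain f' where f': "f' \<in> D1" "\<And>x. x \<in> X \<Longrightarrow> f' x = f x" using D1X_extend[OF f] by blast
  have "lin_ext f' (q x a) = expect (q x a) f" if "x \<in> X" "a \<in> A" for x a
    unfolding lin_ext_def by (rule expect_cong) (use f'(2) q_fin[OF that] in \<open>auto simp: fin_on_def\<close>)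
  then show ?thesis using q_nonexp[OF _ _ _ f'(1)] by (auto simp: D1A_def abs_le_iff)
qed

lemma D1A_convex:
  assumes "\<And>\<phi>. \<phi> \<in> F \<Longrightarrow> \<phi> \<in> D1A" "\<And>\<phi>. \<phi> \<in> F \<Longrightarrow> 0 \<le> l \<phi>" "sum l F = 1"
  shows "(\<lambda>p. \<Sum>\<phi>\<in>F. l \<phi> * \<phi> p) \<in> D1A"
  unfolding D1A_def
proof (intro CollectI ballI allI impI)
  fix x y a and \<alpha> \<beta> :: real assume h: "x \<in> X" "y \<in> X" "a \<in> A" "0 \<le> \<alpha>" "0 \<le> \<beta>"
  have "\<alpha> * (\<Sum>\<phi>\<in>F. l \<phi> * \<phi> (x, a)) - \<beta> * (\<Sum>\<phi>\<in>F. l \<phi> * \<phi> (y, a))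
      = (\<Sum>\<phi>\<in>F. l \<phi> * (\<alpha> * \<phi> (x, a) - \<beta> * \<phi> (y, a)))"
    by (simp add: sum_distrib_left sum_subtractf right_diff_distrib mult.left_commute)
  also have "\<dots> \<le> (\<Sum>\<phi>\<in>F. l \<phi> * norm1 (\<alpha> *\<^sub>R x - \<beta> *\<^sub>R y))"
    using assms h by (intro sum_mono mult_left_mono) (auto simp: D1A_def)
  also have "\<dots> = norm1 (\<alpha> *\<^sub>R x - \<beta> *\<^sub>R y)" using assms(3) by (simp add: sum_distrib_right[symmetric])
  finally show "\<alpha> * (\<Sum>\<phi>\<in>F. l \<phi> * \<phi> (x, a)) - \<beta> * (\<Sum>\<phi>\<in>F. l \<phi> * \<phi> (y, a)) \<le> norm1 (\<alpha> *\<^sub>R x - \<beta> *\<^sub>R y)" .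
qed

lemma D1A_abs:
  assumes "\<phi> \<in> D1A" "x \<in> X" "a \<in> A" shows "\<bar>\<phi> (x, a)\<bar> \<le> 1"
proof -
  have "\<alpha> * \<phi> (x, a) - \<beta> * \<phi> (x, a) \<le> norm1 (\<alpha> *\<^sub>R x - \<beta> *\<^sub>R x)" if "0 \<le> \<alpha>" "0 \<le> \<beta>" for \<alpha> \<beta>
    using assms that by (simp add: D1A_def)
  from this[of 1 0] this[of 0 1] show ?thesis
    using norm1_X[OF assms(2)] norm1_scale[of "-1" x] by (auto simp: abs_le_iff)
qed

text \<open>Since the inequality holds action by action with one common bound, it survives the
  supremum. Hence optimising one step ahead returns to the class of test functions.\<close>

lemma D1A_sup:
  assumes \<phi>: "\<phi> \<in> D1A"
  shows "(\<lambda>x. SUP a\<in>A. \<phi> (x, a)) \<in> D1X"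
  unfolding D1X_def
proof (intro CollectI ballI allI impI)
  fix x y and \<alpha> \<beta> :: real assume h: "x \<in> X" "y \<in> X" "0 \<le> \<alpha>" "0 \<le> \<beta>"
  define s where "s y = (SUP a\<in>A. \<phi> (y, a))" for y
  have bdd: "bdd_above ((\<lambda>a. \<phi> (y, a)) ` A)"
    using D1A_abs[OF \<phi> h(2)] by (intro bdd_aboveI2[where M=1]) (auto simp: abs_le_iff)
  have le: "\<alpha> * \<phi> (x, a) \<le> \<beta> * s y + norm1 (\<alpha> *\<^sub>R x - \<beta> *\<^sub>R y)" if a: "a \<in> A" for a
  proof -
    have "\<phi> (y, a) \<le> s y" unfolding s_def by (rule cSUP_upper[OF a bdd])
    then have "\<beta> * \<phi> (y, a) \<le> \<beta> * s y" using h by (intro mult_left_mono) auto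
    moreover have "\<alpha> * \<phi> (x, a) - \<beta> * \<phi> (y, a) \<le> norm1 (\<alpha> *\<^sub>R x - \<beta> *\<^sub>R y)" using \<phi> h a by (simp add: D1A_def)
    ultimately show ?thesis by linarith
  qed
  have "\<alpha> * s x \<le> \<beta> * s y + norm1 (\<alpha> *\<^sub>R x - \<beta> *\<^sub>R y)"
  proof (cases "\<alpha> = 0")
    case True then show ?thesis using le A_ne by auto
  next
    case False
    then have "s x \<le> (\<beta> * s y + norm1 (\<alpha> *\<^sub>R x - \<beta> *\<^sub>R y)) / \<alpha>"
      unfolding s_def[of x] using le h(3) A_ne by (intro cSUP_least) (auto simp: field_simps)
    then show ?thesis using False h(3) by (simp add: field_simps)
  qed
  then show "\<alpha> * (SUP a\<in>A. \<phi> (x, a)) - \<beta> * (SUP a\<in>A. \<phi> (y, a)) \<le> norm1 (\<alpha> *\<^sub>R x - \<beta> *\<^sub>R y)"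
    by (simp add: s_def)
qed

text \<open>For a single convex combination \<open>\<psi>\<close> of the functions in
  \<open>F\<close>, a nearly maximising action at each state of \<open>z\<close> works: the
  expectation of \<open>\<psi>\<close> under \<open>K\<close> is at most that of its supremum over
  actions, a function in \<open>D1X\<close> for which \<open>d\<close> compares the two state laws.
  The laws with marginal \<open>z\<close> are stable under mixing, so the minimax lemma gives one
  \<open>K'\<close> that serves all functions in \<open>F\<close>.\<close>

lemma one_step_finite:
  assumes K: "adm K" and z: "fin_on X z" and d: "\<And>h. h \<in> D1X \<Longrightarrow> expect (map_pmf fst K) h \<le> expect z h + d"
    and F: "finite F" "F \<subseteq> D1A" and \<eta>: "0 < \<eta>"
  shows "\<exists>K'. adm K' \<and> map_pmf fst K' = z \<and> (\<forall>\<phi>\<in>F. expect K \<phi> \<le> expect K' \<phi> + d + \<eta>)"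
proof -
  obtain a0 where a0: "a0 \<in> A" using A_ne by blast
  define Z where "Z = {K'. adm K' \<and> map_pmf fst K' = z}"
  define c where "c K' \<phi> = expect K' \<phi> - expect K \<phi> + d" for K' \<phi>
  have fin: "finite (set_pmf K)" "finite (set_pmf z)" using K z by (auto simp: fin_on_def)
  have sel: "map_pmf (\<lambda>x. (x, s x)) z \<in> Z" if "\<And>x. x \<in> X \<Longrightarrow> s x \<in> A" for s
    using fin_on_map[OF z, of "\<lambda>x. (x, s x)" "X \<times> A"] that by (auto simp: Z_def map_pmf_comp)
  have ab: "\<bar>expect K' \<phi>\<bar> \<le> 1" if "adm K'" "\<phi> \<in> D1A" for K' \<phi>
    by (rule expect_abs_le) (use that D1A_abs in \<open>auto simp: fin_on_def subset_iff\<close>)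
  have "\<exists>c'\<in>c ` Z. \<forall>\<phi>\<in>F. - \<eta> \<le> c' \<phi>"
  proof (rule convex_family_approaches_orthant[where B="2 + \<bar>d\<bar>"])
    show "c ` Z \<noteq> {}" using sel[of "\<lambda>_. a0"] a0 by auto
  next
    fix c' \<phi> assume "c' \<in> c ` Z" "\<phi> \<in> F"
    then obtain K' where K': "adm K'" "c' = c K'" by (auto simp: Z_def)
    have "\<phi> \<in> D1A" using F \<open>\<phi> \<in> F\<close> by blast
    then show "\<bar>c' \<phi>\<bar> \<le> 2 + \<bar>d\<bar>" using ab[OF K'(1)] ab[OF K] by (fastforce simp: K'(2) c_def)
  next
    fix c1 c2 and s :: real assume "c1 \<in> c ` Z" "c2 \<in> c ` Z" and s: "0 \<le> s" "s \<le> 1"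
    then obtain K1 K2 where K12: "K1 \<in> Z" "K2 \<in> Z" "c1 = c K1" "c2 = c K2" by blast
    have "two_mix s K2 K1 \<in> Z"
    proof -
      have "map_pmf fst (two_mix s K2 K1) = bind_pmf (bernoulli_pmf s) (\<lambda>b. z)"
        unfolding two_mix_def map_bind_pmf by (rule bind_pmf_cong) (use K12 in \<open>auto simp: Z_def\<close>)
      moreover have "adm (two_mix s K2 K1)"
        using K12 by (auto simp: Z_def fin_on_def two_mix_def split: if_splits)
      ultimately show ?thesis by (simp add: Z_def)
    qed
    moreover have "c (two_mix s K2 K1) \<phi> = (1 - s) * c1 \<phi> + s * c2 \<phi>" for \<phi>
      using s K12 by (simp add: c_def expect_two_mix Z_def fin_on_def algebra_simps)
    ultimately show "\<exists>c''\<in>c ` Z. \<forall>\<phi>\<in>F. c'' \<phi> = (1 - s) * c1 \<phi> + s * c2 \<phi>" by blast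
  next
    fix l :: "((real ^ 'k) \<times> 'a \<Rightarrow> real) \<Rightarrow> real" and \<epsilon> :: real
    assume l: "\<And>\<phi>. \<phi> \<in> F \<Longrightarrow> 0 \<le> l \<phi>" "sum l F = 1" and \<epsilon>: "0 < \<epsilon>"
    define \<psi> where "\<psi> p = (\<Sum>\<phi>\<in>F. l \<phi> * \<phi> p)" for p
    have \<psi>: "\<psi> \<in> D1A" unfolding \<psi>_def using F l by (intro D1A_convex) auto
    define h where "h x = (SUP a\<in>A. \<psi> (x, a))" for x
    have h: "h \<in> D1X" unfolding h_def by (rule D1A_sup[OF \<psi>])
    have bdd: "bdd_above ((\<lambda>a. \<psi> (x, a)) ` A)" if "x \<in> X" for x
      using D1A_abs[OF \<psi> that] by (intro bdd_aboveI2[where M=1]) (auto simp: abs_le_iff)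
    have "\<exists>a\<in>A. h x - \<epsilon> < \<psi> (x, a)" if "x \<in> X" for x
      using less_cSUP_iff[OF A_ne bdd[OF that], of "h x - \<epsilon>"] \<epsilon> by (simp add: h_def)
    then obtain s where s: "\<And>x. x \<in> X \<Longrightarrow> s x \<in> A \<and> h x - \<epsilon> < \<psi> (x, s x)" by metis
    define K' where "K' = map_pmf (\<lambda>x. (x, s x)) z"
    have K': "K' \<in> Z" unfolding K'_def using s by (intro sel) auto
    have "expect K \<psi> \<le> expect K (\<lambda>p. h (fst p))"
      using K by (intro expect_mono) (auto simp: fin_on_def h_def subset_iff intro!: cSUP_upper bdd)
    also have "\<dots> = expect (map_pmf fst K) h" by simp
    also have "\<dots> \<le> expect z h + d" by (rule d[OF h])
    also have "expect z h \<le> expect z (\<lambda>x. \<psi> (x, s x) + \<epsilon>)"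
      using z s by (intro expect_mono) (force simp: fin_on_def subset_iff)+
    also have "\<dots> = expect K' \<psi> + \<epsilon>" using fin by (subst expect_add) (auto simp: K'_def)
    finally have le: "expect K \<psi> \<le> expect K' \<psi> + \<epsilon> + d" by simp
    have ex: "expect L \<psi> = (\<Sum>\<phi>\<in>F. l \<phi> * expect L \<phi>)" if "adm L" for L
      unfolding \<psi>_def using that by (subst expect_sum_fun) (auto simp: fin_on_def)
    have "(\<Sum>\<phi>\<in>F. l \<phi> * c K' \<phi>) = expect K' \<psi> - expect K \<psi> + d"
      using l(2) ex[OF K] ex[of K'] K' by (simp add: c_def Z_def algebra_simps sum.distrib sum_subtractf sum_distrib_left[symmetric] sum_distrib_right[symmetric])
    then show "\<exists>c'\<in>c ` Z. - \<epsilon> \<le> (\<Sum>\<phi>\<in>F. l \<phi> * c' \<phi>)" using le K' by (intro bexI[of _ "c K'"]) auto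
  qed (use F \<eta> in auto)
  then obtain K' where "K' \<in> Z" "\<And>\<phi>. \<phi> \<in> F \<Longrightarrow> - \<eta> \<le> c K' \<phi>" by blast
  then show ?thesis by (intro exI[of _ K']) (force simp: Z_def c_def)
qed

text \<open>A finite net of \<open>D1X\<close> brings this down to \<open>one_step_finite\<close>;
  the three thirds of \<open>\<eta>\<close> pay for the comparison and for replacing
  \<open>f\<close> on either side. The discrepancy \<open>d\<close> reappears with factor 1, which
  is what makes iteration possible.\<close>

lemma one_step:
  assumes K: "adm K" and z: "fin_on X z" and d: "\<And>h. h \<in> D1X \<Longrightarrow> expect (map_pmf fst K) h \<le> expect z h + d"
    and \<eta>: "0 < \<eta>"
  shows "\<exists>K'. adm K' \<and> map_pmf fst K' = z \<and> (\<forall>f\<in>D1X. expect (nxt K) f \<le> expect (nxt K') f + d + \<eta>) \<and>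
     pay K \<le> pay K' + d + \<eta>"
proof -
  define \<delta> where "\<delta> = \<eta> / 3"
  have \<delta>: "0 < \<delta>" using \<eta> by (simp add: \<delta>_def)
  obtain F where F: "finite F" "F \<subseteq> D1X" "\<And>f. f \<in> D1X \<Longrightarrow> \<exists>f'\<in>F. \<forall>x\<in>X. \<bar>f x - f' x\<bar> \<le> \<delta>"
    using D1X_net[OF \<delta>] by blast
  define G where "G = insert (\<lambda>(x, a). g x a) ((\<lambda>f. \<lambda>(x, a). expect (q x a) f) ` F)"
  have G: "finite G" "G \<subseteq> D1A" using F g_D1A q_D1A by (auto simp: G_def)
  obtain K' where K': "adm K'" "map_pmf fst K' = z" "\<And>\<phi>. \<phi> \<in> G \<Longrightarrow> expect K \<phi> \<le> expect K' \<phi> + d + \<delta>"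
    using one_step_finite[OF K z d G \<delta>] by blast
  have "expect (nxt K) f \<le> expect (nxt K') f + d + \<eta>" if f: "f \<in> D1X" for f
  proof -
    obtain f' where f': "f' \<in> F" "\<And>x. x \<in> X \<Longrightarrow> \<bar>f x - f' x\<bar> \<le> \<delta>" using F(3)[OF f] by blast
    have close: "\<bar>expect u f - expect u f'\<bar> \<le> \<delta>" if "fin_on X u" for u
    proof -
      have "\<bar>expect u (\<lambda>x. f x - f' x)\<bar> \<le> \<delta>"
        by (rule expect_abs_le) (use that f' in \<open>auto simp: fin_on_def\<close>)
      then show ?thesis using that by (simp add: expect_diff fin_on_def)
    qed
    have "expect (nxt K) f' \<le> expect (nxt K') f' + d + \<delta>"
      using K'(3)[of "\<lambda>(x, a). expect (q x a) f'"] f'(1) K K'(1) by (simp add: expect_nxt G_def)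
    then show ?thesis using close[OF fin_on_nxt[OF K]] close[OF fin_on_nxt[OF K'(1)]] unfolding \<delta>_def by linarith
  qed
  moreover have "pay K \<le> pay K' + d + \<eta>"
    using K'(3)[of "\<lambda>(x, a). g x a"] \<eta> by (simp add: G_def pay_def \<delta>_def)
  ultimately show ?thesis using K' by blast
qed

end

section \<open>Evaluations, flows and values\<close>

lemma evaluation_summable:
  assumes "evaluation \<theta>" "\<And>n. 0 \<le> a n" "\<And>n. a n \<le> (1::real)"
  shows "summable (\<lambda>n. \<theta> n * a n)"
proof (rule summable_comparison_test')
  show "summable \<theta>" using assms(1) by (auto simp: evaluation_def sums_iff)
  show "norm (\<theta> n * a n) \<le> \<theta> n" for n
    using assms by (simp add: evaluation_def abs_mult mult_left_le)
qed

lemma evaluation_mono: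
  assumes \<theta>: "evaluation \<theta>" and a: "\<And>n. 0 \<le> a n" "\<And>n. a n \<le> (1::real)" and b: "\<And>n. 0 \<le> b n" "\<And>n. b n \<le> 1"
    and le: "\<And>n. a n \<le> b n + c"
  shows "(\<Sum>n. \<theta> n * a n) \<le> (\<Sum>n. \<theta> n * b n) + c"
proof -
  have s: "(\<lambda>n. \<theta> n * b n + \<theta> n * c) sums ((\<Sum>n. \<theta> n * b n) + 1 * c)"
    using \<theta> by (intro sums_add summable_sums evaluation_summable b sums_mult2) (auto simp: evaluation_def)
  have "(\<Sum>n. \<theta> n * a n) \<le> (\<Sum>n. \<theta> n * b n) + 1 * c"
  proof (rule sums_le[OF _ summable_sums[OF evaluation_summable[OF \<theta> a]] s])
    show "\<theta> n * a n \<le> \<theta> n * b n + \<theta> n * c" for n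
      using mult_left_mono[OF le[of n], of "\<theta> n"] \<theta> by (simp add: evaluation_def distrib_left)
  qed
  then show ?thesis by simp
qed

lemma evaluation_range:
  assumes \<theta>: "evaluation \<theta>" and a: "\<And>n. 0 \<le> a n" "\<And>n. a n \<le> (1::real)"
  shows "0 \<le> (\<Sum>n. \<theta> n * a n)" "(\<Sum>n. \<theta> n * a n) \<le> 1"
proof -
  show "0 \<le> (\<Sum>n. \<theta> n * a n)"
    using \<theta> a by (intro suminf_nonneg evaluation_summable) (auto simp: evaluation_def)
  show "(\<Sum>n. \<theta> n * a n) \<le> 1" using evaluation_mono[OF \<theta> a, where b="\<lambda>_. 0" and c=1] a by auto
qed

lemma impatience_summable:
  assumes "evaluation \<theta>" shows "summable (\<lambda>n. \<bar>\<theta> (Suc n) - \<theta> n\<bar>)"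
proof (rule summable_comparison_test')
  have "summable \<theta>" using assms by (auto simp: evaluation_def sums_iff)
  then show "summable (\<lambda>n. \<theta> (Suc n) + \<theta> n)" by (intro summable_add) (simp_all add: summable_Suc_iff)
  show "norm \<bar>\<theta> (Suc n) - \<theta> n\<bar> \<le> \<theta> (Suc n) + \<theta> n" for n
    using assms unfolding evaluation_def by (simp add: abs_le_iff add_increasing add_increasing2)
qed

lemma impatience_partial:
  "evaluation \<theta> \<Longrightarrow> finite S \<Longrightarrow> (\<Sum>n\<in>S. \<bar>\<theta> (Suc n) - \<theta> n\<bar>) \<le> impatience \<theta>"
  unfolding impatience_def by (rule sum_le_suminf[OF impatience_summable]) auto

lemma impatience_nonneg: "evaluation \<theta> \<Longrightarrow> 0 \<le> impatience \<theta>"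
  using impatience_partial[of \<theta> "{}"] by simp

text \<open>The weights tend to 0, so each one is the telescoped sum of the later
  differences.\<close>

lemma weight_le_impatience:
  assumes "evaluation \<theta>" shows "\<theta> n \<le> impatience \<theta>"
proof -
  have le: "\<theta> n \<le> impatience \<theta> + \<theta> (n + m)" for m
  proof -
    have "\<theta> n - \<theta> (n + m) \<le> (\<Sum>i\<in>{n..<n+m}. \<bar>\<theta> (Suc i) - \<theta> i\<bar>)"
      by (induction m) auto
    then show ?thesis using impatience_partial[OF assms, of "{n..<n+m}"] by simp
  qed
  have "\<theta> \<longlonglongrightarrow> 0" using assms by (auto simp: evaluation_def sums_iff intro: summable_LIMSEQ_zero)
  then have "(\<lambda>m. \<theta> (n + m)) \<longlonglongrightarrow> 0" using LIMSEQ_ignore_initial_segment[of \<theta> 0 n] by (simp add: add.commute)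
  then have "(\<lambda>m. impatience \<theta> + \<theta> (n + m)) \<longlonglongrightarrow> impatience \<theta> + 0" by (intro tendsto_intros)
  then show ?thesis using le by (intro LIMSEQ_le_const[of _ "impatience \<theta>"]) auto
qed

lemma evaluation_shift_summable:
  assumes \<theta>: "evaluation \<theta>" and r: "\<And>n. 0 \<le> r n" "\<And>n. r n \<le> (1::real)"
  shows "summable (\<lambda>j. \<theta> (j + T) * r j)"
proof (rule summable_comparison_test')
  show "summable (\<lambda>j. \<theta> (j + T))" using \<theta> by (auto simp: evaluation_def sums_iff summable_iff_shift)
  show "norm (\<theta> (j + T) * r j) \<le> \<theta> (j + T)" for j
    using assms by (simp add: evaluation_def abs_mult mult_left_le)
qed

text \<open>Delaying a payoff stream by one stage changes its evaluation by at most the total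
  variation of the weights; \<open>T\<close> such delays accumulate. This is the price of switching
  at a later time.\<close>

lemma evaluation_shift:
  assumes \<theta>: "evaluation \<theta>" and r: "\<And>n. 0 \<le> r n" "\<And>n. r n \<le> (1::real)"
  shows "(\<Sum>j. \<theta> j * r j) \<le> (\<Sum>j. \<theta> (j + T) * r j) + T * impatience \<theta>"
proof (induction T)
  case (Suc T)
  let ?D = "\<lambda>j. \<bar>\<theta> (Suc (j + T)) - \<theta> (j + T)\<bar>"
  have sD: "summable ?D"
    using summable_ignore_initial_segment[OF impatience_summable[OF \<theta>], of T] by simp
  have "suminf ?D \<le> impatience \<theta>"
  proof -
    have "impatience \<theta> = suminf ?D + (\<Sum>i<T. \<bar>\<theta> (Suc i) - \<theta> i\<bar>)"
      unfolding impatience_def using suminf_split_initial_segment[OF impatience_summable[OF \<theta>], of T] by simp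
    moreover have "0 \<le> (\<Sum>i<T. \<bar>\<theta> (Suc i) - \<theta> i\<bar>)" by (intro sum_nonneg) auto
    ultimately show ?thesis by linarith
  qed
  moreover have "(\<Sum>j. \<theta> (j + T) * r j) \<le> (\<Sum>j. \<theta> (j + Suc T) * r j + ?D j)"
  proof (rule suminf_le)
    fix j
    have "(\<theta> (j + T) - \<theta> (j + Suc T)) * r j \<le> ?D j * 1"
      using r by (intro mult_mono) auto
    then show "\<theta> (j + T) * r j \<le> \<theta> (j + Suc T) * r j + ?D j" by (simp add: left_diff_distrib)
  qed (intro summable_add evaluation_shift_summable \<theta> r sD)+
  moreover have "(\<Sum>j. \<theta> (j + Suc T) * r j + ?D j) = (\<Sum>j. \<theta> (j + Suc T) * r j) + suminf ?D"
    by (rule suminf_add[symmetric]) (intro evaluation_shift_summable \<theta> r sD)+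
  ultimately show ?case using Suc by (simp add: algebra_simps)
qed simp

text \<open>The Cesaro mean of \<open>n + 1\<close> stages, those with indices 0 to
  \<open>n\<close>.\<close>

definition unif :: "nat \<Rightarrow> nat \<Rightarrow> real" where
  "unif n k = (if k \<le> n then 1 / Suc n else 0)"

lemma unif_sums: "(\<lambda>k. unif n k * a k) sums ((\<Sum>k\<le>n. a k) / Suc n)"
proof -
  have "(\<lambda>k. unif n k * a k) sums (\<Sum>k\<le>n. unif n k * a k)"
    by (rule sums_finite) (auto simp: unif_def)
  also have "(\<Sum>k\<le>n. unif n k * a k) = (\<Sum>k\<le>n. a k) / Suc n"
    by (simp add: unif_def sum_divide_distrib)
  finally show ?thesis .
qed

lemma evaluation_unif: "evaluation (unif n)"
  using unif_sums[of n "\<lambda>_. 1"] by (auto simp: evaluation_def unif_def[abs_def])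

lemma impatience_unif: "impatience (unif n) = 1 / Suc n"
proof -
  have "(\<lambda>k. \<bar>unif n (Suc k) - unif n k\<bar>) sums (\<Sum>k\<in>{n}. \<bar>unif n (Suc k) - unif n k\<bar>)"
    by (rule sums_finite) (auto simp: unif_def)
  then show ?thesis unfolding impatience_def by (simp add: sums_iff unif_def)
qed

text \<open>The evaluation is conditioned on an initial segment that carries more than half of its
  mass, so that it becomes a random time with finite support. Patience makes this time almost
  invariant under a shift by one.\<close>

lemma truncated_evaluation_pmf:
  assumes \<theta>: "evaluation \<theta>" and a: "\<And>n. 0 \<le> a n" "\<And>n. a n \<le> (1::real)" and \<epsilon>: "0 < \<epsilon>"
  obtains \<kappa> :: "nat pmf" and N where "set_pmf \<kappa> \<subseteq> {..<N}"
    "(\<Sum>n. \<theta> n * a n) \<le> expect \<kappa> a + \<epsilon>"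
    "\<And>F. (\<And>n. \<bar>F n\<bar> \<le> 1) \<Longrightarrow> \<bar>expect \<kappa> F - expect \<kappa> (\<lambda>n. F (Suc n))\<bar> \<le> 6 * impatience \<theta>"
proof -
  have \<theta>0: "0 \<le> \<theta> n" for n using \<theta> by (simp add: evaluation_def)
  have "(\<lambda>n. ennreal (\<theta> n)) sums ennreal 1"
    using \<theta> by (subst sums_ennreal) (auto simp: evaluation_def)
  then have "(\<integral>\<^sup>+n. ennreal (\<theta> n) \<partial>count_space UNIV) = 1"
    by (simp add: nn_integral_count_space_nat sums_iff)
  then have p: "pmf (embed_pmf \<theta>) n = \<theta> n" for n using \<theta>0 by (intro pmf_embed_pmf) auto
  have s1: "(\<lambda>N. \<Sum>n<N. \<theta> n) \<longlonglongrightarrow> 1" using \<theta> by (simp add: evaluation_def sums_def)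
  have s2: "(\<lambda>N. \<Sum>n<N. \<theta> n * a n) \<longlonglongrightarrow> (\<Sum>n. \<theta> n * a n)"
    using summable_sums[OF evaluation_summable[OF \<theta> a]] by (simp add: sums_def)
  have "\<forall>\<^sub>F N in sequentially. 1/2 < (\<Sum>n<N. \<theta> n) \<and> (\<Sum>n. \<theta> n * a n) - \<epsilon> < (\<Sum>n<N. \<theta> n * a n)"
    using order_tendstoD(1)[OF s1, of "1/2"] order_tendstoD(1)[OF s2, of "(\<Sum>n. \<theta> n * a n) - \<epsilon>"] \<epsilon>
    by (auto intro: eventually_conj)
  then obtain N where N: "1/2 < (\<Sum>n<N. \<theta> n)" "(\<Sum>n. \<theta> n * a n) - \<epsilon> < (\<Sum>n<N. \<theta> n * a n)"
    by (auto simp: eventually_sequentially)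
  define c where "c = (\<Sum>n<N. \<theta> n)"
  have m: "measure (embed_pmf \<theta>) {..<N} = c"
    by (simp add: measure_measure_pmf_finite p c_def)
  have c: "1/2 < c" "c \<le> 1"
    using N m measure_pmf.prob_le_1[of "embed_pmf \<theta>" "{..<N}"] by (auto simp: c_def)
  have ne: "set_pmf (embed_pmf \<theta>) \<inter> {..<N} \<noteq> {}"
    using c m measure_pmf_zero_iff[of "embed_pmf \<theta>" "{..<N}"] by auto
  define \<kappa> where "\<kappa> = cond_pmf (embed_pmf \<theta>) {..<N}"
  have set: "set_pmf \<kappa> \<subseteq> {..<N}" by (simp add: \<kappa>_def set_cond_pmf[OF ne])
  have E: "expect \<kappa> F = (\<Sum>n<N. \<theta> n * F n) / c" for F
    using set by (subst integral_measure_pmf_real[of "{..<N}"])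
      (auto simp: \<kappa>_def pmf_cond[OF ne] m p sum_divide_distrib mult.commute)
  \<comment> \<open>Normalising divides by \<open>c \<le> 1\<close> and so only increases this
    nonnegative sum.\<close>
  have "0 \<le> (\<Sum>n<N. \<theta> n * a n)" using \<theta>0 a by (intro sum_nonneg) auto
  then have "(\<Sum>n<N. \<theta> n * a n) \<le> expect \<kappa> a" using c unfolding E
    by (simp add: pos_le_divide_eq mult_left_le)
  then have 1: "(\<Sum>n. \<theta> n * a n) \<le> expect \<kappa> a + \<epsilon>" using N(2) by linarith
  \<comment> \<open>Summation by parts leaves two boundary terms and the variation, each at most the
    impatience; dividing by a mass above 1/2 turns 3 into 6.\<close>
  have 2: "\<bar>expect \<kappa> F - expect \<kappa> (\<lambda>n. F (Suc n))\<bar> \<le> 6 * impatience \<theta>" if F: "\<And>n. \<bar>F n\<bar> \<le> 1" for F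
  proof -
    have "(\<Sum>n<M. \<theta> n * F n) - (\<Sum>n<M. \<theta> n * F (Suc n)) =
        \<theta> 0 * F 0 - \<theta> M * F M + (\<Sum>n<M. (\<theta> (Suc n) - \<theta> n) * F (Suc n))" for M
      by (induction M) (auto simp: algebra_simps)
    note id = this[of N]
    have "\<bar>\<Sum>n<N. (\<theta> (Suc n) - \<theta> n) * F (Suc n)\<bar> \<le> (\<Sum>n<N. \<bar>\<theta> (Suc n) - \<theta> n\<bar>)"
      by (rule order_trans[OF sum_abs sum_mono]) (use F in \<open>auto simp: abs_mult mult_left_le\<close>)
    then have s: "\<bar>\<Sum>n<N. (\<theta> (Suc n) - \<theta> n) * F (Suc n)\<bar> \<le> impatience \<theta>"
      using impatience_partial[OF \<theta>, of "{..<N}"] by simp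
    have w: "\<bar>\<theta> k * F k\<bar> \<le> impatience \<theta>" for k
    proof -
      have "\<bar>\<theta> k * F k\<bar> \<le> \<theta> k" using F[of k] \<theta>0[of k] by (simp add: abs_mult mult_left_le)
      then show ?thesis using weight_le_impatience[OF \<theta>, of k] by linarith
    qed
    have b: "\<bar>(\<Sum>n<N. \<theta> n * F n) - (\<Sum>n<N. \<theta> n * F (Suc n))\<bar> \<le> 3 * impatience \<theta>"
      using id s w[of 0] w[of N] by linarith
    have "\<bar>expect \<kappa> F - expect \<kappa> (\<lambda>n. F (Suc n))\<bar> = \<bar>(\<Sum>n<N. \<theta> n * F n) - (\<Sum>n<N. \<theta> n * F (Suc n))\<bar> / c"
      unfolding E using c by (simp add: diff_divide_distrib[symmetric])
    also have "\<dots> \<le> 3 * impatience \<theta> / (1/2)"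
      using b c by (intro frac_le) auto
    finally show ?thesis by simp
  qed
  show ?thesis using that[OF set 1 2] by blast
qed

section \<open>Flows, tracking and behaviour strategies\<close>

context nonexpansive_mdp
begin

definition flow :: "(real ^ 'k) pmf \<Rightarrow> (nat \<Rightarrow> ((real ^ 'k) \<times> 'a) pmf) \<Rightarrow> bool" where
  "flow u J \<longleftrightarrow> map_pmf fst (J 0) = u \<and> (\<forall>t. adm (J t)) \<and> (\<forall>t. map_pmf fst (J (Suc t)) = nxt (J t))"

lemma flow_adm: "flow u J \<Longrightarrow> adm (J t)"
  by (simp add: flow_def)

lemma flow_Suc: "flow u J \<Longrightarrow> map_pmf fst (J (Suc t)) = nxt (J t)"
  by (simp add: flow_def)

text \<open>A sequence of state-action laws that is only approximately consistent can be followed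
  by a genuine flow from any nearby initial law.\<close>
lemma track:
  assumes K: "\<And>t. adm (K t)" and e: "\<And>t. 0 < e t"
    and step: "\<And>t f. f \<in> D1X \<Longrightarrow> expect (map_pmf fst (K (Suc t))) f \<le> expect (nxt (K t)) f + e t"
    and z: "fin_on X z" and d: "\<And>f. f \<in> D1X \<Longrightarrow> expect (map_pmf fst (K 0)) f \<le> expect z f + d"
  shows "\<exists>J. flow z J \<and> (\<forall>t. pay (K t) \<le> pay (J t) + d + 2 * (\<Sum>s\<le>t. e s))"
proof -
  \<comment> \<open>Each stage costs \<open>e t\<close> twice: once for the inconsistency of
    \<open>K\<close>, once for the slack of \<open>one_step\<close>.\<close>
  define D where "D t = d + 2 * (\<Sum>s<t. e s)" for t
  define P where "P t J \<longleftrightarrow> adm J \<and> (\<forall>f\<in>D1X. expect (nxt (K t)) f \<le> expect (nxt J) f + D t + e t) \<and>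
      pay (K t) \<le> pay J + D t + e t \<and> (t = 0 \<longrightarrow> map_pmf fst J = z)" for t J
  have "\<exists>J. P 0 J" unfolding P_def D_def using one_step[OF K z d e, of 0] by auto
  moreover have "\<exists>J'. P (Suc t) J' \<and> map_pmf fst J' = nxt J" if J: "P t J" for t J
  proof -
    have 1: "fin_on X (nxt J)" using J by (simp add: P_def fin_on_nxt)
    have 2: "expect (map_pmf fst (K (Suc t))) f \<le> expect (nxt J) f + D (Suc t)" if "f \<in> D1X" for f
      using step[OF that, of t] J that by (force simp: P_def D_def)
    show ?thesis using one_step[OF K 1 2 e] by (auto simp: P_def)
  qed
  ultimately obtain J where J: "\<And>t. P t (J t)" "\<And>t. map_pmf fst (J (Suc t)) = nxt (J t)"
    using dependent_nat_choice[of P "\<lambda>t J J'. map_pmf fst J' = nxt J"] by metis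
  have "flow z J" using J by (auto simp: flow_def P_def)
  moreover have "pay (K t) \<le> pay (J t) + d + 2 * (\<Sum>s\<le>t. e s)" for t
    using J(1)[of t] e[of t] by (simp add: P_def D_def lessThan_Suc_atMost[symmetric])
  ultimately show ?thesis by blast
qed

text \<open>The errors \<open>\<eta> * (1/2)^(t + 2)\<close> sum to \<open>\<eta> / 2\<close>, and
  tracking doubles them; the total loss stays below \<open>\<eta>\<close> at all stages.\<close>

lemma track_summable:
  assumes K: "\<And>t. adm (K t)" and \<eta>: "0 < \<eta>"
    and step: "\<And>t f. f \<in> D1X \<Longrightarrow> expect (map_pmf fst (K (Suc t))) f \<le> expect (nxt (K t)) f + \<eta> * (1/2)^(t + 2)"
    and z: "fin_on X z" and d: "\<And>f. f \<in> D1X \<Longrightarrow> expect (map_pmf fst (K 0)) f \<le> expect z f + d"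
  shows "\<exists>J. flow z J \<and> (\<forall>t. pay (K t) \<le> pay (J t) + d + \<eta>)"
proof -
  obtain J where J: "flow z J" "\<And>t. pay (K t) \<le> pay (J t) + d + 2 * (\<Sum>s\<le>t. \<eta> * (1/2)^(s + 2))"
    using track[OF K _ step z d] \<eta> by auto
  have "(\<Sum>s\<le>t. (1/2::real)^(s + 2)) = 1/2 - (1/2)^(t + 2)" for t by (induction t) (auto simp: field_simps)
  then have "2 * (\<Sum>s\<le>t. \<eta> * (1/2)^(s + 2)) = \<eta> * (1 - 2 * (1/2)^(t+2))" for t
    unfolding sum_distrib_left[symmetric] by (simp only: right_diff_distrib)
  moreover have "\<eta> * (1 - 2 * (1/2)^(t+2)) \<le> \<eta>" for t :: nat using \<eta> by (simp add: mult_left_le)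
  ultimately have "pay (K t) \<le> pay (J t) + d + \<eta>" for t using J(2)[of t] by (metis add_left_mono order_trans)
  then show ?thesis using J(1) by blast
qed

text \<open>Tracking applied to a genuine flow: it is consistent without error, so apart from the
  slack the only loss is the initial distance. This yields the Lipschitz bounds for the
  values.\<close>

lemma mimic:
  assumes J: "flow (return_pmf x) J" and xy: "x \<in> X" "y \<in> X" and \<eta>: "0 < \<eta>"
  shows "\<exists>J'. flow (return_pmf y) J' \<and> (\<forall>t. pay (J t) \<le> pay (J' t) + norm1 (x - y) + \<eta>)"
proof (rule track_summable[OF _ \<eta>])
  show "expect (map_pmf fst (J (Suc t))) f \<le> expect (nxt (J t)) f + \<eta> * (1/2)^(t + 2)" for t f
    using flow_Suc[OF J] \<eta> by simp
  show "expect (map_pmf fst (J 0)) f \<le> expect (return_pmf y) f + norm1 (x - y)" if "f \<in> D1X" for f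
    using J D1X_lip[OF that xy] by (simp add: flow_def)
qed (use J xy flow_adm in \<open>auto intro: fin_on_return\<close>)

definition kern :: "(nat \<Rightarrow> real ^ 'k \<Rightarrow> 'a pmf) \<Rightarrow> bool" where
  "kern \<tau> \<longleftrightarrow> (\<forall>t x. fin_on A (\<tau> t x))"

text \<open>The state-action laws of the Markov strategy \<open>\<tau>\<close>. Keeping the kernels
  apart from the initial law allows the same strategy to be restarted from other laws, and
  \<open>mk_bind\<close> makes the result linear in that law.\<close>

primrec mk :: "(real ^ 'k) pmf \<Rightarrow> (nat \<Rightarrow> real ^ 'k \<Rightarrow> 'a pmf) \<Rightarrow> nat \<Rightarrow> ((real ^ 'k) \<times> 'a) pmf" where
  "mk u \<tau> 0 = bind_pmf u (\<lambda>x. map_pmf (Pair x) (\<tau> 0 x))"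
| "mk u \<tau> (Suc t) = bind_pmf (nxt (mk u \<tau> t)) (\<lambda>x. map_pmf (Pair x) (\<tau> (Suc t) x))"

lemma fst_kernel: "map_pmf fst (bind_pmf u (\<lambda>x. map_pmf (Pair x) (s x))) = u"
  by (simp add: map_bind_pmf map_pmf_comp map_pmf_const bind_return_pmf')

lemma adm_kernel: "kern \<tau> \<Longrightarrow> fin_on X u \<Longrightarrow> adm (bind_pmf u (\<lambda>x. map_pmf (Pair x) (\<tau> t x)))"
  unfolding kern_def by (rule fin_on_bind, assumption) (rule fin_on_map[where S=A], auto)

lemma mk_flow: assumes "kern \<tau>" "fin_on X u" shows "flow u (mk u \<tau>)"
proof -
  have "adm (mk u \<tau> t)" for t
    by (induction t) (auto simp: adm_kernel[OF assms(1)] assms fin_on_nxt)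
  then show ?thesis by (simp add: flow_def fst_kernel)
qed

lemma flow_mk:
  assumes J: "flow u J"
  obtains \<tau> where "kern \<tau>" "J = mk u \<tau>"
proof -
  obtain a0 where a0: "a0 \<in> A" using A_ne by blast
  have "\<forall>t. \<exists>s. (\<forall>x. fin_on A (s x)) \<and> J t = bind_pmf (map_pmf fst (J t)) (\<lambda>x. map_pmf (Pair x) (s x))"
    using pmf_disintegration[OF flow_adm[OF J] a0] by metis
  then obtain \<tau> where \<tau>: "\<And>t x. fin_on A (\<tau> t x)"
    "\<And>t. J t = bind_pmf (map_pmf fst (J t)) (\<lambda>x. map_pmf (Pair x) (\<tau> t x))" by metis
  have "J t = mk u \<tau> t" for t
  proof (induction t)
    case 0 show ?case using \<tau>(2)[of 0] J by (simp add: flow_def)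
  next
    case (Suc t)
    then show ?case using \<tau>(2)[of "Suc t"] flow_Suc[OF J, of t] by simp
  qed
  then show ?thesis using that[of \<tau>] \<tau>(1) by (auto simp: kern_def)
qed

lemma nxt_bind: "nxt (bind_pmf p F) = bind_pmf p (\<lambda>i. nxt (F i))"
  by (simp add: nxt_def bind_assoc_pmf)

lemma mk_bind: "mk (bind_pmf p f) \<tau> t = bind_pmf p (\<lambda>i. mk (f i) \<tau> t)"
  by (induction t) (simp_all add: bind_assoc_pmf nxt_bind)

lemma flow_bind:
  assumes "fin_on I p" "\<And>i. i \<in> I \<Longrightarrow> flow (u i) (F i)"
  shows "flow (bind_pmf p u) (\<lambda>t. bind_pmf p (\<lambda>i. F i t))"
  unfolding flow_def
proof (intro conjI allI)
  show "map_pmf fst (bind_pmf p (\<lambda>i. F i 0)) = bind_pmf p u"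
    unfolding map_bind_pmf by (rule bind_pmf_cong) (use assms in \<open>auto simp: flow_def fin_on_def\<close>)
  show "adm (bind_pmf p (\<lambda>i. F i t))" for t by (rule fin_on_bind[OF assms(1)]) (rule flow_adm[OF assms(2)])
  show "map_pmf fst (bind_pmf p (\<lambda>i. F i (Suc t))) = nxt (bind_pmf p (\<lambda>i. F i t))" for t
    unfolding map_bind_pmf nxt_bind
    by (rule bind_pmf_cong) (use assms in \<open>auto simp: flow_def fin_on_def\<close>)
qed

lemma pay_bind: "fin_on I p \<Longrightarrow> (\<And>i. i \<in> I \<Longrightarrow> adm (F i)) \<Longrightarrow> pay (bind_pmf p F) = expect p (\<lambda>i. pay (F i))"
  unfolding pay_def by (rule expect_bind) (auto simp: fin_on_def)

definition law :: "real ^ 'k \<Rightarrow> (((real ^ 'k) \<times> 'a) list \<Rightarrow> real ^ 'k \<Rightarrow> 'a pmf) \<Rightarrow> nat \<Rightarrow> ((real ^ 'k) \<times> 'a) pmf" where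
  "law x \<sigma> n = bind_pmf (hist q x \<sigma> n) (\<lambda>(h, y). map_pmf (Pair y) (\<sigma> h y))"

lemma fst_law: "map_pmf fst (law x \<sigma> n) = map_pmf snd (hist q x \<sigma> n)"
  unfolding law_def map_bind_pmf case_prod_unfold
  by (simp add: map_pmf_comp map_pmf_const map_pmf_def[of snd])

lemma snd_hist_Suc: "map_pmf snd (hist q x \<sigma> (Suc n)) = nxt (law x \<sigma> n)"
  by (simp add: law_def nxt_def map_bind_pmf bind_assoc_pmf bind_map_pmf case_prod_unfold map_pmf_comp)

lemma hist_fin:
  assumes "x \<in> X" "\<sigma> \<in> strategies A" shows "fin_on (UNIV \<times> X) (hist q x \<sigma> n)"
proof (induction n)
  case 0 then show ?case using assms by (simp add: fin_on_return)
next
  case (Suc n)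
  have "fin_on A (\<sigma> h y)" for h y using assms(2) by (simp add: strategies_def fin_on_def)
  then have "fin_on (UNIV \<times> X) (bind_pmf (\<sigma> h y) (\<lambda>a. map_pmf (\<lambda>x'. (h @ [(y, a)], x')) (q y a)))" if "y \<in> X" for h y
    using that by (intro fin_on_bind[where S=A] fin_on_map[where S=X] q_fin) auto
  then show ?case unfolding hist.simps by (intro fin_on_bind[OF Suc]) auto
qed

lemma adm_law: "x \<in> X \<Longrightarrow> \<sigma> \<in> strategies A \<Longrightarrow> adm (law x \<sigma> n)"
  unfolding law_def
  by (rule fin_on_bind[OF hist_fin]) (auto simp: strategies_def fin_on_def subset_iff)

lemma flow_law: "x \<in> X \<Longrightarrow> \<sigma> \<in> strategies A \<Longrightarrow> flow (return_pmf x) (law x \<sigma>)"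
  by (simp add: flow_def adm_law fst_law snd_hist_Suc del: hist.simps(2))

lemma stage_payoff_law:
  assumes "x \<in> X" "\<sigma> \<in> strategies A" shows "stage_payoff q g x \<sigma> n = pay (law x \<sigma> n)"
  unfolding stage_payoff_def pay_def law_def
  using hist_fin[OF assms, of n] assms(2)
  by (subst expect_bind) (auto simp: fin_on_def strategies_def case_prod_unfold)

text \<open>With \<open>flow_law\<close> and \<open>stage_payoff_law\<close> this shows that flows
  and behaviour strategies from a state produce the same payoff sequences, so values may be computed
  over flows.\<close>

lemma flow_strategy:
  assumes x: "x \<in> X" and J: "flow (return_pmf x) J"
  obtains \<sigma> where "\<sigma> \<in> strategies A" "\<And>n. stage_payoff q g x \<sigma> n = pay (J n)"
proof -
  obtain \<tau> where \<tau>: "kern \<tau>" "J = mk (return_pmf x) \<tau>" using flow_mk[OF J] by blast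
  \<comment> \<open>The stage is recovered as the length of the past history; otherwise the history
    is ignored.\<close>
  define \<sigma> where "\<sigma> h y = \<tau> (length h) y" for h :: "((real ^ 'k) \<times> 'a) list" and y
  have \<sigma>: "\<sigma> \<in> strategies A" using \<tau>(1) by (auto simp: strategies_def \<sigma>_def kern_def fin_on_def)
  have len: "\<forall>p\<in>set_pmf (hist q x \<sigma> n). length (fst p) = n" for n by (induction n) fastforce+
  have law: "law x \<sigma> n = bind_pmf (map_pmf snd (hist q x \<sigma> n)) (\<lambda>y. map_pmf (Pair y) (\<tau> n y))" for n
    unfolding law_def bind_map_pmf by (rule bind_pmf_cong) (use len[of n] in \<open>auto simp: \<sigma>_def\<close>)
  have "law x \<sigma> n = J n" for n
  proof (induction n)
    case 0 show ?case using law[of 0] by (simp add: \<tau>(2))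
  next
    case (Suc n) then show ?case using law[of "Suc n"] by (simp only: snd_hist_Suc \<tau>(2) mk.simps)
  qed
  then show ?thesis using that[OF \<sigma>] stage_payoff_law[OF x \<sigma>] by simp
qed

section \<open>Values over flows and their upper limit\<close>

definition gam :: "(nat \<Rightarrow> real) \<Rightarrow> (nat \<Rightarrow> ((real ^ 'k) \<times> 'a) pmf) \<Rightarrow> real" where
  "gam \<theta> J = (\<Sum>n. \<theta> n * pay (J n))"

lemma gam_range: "evaluation \<theta> \<Longrightarrow> flow u J \<Longrightarrow> 0 \<le> gam \<theta> J" "evaluation \<theta> \<Longrightarrow> flow u J \<Longrightarrow> gam \<theta> J \<le> 1"
  unfolding gam_def by (rule evaluation_range; simp add: pay_range flow_adm)+

abbreviation v :: "(nat \<Rightarrow> real) \<Rightarrow> real ^ 'k \<Rightarrow> real" where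
  "v \<equiv> val A q g"

lemma strategies_ne: "strategies A \<noteq> {}"
proof -
  obtain a0 where "a0 \<in> A" using A_ne by blast
  then have "(\<lambda>_ _. return_pmf a0) \<in> strategies A" by (simp add: strategies_def)
  then show ?thesis by blast
qed

lemma gamma_law: "x \<in> X \<Longrightarrow> \<sigma> \<in> strategies A \<Longrightarrow> gamma q g \<theta> x \<sigma> = gam \<theta> (law x \<sigma>)"
  by (simp add: gamma_def gam_def stage_payoff_law)

lemma v_ge:
  assumes \<theta>: "evaluation \<theta>" and x: "x \<in> X" and J: "flow (return_pmf x) J"
  shows "gam \<theta> J \<le> v \<theta> x"
proof -
  obtain \<sigma> where \<sigma>: "\<sigma> \<in> strategies A" "\<And>n. stage_payoff q g x \<sigma> n = pay (J n)"
    using flow_strategy[OF x J] by blast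
  have "gam \<theta> J = gamma q g \<theta> x \<sigma>" by (simp add: gamma_def gam_def \<sigma>(2))
  also have "\<dots> \<le> v \<theta> x"
    unfolding val_def
    by (rule cSUP_upper[OF \<sigma>(1)], rule bdd_aboveI2[where M=1])
      (simp add: gamma_law x gam_range(2)[OF \<theta> flow_law])
  finally show ?thesis .
qed

lemma v_le:
  assumes x: "x \<in> X" and "\<And>J. flow (return_pmf x) J \<Longrightarrow> gam \<theta> J \<le> c"
  shows "v \<theta> x \<le> c"
  unfolding val_def using assms by (intro cSUP_least strategies_ne) (simp add: gamma_law flow_law)

lemma v_near:
  assumes x: "x \<in> X" and \<epsilon>: "0 < \<epsilon>"
  obtains J where "flow (return_pmf x) J" "v \<theta> x - \<epsilon> < gam \<theta> J"
  using v_le[OF x, of \<theta> "v \<theta> x - \<epsilon>"] \<epsilon> by (metis diff_less_eq less_add_same_cancel1 not_le)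

lemma v_range:
  assumes \<theta>: "evaluation \<theta>" and x: "x \<in> X" shows "0 \<le> v \<theta> x" "v \<theta> x \<le> 1"
proof -
  obtain J where J: "flow (return_pmf x) J" using v_near[OF x, of 1] by auto
  show "0 \<le> v \<theta> x" using v_ge[OF \<theta> x J] gam_range(1)[OF \<theta> J] by linarith
  show "v \<theta> x \<le> 1" by (rule v_le[OF x]) (rule gam_range(2)[OF \<theta>])
qed

lemma v_lip_le:
  assumes \<theta>: "evaluation \<theta>" and xy: "x \<in> X" "y \<in> X"
  shows "v \<theta> x \<le> v \<theta> y + norm1 (x - y)"
proof (rule field_le_epsilon)
  fix \<eta> :: real assume \<eta>: "0 < \<eta>"
  have "gam \<theta> J \<le> v \<theta> y + norm1 (x - y) + \<eta>" if J: "flow (return_pmf x) J" for J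
  proof -
    obtain J' where J': "flow (return_pmf y) J'" "\<And>t. pay (J t) \<le> pay (J' t) + norm1 (x - y) + \<eta>"
      using mimic[OF J xy \<eta>] by blast
    have "gam \<theta> J \<le> gam \<theta> J' + (norm1 (x - y) + \<eta>)"
      unfolding gam_def
      by (rule evaluation_mono[OF \<theta>]) (use J' flow_adm[OF J] flow_adm[OF J'(1)] in \<open>auto simp: pay_range add.assoc\<close>)
    then show ?thesis using v_ge[OF \<theta> xy(2) J'(1)] by linarith
  qed
  then show "v \<theta> x \<le> v \<theta> y + norm1 (x - y) + \<eta>" by (rule v_le[OF xy(1)])
qed

lemma one_sided_lip_continuous:
  assumes lip: "\<And>x y. x \<in> X \<Longrightarrow> y \<in> X \<Longrightarrow> f x \<le> f y + norm1 (x - y)"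
  shows "continuous_on X f"
proof (rule lip_continuous)
  show "\<bar>f x - f y\<bar> \<le> norm1 (x - y)" if "x \<in> X" "y \<in> X" for x y
    using lip[OF that] lip[OF that(2,1)] norm1_minus_commute[of x y] by linarith
qed

lemma v_continuous: "evaluation \<theta> \<Longrightarrow> continuous_on X (v \<theta>)"
  by (rule one_sided_lip_continuous) (rule v_lip_le)

definition Ev :: "real \<Rightarrow> (nat \<Rightarrow> real) set" where
  "Ev \<alpha> = {\<theta>. evaluation \<theta> \<and> impatience \<theta> \<le> \<alpha>}"

lemma Ev_ne: assumes "0 < \<alpha>" shows "Ev \<alpha> \<noteq> {}"
proof -
  obtain n where "1 / Suc n < \<alpha>" using assms by (metis nat_approx_posE)
  then have "unif n \<in> Ev \<alpha>" by (simp add: Ev_def evaluation_unif impatience_unif)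
  then show ?thesis by blast
qed

definition V :: "real ^ 'k \<Rightarrow> real" where
  "V x = (INF \<alpha>\<in>{0<..}. SUP \<theta>\<in>Ev \<alpha>. v \<theta> x)"

lemma Ev_bdd: "x \<in> X \<Longrightarrow> bdd_above ((\<lambda>\<theta>. v \<theta> x) ` Ev \<alpha>)"
  by (rule bdd_aboveI2[where M=1]) (simp add: Ev_def v_range)

lemma SUP_Ev_range:
  assumes "x \<in> X" "0 < \<alpha>" shows "0 \<le> (SUP \<theta>\<in>Ev \<alpha>. v \<theta> x)" "(SUP \<theta>\<in>Ev \<alpha>. v \<theta> x) \<le> 1"
proof -
  obtain \<theta> where \<theta>: "\<theta> \<in> Ev \<alpha>" using Ev_ne[OF assms(2)] by blast
  have "0 \<le> v \<theta> x" using \<theta> v_range[OF _ assms(1)] by (simp add: Ev_def)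
  also have "\<dots> \<le> (SUP \<theta>\<in>Ev \<alpha>. v \<theta> x)" by (rule cSUP_upper[OF \<theta> Ev_bdd[OF assms(1)]])
  finally show "0 \<le> (SUP \<theta>\<in>Ev \<alpha>. v \<theta> x)" .
  show "(SUP \<theta>\<in>Ev \<alpha>. v \<theta> x) \<le> 1"
    by (rule cSUP_least[OF Ev_ne[OF assms(2)]]) (use v_range[OF _ assms(1)] in \<open>simp add: Ev_def\<close>)
qed

lemma V_bdd: "x \<in> X \<Longrightarrow> bdd_below ((\<lambda>\<alpha>. SUP \<theta>\<in>Ev \<alpha>. v \<theta> x) ` {0<..})"
  by (rule bdd_belowI2[where m=0]) (simp add: SUP_Ev_range)

lemma V_range: assumes "x \<in> X" shows "0 \<le> V x" "V x \<le> 1"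
proof -
  show "0 \<le> V x" unfolding V_def by (rule cINF_greatest) (auto simp: SUP_Ev_range assms)
  have "V x \<le> (SUP \<theta>\<in>Ev 1. v \<theta> x)" unfolding V_def by (rule cINF_lower[OF V_bdd[OF assms]]) simp
  then show "V x \<le> 1" using SUP_Ev_range(2)[OF assms, of 1] by simp
qed

lemma V_upper:
  assumes x: "x \<in> X" and \<epsilon>: "0 < \<epsilon>"
  obtains \<alpha> where "0 < \<alpha>" "\<And>\<theta>. \<theta> \<in> Ev \<alpha> \<Longrightarrow> v \<theta> x \<le> V x + \<epsilon>"
proof -
  have "(INF \<alpha>\<in>{0<..}. SUP \<theta>\<in>Ev \<alpha>. v \<theta> x) < V x + \<epsilon>" using \<epsilon> by (simp add: V_def)
  then obtain \<alpha> :: real where \<alpha>: "0 < \<alpha>" "(SUP \<theta>\<in>Ev \<alpha>. v \<theta> x) < V x + \<epsilon>"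
    using cINF_less_iff[OF _ V_bdd[OF x], of "V x + \<epsilon>"] by auto
  have "v \<theta> x \<le> V x + \<epsilon>" if "\<theta> \<in> Ev \<alpha>" for \<theta>
    using cSUP_upper[OF that Ev_bdd[OF x]] \<alpha>(2) by simp
  then show ?thesis using that \<alpha>(1) by blast
qed

lemma V_lower:
  assumes x: "x \<in> X" and \<epsilon>: "0 < \<epsilon>" and \<alpha>: "0 < \<alpha>"
  obtains \<theta> where "\<theta> \<in> Ev \<alpha>" "V x - \<epsilon> < v \<theta> x"
proof -
  have "V x \<le> (SUP \<theta>\<in>Ev \<alpha>. v \<theta> x)" unfolding V_def by (rule cINF_lower[OF V_bdd[OF x]]) (use \<alpha> in simp)
  then have "V x - \<epsilon> < (SUP \<theta>\<in>Ev \<alpha>. v \<theta> x)" using \<epsilon> by linarith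
  then show ?thesis using that less_cSUP_iff[OF Ev_ne[OF \<alpha>] Ev_bdd[OF x]] by blast
qed

lemma V_lip_le:
  assumes xy: "x \<in> X" "y \<in> X" shows "V x \<le> V y + norm1 (x - y)"
proof (rule field_le_epsilon)
  fix \<epsilon> :: real assume "0 < \<epsilon>"
  then have \<epsilon>: "0 < \<epsilon> / 2" by simp
  obtain \<alpha> where \<alpha>: "0 < \<alpha>" "\<And>\<theta>. \<theta> \<in> Ev \<alpha> \<Longrightarrow> v \<theta> y \<le> V y + \<epsilon> / 2" using V_upper[OF xy(2) \<epsilon>] by blast
  obtain \<theta> where \<theta>: "\<theta> \<in> Ev \<alpha>" "V x - \<epsilon> / 2 < v \<theta> x" using V_lower[OF xy(1) \<epsilon> \<alpha>(1)] by blast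
  have "v \<theta> x \<le> v \<theta> y + norm1 (x - y)" using \<theta> by (intro v_lip_le xy) (simp add: Ev_def)
  then show "V x \<le> V y + norm1 (x - y) + \<epsilon>" using \<alpha>(2)[OF \<theta>(1)] \<theta>(2) by linarith
qed

lemma V_continuous: "continuous_on X V"
  by (rule one_sided_lip_continuous) (rule V_lip_le)

end

section \<open>Uniform value and its characterization\<close>

context nonexpansive_mdp
begin

lemma gam_bind:
  assumes \<theta>: "evaluation \<theta>" and p: "fin_on I p" and F: "\<And>i. i \<in> I \<Longrightarrow> flow (u i) (F i)"
  shows "gam \<theta> (\<lambda>t. bind_pmf p (\<lambda>i. F i t)) = expect p (\<lambda>i. gam \<theta> (F i))"
proof -
  have fin: "finite (set_pmf p)" and sub: "set_pmf p \<subseteq> I" using p by (auto simp: fin_on_def)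
  have s: "summable (\<lambda>n. \<theta> n * pay (F i n))" if "i \<in> set_pmf p" for i
    using F[of i] sub that by (intro evaluation_summable[OF \<theta>]) (auto simp: pay_range flow_adm)
  have "pay (bind_pmf p (\<lambda>i. F i n)) = (\<Sum>i\<in>set_pmf p. pmf p i * pay (F i n))" for n
    using pay_bind[OF p flow_adm[OF F]] by (simp only: expect_sum[OF fin])
  then have "gam \<theta> (\<lambda>t. bind_pmf p (\<lambda>i. F i t)) = (\<Sum>n. \<Sum>i\<in>set_pmf p. pmf p i * (\<theta> n * pay (F i n)))"
    by (simp add: gam_def sum_distrib_left mult.left_commute)
  also have "\<dots> = (\<Sum>i\<in>set_pmf p. \<Sum>n. pmf p i * (\<theta> n * pay (F i n)))"
    by (rule suminf_sum) (intro summable_mult s)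
  also have "\<dots> = expect p (\<lambda>i. gam \<theta> (F i))"
    unfolding expect_sum[OF fin] gam_def by (intro sum.cong refl suminf_mult s)
  finally show ?thesis .
qed

text \<open>The kernels of \<open>J\<close> are run separately from each initial state. By linearity
  the evaluation of \<open>J\<close> is the average of these runs, each bounded by the value at its
  own state.\<close>

lemma gam_le_expect_v:
  assumes \<theta>: "evaluation \<theta>" and z: "fin_on X z" and J: "flow z J"
  shows "gam \<theta> J \<le> expect z (v \<theta>)"
proof -
  obtain \<tau> where \<tau>: "kern \<tau>" "J = mk z \<tau>" using flow_mk[OF J] by blast
  have fl: "flow (return_pmf x) (mk (return_pmf x) \<tau>)" if "x \<in> X" for x
    by (rule mk_flow[OF \<tau>(1) fin_on_return[OF that]])
  have "J t = bind_pmf z (\<lambda>x. mk (return_pmf x) \<tau> t)" for t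
    using mk_bind[of z return_pmf \<tau> t] by (simp add: \<tau>(2) bind_return_pmf')
  then have "gam \<theta> J = gam \<theta> (\<lambda>t. bind_pmf z (\<lambda>x. mk (return_pmf x) \<tau> t))" by (simp add: gam_def)
  also have "\<dots> = expect z (\<lambda>x. gam \<theta> (mk (return_pmf x) \<tau>))" by (rule gam_bind[OF \<theta> z fl])
  also have "\<dots> \<le> expect z (v \<theta>)"
    using z by (intro expect_mono) (auto simp: fin_on_def subset_iff intro!: v_ge[OF \<theta>] fl)
  finally show ?thesis .
qed

text \<open>Tracking asks for one bound valid for all test functions at once. Weak convergence gives
  it because \<open>D1X\<close> is totally bounded.\<close>

lemma D1X_uniform_limit:
  assumes u: "\<And>n. fin_on X (u n)" and \<mu>: "\<mu> \<in> DeltaX X"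
    and lim: "\<And>h. continuous_on X h \<Longrightarrow> (\<lambda>n. expect (u n) h) \<longlonglongrightarrow> set_lebesgue_integral \<mu> X h"
    and \<eta>: "0 < \<eta>"
  shows "\<forall>\<^sub>F n in sequentially. \<forall>f\<in>D1X. \<bar>expect (u n) f - set_lebesgue_integral \<mu> X f\<bar> \<le> \<eta>"
proof -
  define \<delta> where "\<delta> = \<eta> / 3"
  have \<delta>: "0 < \<delta>" using \<eta> by (simp add: \<delta>_def)
  obtain F where F: "finite F" "F \<subseteq> D1X" "\<And>f. f \<in> D1X \<Longrightarrow> \<exists>f'\<in>F. \<forall>x\<in>X. \<bar>f x - f' x\<bar> \<le> \<delta>"
    using D1X_net[OF \<delta>] by blast
  have "\<forall>\<^sub>F n in sequentially. \<forall>f\<in>F. dist (expect (u n) f) (set_lebesgue_integral \<mu> X f) < \<delta>"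
    using F(1)
  proof (rule eventually_ball_finite, intro ballI)
    fix f assume "f \<in> F"
    then have "continuous_on X f" using F(2) D1X_continuous by blast
    then show "\<forall>\<^sub>F n in sequentially. dist (expect (u n) f) (set_lebesgue_integral \<mu> X f) < \<delta>"
      using tendstoD[OF lim \<delta>] by blast
  qed
  then show ?thesis
  proof eventually_elim
    case (elim n)
    show ?case
    proof
      fix f assume f: "f \<in> D1X"
      obtain f' where f': "f' \<in> F" "\<And>x. x \<in> X \<Longrightarrow> \<bar>f x - f' x\<bar> \<le> \<delta>" using F(3)[OF f] by blast
      have "\<bar>expect (u n) (\<lambda>x. f x - f' x)\<bar> \<le> \<delta>"
        by (rule expect_abs_le) (use u[of n] f' in \<open>auto simp: fin_on_def\<close>)
      then have "\<bar>expect (u n) f - expect (u n) f'\<bar> \<le> \<delta>" using u[of n] by (simp add: expect_diff fin_on_def)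
      moreover have "\<bar>set_lebesgue_integral \<mu> X f - set_lebesgue_integral \<mu> X f'\<bar> \<le> \<delta>"
        using f f' F(2) D1X_continuous by (intro DeltaX_integral_close[OF compact_X \<mu>]) auto
      moreover have "\<bar>expect (u n) f' - set_lebesgue_integral \<mu> X f'\<bar> < \<delta>"
        using elim f'(1) by (simp add: dist_real_def)
      ultimately show "\<bar>expect (u n) f - set_lebesgue_integral \<mu> X f\<bar> \<le> \<eta>" unfolding \<delta>_def by linarith
    qed
  qed
qed

text \<open>Mixing a nearly optimal flow over a random time with law \<open>\<theta>\<close> gives a state-action law
  which is almost invariant when \<open>\<theta>\<close> is patient.\<close>
lemma occupation_law:
  assumes x: "x \<in> X" and \<alpha>: "0 < \<alpha>"
  obtains J \<kappa> N where "flow (return_pmf x) J" "set_pmf \<kappa> \<subseteq> {..<N}" "V x - 3 * \<alpha> \<le> pay (bind_pmf \<kappa> J)"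
    "\<And>f. (\<And>x. x \<in> X \<Longrightarrow> \<bar>f x\<bar> \<le> 1) \<Longrightarrow>
       \<bar>expect (map_pmf fst (bind_pmf \<kappa> J)) f - expect (nxt (bind_pmf \<kappa> J)) f\<bar> \<le> 6 * \<alpha>"
proof -
  obtain \<theta> where \<theta>: "\<theta> \<in> Ev \<alpha>" "V x - \<alpha> < v \<theta> x" using V_lower[OF x \<alpha> \<alpha>] by blast
  then have ev: "evaluation \<theta>" and im: "impatience \<theta> \<le> \<alpha>" by (auto simp: Ev_def)
  obtain J where J: "flow (return_pmf x) J" "v \<theta> x - \<alpha> < gam \<theta> J" using v_near[OF x \<alpha>] by blast
  have aJ: "adm (J t)" for t by (rule flow_adm[OF J(1)])
  obtain \<kappa> N where \<kappa>: "set_pmf \<kappa> \<subseteq> {..<N}" "(\<Sum>n. \<theta> n * pay (J n)) \<le> expect \<kappa> (\<lambda>n. pay (J n)) + \<alpha>"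
    "\<And>F. (\<And>n. \<bar>F n\<bar> \<le> 1) \<Longrightarrow> \<bar>expect \<kappa> F - expect \<kappa> (\<lambda>n. F (Suc n))\<bar> \<le> 6 * impatience \<theta>"
    by (rule truncated_evaluation_pmf[of \<theta> "\<lambda>n. pay (J n)" \<alpha>, OF ev pay_range(1)[OF aJ] pay_range(2)[OF aJ] \<alpha>])
      (rule that, assumption, assumption, simp)
  have fk: "fin_on {..<N} \<kappa>" using \<kappa>(1) finite_subset by (auto simp: fin_on_def)
  have "pay (bind_pmf \<kappa> J) = expect \<kappa> (\<lambda>n. pay (J n))" by (rule pay_bind[OF fk aJ])
  \<comment> \<open>One \<alpha> each for the choice of \<theta>, the choice of the flow and the
    truncation.\<close>
  then have 1: "V x - 3 * \<alpha> \<le> pay (bind_pmf \<kappa> J)"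
    using \<kappa>(2) J(2) \<theta>(2) by (simp add: gam_def)
  have 2: "\<bar>expect (map_pmf fst (bind_pmf \<kappa> J)) f - expect (nxt (bind_pmf \<kappa> J)) f\<bar> \<le> 6 * \<alpha>"
    if f: "\<And>x. x \<in> X \<Longrightarrow> \<bar>f x\<bar> \<le> 1" for f
  proof -
    define F where "F n = expect (map_pmf fst (J n)) f" for n
    have "\<bar>F n\<bar> \<le> 1" for n
      unfolding F_def by (rule expect_abs_le) (use fin_on_fst[OF aJ, of n] f in \<open>auto simp: fin_on_def subset_iff\<close>)
    note b = \<kappa>(3)[of F, OF this]
    have fin: "finite (set_pmf \<kappa>)" using fk by (simp add: fin_on_def)
    have "expect (map_pmf fst (bind_pmf \<kappa> J)) f = expect \<kappa> F"
      unfolding map_bind_pmf F_def using fin fin_on_fst[OF aJ] by (intro expect_bind) (auto simp: fin_on_def)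
    moreover have "expect (nxt (bind_pmf \<kappa> J)) f = expect \<kappa> (\<lambda>n. F (Suc n))"
      unfolding nxt_bind F_def flow_Suc[OF J(1)] using fin fin_on_nxt[OF aJ] by (intro expect_bind) (auto simp: fin_on_def)
    ultimately show ?thesis using b im by simp
  qed
  show ?thesis using that[OF J(1) \<kappa>(1) 1 2] by blast
qed

text \<open>The error in \<open>occupation_law\<close> is of order \<open>1 / Suc n\<close>, so
  state laws and next-state laws share their weak limit. Two successive extractions make the state
  laws and the payoffs converge together.\<close>

lemma limit_occupation:
  assumes x: "x \<in> X"
  obtains J \<kappa> N K \<mu> y where "\<And>n. flow (return_pmf x) (J n)" "\<And>n. set_pmf (\<kappa> n) \<subseteq> {..<N n}"
    "\<And>n. K n = bind_pmf (\<kappa> n) (J n)" "\<And>n. adm (K n)" "\<mu> \<in> DeltaX X"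
    "\<And>h. continuous_on X h \<Longrightarrow> (\<lambda>n. expect (map_pmf fst (K n)) h) \<longlonglongrightarrow> set_lebesgue_integral \<mu> X h"
    "\<And>h. continuous_on X h \<Longrightarrow> (\<lambda>n. expect (nxt (K n)) h) \<longlonglongrightarrow> set_lebesgue_integral \<mu> X h"
    "(\<lambda>n. pay (K n)) \<longlonglongrightarrow> y" "V x \<le> y" "0 \<le> y" "y \<le> 1"
proof -
  have "\<forall>n. \<exists>J \<kappa> N. flow (return_pmf x) J \<and> set_pmf \<kappa> \<subseteq> {..<N} \<and> V x - 3 * (1 / Suc n) \<le> pay (bind_pmf \<kappa> J) \<and>
    (\<forall>f. (\<forall>x\<in>X. \<bar>f x\<bar> \<le> 1) \<longrightarrow>
       \<bar>expect (map_pmf fst (bind_pmf \<kappa> J)) f - expect (nxt (bind_pmf \<kappa> J)) f\<bar> \<le> 6 * (1 / Suc n))"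
  proof
    fix n
    obtain J \<kappa> N where "flow (return_pmf x) J" "set_pmf \<kappa> \<subseteq> {..<N}" "V x - 3 * (1 / Suc n) \<le> pay (bind_pmf \<kappa> J)"
      "\<And>f. (\<And>x. x \<in> X \<Longrightarrow> \<bar>f x\<bar> \<le> 1) \<Longrightarrow>
       \<bar>expect (map_pmf fst (bind_pmf \<kappa> J)) f - expect (nxt (bind_pmf \<kappa> J)) f\<bar> \<le> 6 * (1 / Suc n)"
      using occupation_law[OF x, of "1 / Suc n"] by (metis of_nat_0_less_iff zero_less_Suc zero_less_divide_1_iff)
    then show "\<exists>J \<kappa> N. flow (return_pmf x) J \<and> set_pmf \<kappa> \<subseteq> {..<N} \<and> V x - 3 * (1 / Suc n) \<le> pay (bind_pmf \<kappa> J) \<and>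
      (\<forall>f. (\<forall>x\<in>X. \<bar>f x\<bar> \<le> 1) \<longrightarrow>
       \<bar>expect (map_pmf fst (bind_pmf \<kappa> J)) f - expect (nxt (bind_pmf \<kappa> J)) f\<bar> \<le> 6 * (1 / Suc n))"
      by blast
  qed
  then obtain J \<kappa> N where J: "\<And>n. flow (return_pmf x) (J n)" and \<kappa>: "\<And>n. set_pmf (\<kappa> n) \<subseteq> {..<N n}"
    and p: "\<And>n. V x - 3 * (1 / Suc n) \<le> pay (bind_pmf (\<kappa> n) (J n))"
    and i: "\<And>n f. (\<forall>x\<in>X. \<bar>f x\<bar> \<le> 1) \<Longrightarrow>
       \<bar>expect (map_pmf fst (bind_pmf (\<kappa> n) (J n))) f - expect (nxt (bind_pmf (\<kappa> n) (J n))) f\<bar> \<le> 6 * (1 / Suc n)"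
    by metis
  define K where "K n = bind_pmf (\<kappa> n) (J n)" for n
  have aK: "adm (K n)" for n
    unfolding K_def
    by (rule fin_on_bind[of "{..<N n}"])
      (use \<kappa>[of n] finite_subset flow_adm[OF J] in \<open>auto simp: fin_on_def[of "{..<N n}"]\<close>)
  obtain r \<mu> where r: "strict_mono r" and \<mu>: "\<mu> \<in> DeltaX X"
    and lim: "\<And>h. continuous_on X h \<Longrightarrow> (\<lambda>n. expect (map_pmf fst (K (r n))) h) \<longlonglongrightarrow> set_lebesgue_integral \<mu> X h"
    by (rule finite_pmf_weak_limit[of X "\<lambda>n. map_pmf fst (K n)", OF compact_X fin_on_fst[OF aK]]) (rule that)
  have "\<forall>n. pay (K (r n)) \<in> {0..1}" using pay_range[OF aK] by auto
  then obtain y s where y: "y \<in> {0..1}" and s: "strict_mono s" and limy: "((\<lambda>n. pay (K (r n))) \<circ> s) \<longlonglongrightarrow> y"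
    using compact_imp_seq_compact[OF compact_Icc[of 0 "1::real"]] unfolding seq_compact_def by metis
  define m where "m = r \<circ> s"
  have m: "strict_mono m" unfolding m_def by (rule strict_mono_o[OF r s])
  have to0: "(\<lambda>n. c * (1 / Suc (m n))) \<longlonglongrightarrow> 0" for c :: real
  proof -
    have "(\<lambda>n. 1 / Suc n) \<longlonglongrightarrow> (0::real)" using LIMSEQ_inverse_real_of_nat by (simp add: inverse_eq_divide)
    then have "(\<lambda>n. 1 / Suc (m n)) \<longlonglongrightarrow> (0::real)" using LIMSEQ_subseq_LIMSEQ[OF _ m] by (simp add: o_def)
    then show ?thesis using tendsto_mult_right_zero by blast
  qed
  have lim1: "(\<lambda>n. expect (map_pmf fst (K (m n))) h) \<longlonglongrightarrow> set_lebesgue_integral \<mu> X h" if "continuous_on X h" for h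
    using LIMSEQ_subseq_LIMSEQ[OF lim[OF that] s] by (simp add: m_def o_def)
  have lim2: "(\<lambda>n. expect (nxt (K (m n))) h) \<longlonglongrightarrow> set_lebesgue_integral \<mu> X h" if h: "continuous_on X h" for h
  proof -
    have "bounded (h ` X)" using compact_X h compact_continuous_image compact_imp_bounded by blast
    then obtain B where B: "\<And>x. x \<in> X \<Longrightarrow> \<bar>h x\<bar> \<le> B" by (auto simp: bounded_iff)
    \<comment> \<open>Almost invariance was stated for functions bounded by 1, so \<open>h\<close>
      is rescaled by \<open>C\<close>.\<close>
    define C where "C = \<bar>B\<bar> + 1"
    have C: "0 < C" "\<And>x. x \<in> X \<Longrightarrow> \<bar>h x\<bar> \<le> C" using B by (force simp: C_def)+
    have "\<bar>expect (map_pmf fst (K n)) h - expect (nxt (K n)) h\<bar> \<le> (6 * C) * (1 / Suc n)" for n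
    proof -
      have "\<forall>x\<in>X. \<bar>(1 / C) * h x\<bar> \<le> 1" using C by (simp add: abs_mult)
      from i[OF this, of n] have "\<bar>(1/C) * expect (map_pmf fst (K n)) h - (1/C) * expect (nxt (K n)) h\<bar> \<le> 6 * (1 / Suc n)"
        unfolding K_def expect_cmult .
      then have "\<bar>(1/C) * (expect (map_pmf fst (K n)) h - expect (nxt (K n)) h)\<bar> \<le> 6 * (1 / Suc n)"
        by (simp only: right_diff_distrib)
      then have "\<bar>expect (map_pmf fst (K n)) h - expect (nxt (K n)) h\<bar> / C \<le> 6 * (1 / Suc n)"
        using C(1) by (simp add: abs_mult)
      then show ?thesis using C(1) by (simp add: pos_divide_le_eq mult_ac)
    qed
    then have "(\<lambda>n. expect (map_pmf fst (K (m n))) h - expect (nxt (K (m n))) h) \<longlonglongrightarrow> 0"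
      by (intro Lim_null_comparison[OF _ to0[of "6 * C"]]) simp
    from tendsto_diff[OF lim1[OF h] this] show ?thesis by simp
  qed
  have limy': "(\<lambda>n. pay (K (m n))) \<longlonglongrightarrow> y" using limy by (simp add: m_def o_def)
  have "V x \<le> y"
  proof (rule LIMSEQ_le)
    show "(\<lambda>n. V x - 3 * (1 / Suc (m n))) \<longlonglongrightarrow> V x" using tendsto_diff[OF tendsto_const[of "V x"] to0[of 3]] by simp
    show "(\<lambda>n. pay (K (m n))) \<longlonglongrightarrow> y" by (rule limy')
    show "\<exists>N. \<forall>n\<ge>N. V x - 3 * (1 / Suc (m n)) \<le> pay (K (m n))" using p by (auto simp: K_def)
  qed
  then show ?thesis
    using that[of "\<lambda>n. J (m n)" "\<lambda>n. \<kappa> (m n)" "\<lambda>n. N (m n)" "\<lambda>n. K (m n)" \<mu> y] J \<kappa> aK \<mu> lim1 lim2 limy' y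
    by (simp add: K_def)
qed

text \<open>Switch at a random time from a nearly optimal flow to one that stays close to the limit
  occupation measure, where every stage pays almost \<open>V x\<close>. Patience makes the random
  delay harmless.\<close>
lemma uniform_flow:
  assumes x: "x \<in> X" and \<epsilon>: "0 < \<epsilon>"
  obtains M and N :: nat where "flow (return_pmf x) M"
    "\<And>\<theta>. evaluation \<theta> \<Longrightarrow> V x - \<epsilon> - N * impatience \<theta> \<le> gam \<theta> M"
proof -
  obtain J \<kappa> N K \<mu> y where J: "\<And>n. flow (return_pmf x) (J n)" and \<kappa>: "\<And>n. set_pmf (\<kappa> n) \<subseteq> {..<N n :: nat}"
    and K: "\<And>n. K n = bind_pmf (\<kappa> n) (J n)" and aK: "\<And>n. adm (K n)" and \<mu>: "\<mu> \<in> DeltaX X"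
    and lim: "\<And>h. continuous_on X h \<Longrightarrow> (\<lambda>n. expect (map_pmf fst (K n)) h) \<longlonglongrightarrow> set_lebesgue_integral \<mu> X h"
      "\<And>h. continuous_on X h \<Longrightarrow> (\<lambda>n. expect (nxt (K n)) h) \<longlonglongrightarrow> set_lebesgue_integral \<mu> X h"
    and y: "(\<lambda>n. pay (K n)) \<longlonglongrightarrow> y" "V x \<le> y"
    using limit_occupation[OF x] by metis
  define \<eta> where "\<eta> = \<epsilon> / 2"
  have \<eta>: "0 < \<eta>" using \<epsilon> by (simp add: \<eta>_def)
  define e where "e t = \<eta> * (1/2)^(t + 2)" for t :: nat
  have e: "0 < e t" for t using \<eta> by (simp add: e_def)
  \<comment> \<open>At stage \<open>t\<close> the approximant is chosen so that both of its
    marginals lie within \<open>e t / 2\<close> of the limit. As \<open>e\<close> decreases, the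
    next-state law at stage \<open>t\<close> and the state law at stage \<open>t + 1\<close> then
    agree up to \<open>e t\<close>, a summable error.\<close>
  have "\<exists>k. (\<forall>f\<in>D1X. \<bar>expect (map_pmf fst (K k)) f - set_lebesgue_integral \<mu> X f\<bar> \<le> e t / 2) \<and>
      (\<forall>f\<in>D1X. \<bar>expect (nxt (K k)) f - set_lebesgue_integral \<mu> X f\<bar> \<le> e t / 2) \<and> y - \<eta> < pay (K k)" for t
  proof -
    have e2: "0 < e t / 2" using e by simp
    have "\<forall>\<^sub>F k in sequentially. (\<forall>f\<in>D1X. \<bar>expect (map_pmf fst (K k)) f - set_lebesgue_integral \<mu> X f\<bar> \<le> e t / 2) \<and>
      (\<forall>f\<in>D1X. \<bar>expect (nxt (K k)) f - set_lebesgue_integral \<mu> X f\<bar> \<le> e t / 2) \<and> y - \<eta> < pay (K k)"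
      by (intro eventually_conj D1X_uniform_limit[OF fin_on_fst[OF aK] \<mu> lim(1) e2]
          D1X_uniform_limit[OF fin_on_nxt[OF aK] \<mu> lim(2) e2] order_tendstoD(1)[OF y(1)]) (use \<eta> in auto)
    then show ?thesis by (auto simp: eventually_sequentially)
  qed
  then obtain k where k: "\<And>t f. f \<in> D1X \<Longrightarrow> \<bar>expect (map_pmf fst (K (k t))) f - set_lebesgue_integral \<mu> X f\<bar> \<le> e t / 2"
    "\<And>t f. f \<in> D1X \<Longrightarrow> \<bar>expect (nxt (K (k t))) f - set_lebesgue_integral \<mu> X f\<bar> \<le> e t / 2"
    "\<And>t. y - \<eta> < pay (K (k t))" by metis
  define z where "z = map_pmf fst (K (k 0))"
  have z: "fin_on X z" unfolding z_def by (rule fin_on_fst[OF aK])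
  have "\<exists>L. flow z L \<and> (\<forall>t. pay (K (k t)) \<le> pay (L t) + 0 + \<eta>)"
  proof (rule track_summable[OF aK \<eta> _ z])
    fix t f assume f: "f \<in> D1X"
    have "e (Suc t) \<le> e t" using \<eta> by (simp add: e_def)
    then show "expect (map_pmf fst (K (k (Suc t)))) f \<le> expect (nxt (K (k t))) f + \<eta> * (1/2)^(t + 2)"
      using k(1)[OF f, of "Suc t"] k(2)[OF f, of t] unfolding e_def[symmetric] by linarith
  qed (simp add: z_def)
  then obtain L where L: "flow z L" "\<And>t. pay (K (k t)) \<le> pay (L t) + \<eta>" by auto
  have payL: "V x \<le> pay (L t) + \<epsilon>" for t using L(2)[of t] k(3)[of t] y(2) by (simp add: \<eta>_def)
  obtain \<rho> where \<rho>: "kern \<rho>" "L = mk z \<rho>" using flow_mk[OF L(1)] by blast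
  define J0 where "J0 = J (k 0)"
  define \<kappa>0 where "\<kappa>0 = \<kappa> (k 0)"
  define N0 where "N0 = N (k 0)"
  have J0: "flow (return_pmf x) J0" by (simp add: J0_def J)
  have \<kappa>0: "fin_on {..<N0} \<kappa>0" using \<kappa>[of "k 0"] finite_subset by (auto simp: fin_on_def \<kappa>0_def N0_def)
  \<comment> \<open>The kernels of \<open>L\<close> are restarted from the state law of
    \<open>J0\<close> at time \<open>T\<close>. Averaged over \<open>\<kappa>0\<close> these laws
    make up \<open>z\<close>, so the restarted flows average to \<open>L\<close>.\<close>
  define R where "R T = mk (map_pmf fst (J0 T)) \<rho>" for T
  have R: "flow (map_pmf fst (J0 T)) (R T)" for T
    unfolding R_def by (rule mk_flow[OF \<rho>(1) fin_on_fst[OF flow_adm[OF J0]]])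
  define MT where "MT T t = (if t < T then J0 t else R T (t - T))" for T t
  have MT: "flow (return_pmf x) (MT T)" for T
    unfolding flow_def
  proof (intro conjI allI)
    show "map_pmf fst (MT T 0) = return_pmf x"
      using J0 R[of T] by (cases "T = 0") (auto simp: MT_def flow_def)
    show "adm (MT T t)" for t by (simp add: MT_def flow_adm[OF J0] flow_adm[OF R])
    show "map_pmf fst (MT T (Suc t)) = nxt (MT T t)" for t
    proof (cases "Suc t < T")
      case True then show ?thesis by (simp add: MT_def flow_Suc[OF J0])
    next
      case False
      show ?thesis
      proof (cases "Suc t = T")
        case True
        then have "map_pmf fst (MT T (Suc t)) = map_pmf fst (J0 (Suc t))" using R[of T] by (simp add: MT_def flow_def)
        then show ?thesis using True by (auto simp: MT_def flow_Suc[OF J0])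
      next
        case f: False
        then have "Suc t - T = Suc (t - T)" using False by simp
        then show ?thesis using False f by (simp add: MT_def flow_Suc[OF R])
      qed
    qed
  qed
  define M where "M t = bind_pmf \<kappa>0 (\<lambda>T. MT T t)" for t
  have M: "flow (return_pmf x) M"
    using flow_bind[OF \<kappa>0 MT] by (simp add: M_def[abs_def])
  have "V x - \<epsilon> - N0 * impatience \<theta> \<le> gam \<theta> M" if \<theta>: "evaluation \<theta>" for \<theta>
  proof -
    \<comment> \<open>The payoffs before the switch are nonnegative and are dropped; the delay by
      \<open>T < N0\<close> costs at most \<open>N0\<close> times the impatience.\<close>
    have ge: "gam \<theta> (R T) - N0 * impatience \<theta> \<le> gam \<theta> (MT T)" if "T \<in> set_pmf \<kappa>0" for T
    proof -
      have T: "real T \<le> N0" using that \<kappa>0 by (auto simp: fin_on_def)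
      have r: "0 \<le> pay (R T j)" "pay (R T j) \<le> 1" for j by (simp_all add: pay_range flow_adm[OF R])
      have r': "0 \<le> pay (MT T j)" "pay (MT T j) \<le> 1" for j by (simp_all add: pay_range flow_adm[OF MT])
      have "gam \<theta> (R T) \<le> (\<Sum>j. \<theta> (j + T) * pay (R T j)) + T * impatience \<theta>"
        unfolding gam_def by (rule evaluation_shift[OF \<theta> r])
      also have "(\<Sum>j. \<theta> (j + T) * pay (R T j)) = (\<Sum>j. \<theta> (j + T) * pay (MT T (j + T)))" by (simp add: MT_def)
      also have "\<dots> \<le> gam \<theta> (MT T)"
      proof -
        have "gam \<theta> (MT T) = (\<Sum>j. \<theta> (j + T) * pay (MT T (j + T))) + (\<Sum>i<T. \<theta> i * pay (MT T i))"
          unfolding gam_def by (rule suminf_split_initial_segment[OF evaluation_summable[OF \<theta> r']])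
        moreover have "0 \<le> (\<Sum>i<T. \<theta> i * pay (MT T i))"
          using \<theta> r' by (intro sum_nonneg mult_nonneg_nonneg) (auto simp: evaluation_def)
        ultimately show ?thesis by linarith
      qed
      also have "T * impatience \<theta> \<le> N0 * impatience \<theta>" by (rule mult_right_mono[OF T impatience_nonneg[OF \<theta>]])
      finally show ?thesis by simp
    qed
    have "V x = (\<Sum>n. \<theta> n * V x)"
      using sums_unique[OF sums_mult2[of \<theta> 1 "V x"]] \<theta> by (simp add: evaluation_def)
    also have "\<dots> \<le> gam \<theta> L + \<epsilon>"
      unfolding gam_def by (rule evaluation_mono[OF \<theta>]) (use payL V_range[OF x] pay_range flow_adm[OF L(1)] in auto)
    finally have 1: "V x - \<epsilon> \<le> gam \<theta> L" by simp
    have "z = bind_pmf \<kappa>0 (\<lambda>T. map_pmf fst (J0 T))" by (simp add: z_def K \<kappa>0_def J0_def map_bind_pmf)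
    then have "L = (\<lambda>t. bind_pmf \<kappa>0 (\<lambda>T. R T t))" by (simp add: \<rho>(2) R_def mk_bind fun_eq_iff)
    then have "gam \<theta> L = expect \<kappa>0 (\<lambda>T. gam \<theta> (R T))" using gam_bind[OF \<theta> \<kappa>0 R] by simp
    also have "\<dots> \<le> expect \<kappa>0 (\<lambda>T. gam \<theta> (MT T) + N0 * impatience \<theta>)"
      using ge \<kappa>0 by (intro expect_mono) (auto simp: fin_on_def diff_le_eq)
    also have "\<dots> = gam \<theta> M + N0 * impatience \<theta>"
      using \<kappa>0 gam_bind[OF \<theta> \<kappa>0 MT] by (subst expect_add) (auto simp: fin_on_def M_def[abs_def])
    finally show ?thesis using 1 by linarith
  qed
  then show ?thesis using that[OF M] by blast
qed

text \<open>The delay in \<open>uniform_flow\<close> depends on the state. A finite net leaves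
  finitely many delays, and \<open>mimic\<close> carries the flows to neighbouring states. The five
  fifths of \<epsilon> pay for the Lipschitz bound of \<open>V\<close>, the loss of the flow, its
  delay, the distance in \<open>mimic\<close> and the slack there.\<close>

lemma uniform_flows:
  assumes \<epsilon>: "0 < \<epsilon>"
  obtains \<alpha> M where "0 < \<alpha>" "\<And>x. x \<in> X \<Longrightarrow> flow (return_pmf x) (M x)"
    "\<And>x \<theta>. x \<in> X \<Longrightarrow> \<theta> \<in> Ev \<alpha> \<Longrightarrow> V x - \<epsilon> \<le> gam \<theta> (M x)"
proof -
  define \<delta> where "\<delta> = \<epsilon> / 5"
  have \<delta>: "0 < \<delta>" using \<epsilon> by (simp add: \<delta>_def)
  obtain P where P: "finite P" "P \<subseteq> X" "\<And>x. x \<in> X \<Longrightarrow> \<exists>p\<in>P. norm1 (x - p) < \<delta>"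
    using norm1_net[OF compact_X \<delta>] by blast
  have "\<forall>p\<in>X. \<exists>M N. flow (return_pmf p) M \<and> (\<forall>\<theta>. evaluation \<theta> \<longrightarrow> V p - \<delta> - real N * impatience \<theta> \<le> gam \<theta> M)"
    using uniform_flow[OF _ \<delta>] by metis
  then obtain M0 N where M0: "\<And>p. p \<in> X \<Longrightarrow> flow (return_pmf p) (M0 p)"
    "\<And>p \<theta>. p \<in> X \<Longrightarrow> evaluation \<theta> \<Longrightarrow> V p - \<delta> - real (N p) * impatience \<theta> \<le> gam \<theta> (M0 p)" by metis
  define S where "S = 1 + (\<Sum>p\<in>P. real (N p))"
  have S: "1 \<le> S" "\<And>p. p \<in> P \<Longrightarrow> real (N p) \<le> S"
    using P(1) by (auto simp: S_def sum_nonneg intro!: order_trans[OF member_le_sum[of _ P "\<lambda>p. real (N p)"]])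
  define \<alpha> where "\<alpha> = \<delta> / S"
  have \<alpha>: "0 < \<alpha>" using \<delta> S(1) by (simp add: \<alpha>_def)
  have "\<exists>M. flow (return_pmf x) M \<and> (\<forall>\<theta>\<in>Ev \<alpha>. V x - \<epsilon> \<le> gam \<theta> M)" if x: "x \<in> X" for x
  proof -
    obtain p where p: "p \<in> P" "norm1 (x - p) < \<delta>" using P(3)[OF x] by blast
    then have pX: "p \<in> X" using P(2) by blast
    obtain M where M: "flow (return_pmf x) M" "\<And>t. pay (M0 p t) \<le> pay (M t) + norm1 (p - x) + \<delta>"
      using mimic[OF M0(1)[OF pX] pX x \<delta>] by blast
    have d: "norm1 (p - x) < \<delta>" using p(2) norm1_minus_commute by metis
    have "V x - \<epsilon> \<le> gam \<theta> M" if "\<theta> \<in> Ev \<alpha>" for \<theta>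
    proof -
      have ev: "evaluation \<theta>" and im: "impatience \<theta> \<le> \<alpha>" using that by (auto simp: Ev_def)
      have "gam \<theta> (M0 p) \<le> gam \<theta> M + (norm1 (p - x) + \<delta>)"
        unfolding gam_def
        by (rule evaluation_mono[OF ev]) (use M flow_adm[OF M(1)] flow_adm[OF M0(1)[OF pX]] in \<open>auto simp: pay_range add.assoc\<close>)
      moreover have "real (N p) * impatience \<theta> \<le> S * \<alpha>"
        using S(2)[OF p(1)] im S(1) impatience_nonneg[OF ev] by (intro mult_mono) auto
      moreover have "S * \<alpha> = \<delta>" using S(1) by (simp add: \<alpha>_def)
      ultimately show ?thesis
        using M0(2)[OF pX ev] d V_lip_le[OF x pX] p(2) unfolding \<delta>_def by linarith
    qed
    then show ?thesis using M(1) by blast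
  qed
  then obtain M where "\<And>x. x \<in> X \<Longrightarrow> flow (return_pmf x) (M x) \<and> (\<forall>\<theta>\<in>Ev \<alpha>. V x - \<epsilon> \<le> gam \<theta> (M x))" by metis
  then show ?thesis using that[OF \<alpha>, of M] by blast
qed

lemma V_upper_uniform:
  assumes \<epsilon>: "0 < \<epsilon>"
  obtains \<alpha> where "0 < \<alpha>" "\<And>x \<theta>. x \<in> X \<Longrightarrow> \<theta> \<in> Ev \<alpha> \<Longrightarrow> v \<theta> x \<le> V x + \<epsilon>"
proof -
  define \<delta> where "\<delta> = \<epsilon> / 3"
  have \<delta>: "0 < \<delta>" using \<epsilon> by (simp add: \<delta>_def)
  obtain P where P: "finite P" "P \<subseteq> X" "\<And>x. x \<in> X \<Longrightarrow> \<exists>p\<in>P. norm1 (x - p) < \<delta>"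
    using norm1_net[OF compact_X \<delta>] by blast
  have "\<forall>p\<in>X. \<exists>\<alpha>>0. \<forall>\<theta>\<in>Ev \<alpha>. v \<theta> p \<le> V p + \<delta>" using V_upper[OF _ \<delta>] by metis
  then obtain a where a: "\<And>p. p \<in> X \<Longrightarrow> 0 < a p" "\<And>p \<theta>. p \<in> X \<Longrightarrow> \<theta> \<in> Ev (a p) \<Longrightarrow> v \<theta> p \<le> V p + \<delta>" by metis
  define \<alpha> where "\<alpha> = Min (insert 1 (a ` P))"
  have \<alpha>: "0 < \<alpha>" "\<And>p. p \<in> P \<Longrightarrow> \<alpha> \<le> a p" using P a(1) by (auto simp: \<alpha>_def)
  have "v \<theta> x \<le> V x + \<epsilon>" if x: "x \<in> X" and \<theta>: "\<theta> \<in> Ev \<alpha>" for x \<theta>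
  proof -
    obtain p where p: "p \<in> P" "norm1 (x - p) < \<delta>" using P(3)[OF x] by blast
    then have pX: "p \<in> X" using P(2) by blast
    have "\<theta> \<in> Ev (a p)" "evaluation \<theta>" using \<theta> \<alpha>(2)[OF p(1)] by (auto simp: Ev_def)
    then show ?thesis
      using a(2)[OF pX] v_lip_le[OF _ x pX, of \<theta>] V_lip_le[OF pX x] p(2) norm1_minus_commute[of p x]
      unfolding \<delta>_def by fastforce
  qed
  then show ?thesis using that \<alpha>(1) by blast
qed

text \<open>As an upper limit \<open>V\<close> dominates the values of patient evaluations up to
  \<epsilon>. The flows of \<open>uniform_flows\<close> supply the matching lower bound, so the
  limit exists and is guaranteed by one strategy per state.\<close>

lemma V_general_uniform_value: "general_uniform_value X A q g V"
  unfolding general_uniform_value_def general_limit_value_def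
proof (intro conjI allI impI)
  fix \<epsilon> :: real assume \<epsilon>: "0 < \<epsilon>"
  obtain \<alpha> M where \<alpha>: "0 < \<alpha>" and M: "\<And>x. x \<in> X \<Longrightarrow> flow (return_pmf x) (M x)"
    "\<And>x \<theta>. x \<in> X \<Longrightarrow> \<theta> \<in> Ev \<alpha> \<Longrightarrow> V x - \<epsilon> \<le> gam \<theta> (M x)" using uniform_flows[OF \<epsilon>] by blast
  obtain \<beta> where \<beta>: "0 < \<beta>" "\<And>x \<theta>. x \<in> X \<Longrightarrow> \<theta> \<in> Ev \<beta> \<Longrightarrow> v \<theta> x \<le> V x + \<epsilon>"
    using V_upper_uniform[OF \<epsilon>] by blast
  show "\<exists>\<alpha>>0. \<forall>\<theta>. evaluation \<theta> \<and> impatience \<theta> \<le> \<alpha> \<longrightarrow> (\<forall>x\<in>X. \<bar>v \<theta> x - V x\<bar> \<le> \<epsilon>)"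
  proof (intro exI[of _ "min \<alpha> \<beta>"] conjI allI impI ballI)
    fix \<theta> x assume \<theta>: "evaluation \<theta> \<and> impatience \<theta> \<le> min \<alpha> \<beta>" and x: "x \<in> X"
    then have "\<theta> \<in> Ev \<alpha>" "\<theta> \<in> Ev \<beta>" by (auto simp: Ev_def)
    then show "\<bar>v \<theta> x - V x\<bar> \<le> \<epsilon>"
      using \<beta>(2)[OF x] M(2)[OF x] v_ge[OF _ x M(1)[OF x], of \<theta>] \<theta> by fastforce
  qed (use \<alpha> \<beta> in auto)
  have "\<forall>x\<in>X. \<exists>\<sigma>\<in>strategies A. \<forall>n. stage_payoff q g x \<sigma> n = pay (M x n)"
    using flow_strategy[OF _ M(1)] by metis
  then obtain \<sigma> where \<sigma>: "\<And>x. x \<in> X \<Longrightarrow> \<sigma> x \<in> strategies A"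
    "\<And>x n. x \<in> X \<Longrightarrow> stage_payoff q g x (\<sigma> x) n = pay (M x n)" by metis
  have "V x - \<epsilon> \<le> gamma q g \<theta> x (\<sigma> x)" if "x \<in> X" "\<theta> \<in> Ev \<alpha>" for x \<theta>
    using M(2)[OF that] \<sigma>(2)[OF that(1)] by (simp add: gamma_def gam_def)
  then show "\<exists>\<alpha>>0. \<exists>\<sigma>. (\<forall>x\<in>X. \<sigma> x \<in> strategies A) \<and> (\<forall>\<theta>. evaluation \<theta> \<and> impatience \<theta> \<le> \<alpha> \<longrightarrow>
      (\<forall>x\<in>X. V x - \<epsilon> \<le> gamma q g \<theta> x (\<sigma> x)))"
    using \<alpha> \<sigma>(1) by (intro exI[of _ \<alpha>] conjI exI[of _ \<sigma>]) (auto simp: Ev_def)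
qed

section \<open>The limit value as the least admissible function\<close>

lemma v_unif_limit:
  assumes x: "x \<in> X" shows "(\<lambda>n. v (unif n) x) \<longlonglongrightarrow> V x"
proof (rule LIMSEQ_I)
  fix \<epsilon> :: real assume "0 < \<epsilon>"
  then have "0 < \<epsilon> / 2" by simp
  then obtain \<alpha> where \<alpha>: "0 < \<alpha>" "\<And>\<theta>. evaluation \<theta> \<and> impatience \<theta> \<le> \<alpha> \<Longrightarrow> \<bar>v \<theta> x - V x\<bar> \<le> \<epsilon> / 2"
    using V_general_uniform_value x unfolding general_uniform_value_def general_limit_value_def by metis
  obtain n0 where n0: "1 / Suc n0 < \<alpha>" using \<alpha>(1) by (metis nat_approx_posE)
  have "norm (v (unif n) x - V x) < \<epsilon>" if "n0 \<le> n" for n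
  proof -
    have "1 / real (Suc n) \<le> 1 / Suc n0" using that by (intro frac_le) auto
    then have "\<bar>v (unif n) x - V x\<bar> \<le> \<epsilon> / 2" using n0 by (intro \<alpha>(2)) (simp add: evaluation_unif impatience_unif)
    then show ?thesis using \<open>0 < \<epsilon>\<close> by simp
  qed
  then show "\<exists>n0. \<forall>n\<ge>n0. norm (v (unif n) x - V x) < \<epsilon>" by blast
qed

text \<open>Playing \<open>a\<close> first and then a nearly optimal flow for \<open>n + 1\<close>
  stages gives a flow for \<open>n + 2\<close> stages. Near-optimality and the longer average cost
  \<open>1 / Suc n\<close> each, which vanishes in the limit.\<close>

lemma V_excessive:
  assumes x: "x \<in> X" and a: "a \<in> A" shows "expect (q x a) V \<le> V x"
proof -
  define u where "u = q x a"
  have u: "fin_on X u" unfolding u_def by (rule q_fin[OF x a])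
  then have finu: "finite (set_pmf u)" by (simp add: fin_on_def)
  have step: "expect u (v (unif n)) - 2 / Suc n \<le> v (unif (Suc n)) x" for n
  proof -
    have "\<forall>y\<in>X. \<exists>J. flow (return_pmf y) J \<and> v (unif n) y - 1 / Suc n < gam (unif n) J"
      using v_near[of _ "1 / Suc n" "unif n"] by (metis of_nat_0_less_iff zero_less_Suc zero_less_divide_1_iff)
    then obtain J where J: "\<And>y. y \<in> X \<Longrightarrow> flow (return_pmf y) (J y)"
      "\<And>y. y \<in> X \<Longrightarrow> v (unif n) y - 1 / Suc n < gam (unif n) (J y)" by metis
    define L where "L t = bind_pmf u (\<lambda>y. J y t)" for t
    have L: "flow u L" using flow_bind[OF u, of return_pmf J] J(1) by (simp add: L_def[abs_def] bind_return_pmf')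
    define M where "M t = (case t of 0 \<Rightarrow> return_pmf (x, a) | Suc t \<Rightarrow> L t)" for t
    have M: "flow (return_pmf x) M"
      unfolding flow_def
    proof (intro conjI allI)
      show "map_pmf fst (M 0) = return_pmf x" by (simp add: M_def)
      show "adm (M t)" for t using x a flow_adm[OF L] by (cases t) (auto simp: M_def intro: fin_on_return)
      show "map_pmf fst (M (Suc t)) = nxt (M t)" for t
      proof (cases t)
        case 0 then show ?thesis using L by (simp add: M_def flow_def nxt_def bind_return_pmf u_def)
      next
        case (Suc s) then show ?thesis by (simp add: M_def flow_Suc[OF L])
      qed
    qed
    define S where "S = (\<Sum>k\<le>n. pay (L k))"
    have S: "0 \<le> S" "S \<le> Suc n"
      using sum_bounded_above[of "{..n}" "\<lambda>k. pay (L k)" 1] pay_range flow_adm[OF L] by (auto simp: S_def intro!: sum_nonneg)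
    have gL: "gam (unif n) L = S / Suc n" using sums_unique[OF unif_sums[of n "\<lambda>k. pay (L k)"]] by (simp add: gam_def S_def)
    have "(\<Sum>k\<le>Suc n. pay (M k)) = pay (M 0) + S"
      by (subst sum.atMost_Suc_shift) (simp add: S_def M_def)
    then have "S \<le> (\<Sum>k\<le>Suc n. pay (M k))" using pay_range[OF flow_adm[OF M, of 0]] by simp
    then have "S / Suc (Suc n) \<le> (\<Sum>k\<le>Suc n. pay (M k)) / Suc (Suc n)" by (rule divide_right_mono) simp
    also have "\<dots> = gam (unif (Suc n)) M"
      using sums_unique[OF unif_sums[of "Suc n" "\<lambda>k. pay (M k)"]] by (simp only: gam_def)
    finally have "S / Suc (Suc n) \<le> gam (unif (Suc n)) M" .
    \<comment> \<open>Dividing by one stage more is cheap because the total \<open>S\<close> is at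
      most \<open>n + 1\<close>.\<close>
    moreover have "S / Suc n - 1 / Suc n \<le> S / Suc (Suc n)"
    proof -
      have "(S - 1) * Suc (Suc n) \<le> S * Suc n" using S(2) by (simp add: algebra_simps)
      then have "(S - 1) / Suc n \<le> S / Suc (Suc n)" by (subst pos_divide_le_eq) (simp_all add: pos_le_divide_eq)
      then show ?thesis by (simp add: diff_divide_distrib)
    qed
    moreover have "gam (unif (Suc n)) M \<le> v (unif (Suc n)) x" by (rule v_ge[OF evaluation_unif x M])
    moreover have "expect u (v (unif n)) - 1 / Suc n \<le> gam (unif n) L"
    proof -
      have "expect u (v (unif n)) \<le> expect u (\<lambda>y. gam (unif n) (J y) + 1 / Suc n)"
        using u J(2) by (intro expect_mono) (force simp: fin_on_def subset_iff)+
      also have "\<dots> = gam (unif n) L + 1 / Suc n"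
        using finu gam_bind[OF evaluation_unif u J(1)] by (subst expect_add) (auto simp: L_def[abs_def])
      finally show ?thesis by simp
    qed
    ultimately show ?thesis using gL by simp
  qed
  have "expect u V \<le> V x"
  proof (rule LIMSEQ_le)
    show "(\<lambda>n. v (unif (Suc n)) x) \<longlonglongrightarrow> V x" by (rule LIMSEQ_Suc[OF v_unif_limit[OF x]])
    have "(\<lambda>n. 2 * inverse (real (Suc n))) \<longlonglongrightarrow> 0"
      using tendsto_mult_right_zero[OF LIMSEQ_inverse_real_of_nat] by blast
    then have "(\<lambda>n. 2 / real (Suc n)) \<longlonglongrightarrow> 0" by (simp add: divide_inverse)
    moreover have "(\<lambda>n. expect u (v (unif n))) \<longlonglongrightarrow> expect u V"
      unfolding expect_sum[OF finu] using u
      by (intro tendsto_sum tendsto_mult tendsto_const v_unif_limit) (auto simp: fin_on_def)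
    ultimately show "(\<lambda>n. expect u (v (unif n)) - 2 / Suc n) \<longlonglongrightarrow> expect u V"
      using tendsto_diff by fastforce
    show "\<exists>N. \<forall>n\<ge>N. expect u (v (unif n)) - 2 / Suc n \<le> v (unif (Suc n)) x" using step by blast
  qed
  then show ?thesis by (simp add: u_def)
qed

text \<open>Membership in the closure is tested on the basic neighbourhood determined by
  \<open>F\<close> and \<open>\<eta>\<close>. The graph point found there, read as a state-action
  law, is almost invariant with payoff close to \<open>y\<close>.\<close>

lemma RR_approx:
  assumes R: "(\<mu>, y) \<in> RR X A q g" and F: "finite F" "\<And>f. f \<in> F \<Longrightarrow> continuous_on X f" and \<eta>: "0 < \<eta>"
  obtains K where "adm K" "\<And>f. f \<in> F \<Longrightarrow> \<bar>expect (map_pmf fst K) f - set_lebesgue_integral \<mu> X f\<bar> < \<eta>"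
    "\<And>f. f \<in> F \<Longrightarrow> \<bar>expect (nxt K) f - set_lebesgue_integral \<mu> X f\<bar> < \<eta>" "\<bar>pay K - y\<bar> < \<eta>"
proof -
  have \<mu>: "\<mu> \<in> DeltaX X" and y: "y \<in> {0..1}"
    and cl: "((\<mu>, y), (\<mu>, y)) \<in> (prod_topology (prod_topology (weak_star X) (top_of_set {0..1})) (prod_topology (weak_star X) (top_of_set {0..1}))) closure_of graphF X A q g"
    using R by (auto simp: RR_def Let_def)
  \<comment> \<open>The constant function makes the index set of the intersection nonempty.\<close>
  define G where "G = insert (\<lambda>_. 0) F"
  define O1 where "O1 = (\<Inter>f\<in>G. {\<nu> \<in> DeltaX X. set_lebesgue_integral \<nu> X f \<in> ball (set_lebesgue_integral \<mu> X f) \<eta>})"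
  have O1: "openin (weak_star X) O1"
    unfolding O1_def
    by (rule openin_INT2) (use F in \<open>auto simp: G_def simp del: mem_ball intro!: openin_weak_star_basic\<close>)
  have \<mu>O: "\<mu> \<in> O1" using \<mu> \<eta> by (simp add: O1_def)
  define O2 where "O2 = {0..1} \<inter> ball y \<eta>"
  have O2: "openin (top_of_set {0..1}) O2" by (auto simp: O2_def openin_open)
  have I: "openin (top_of_set {0..1::real}) {0..1}" by simp
  \<comment> \<open>The payoff in the first component is left free, since the image in
    \<open>graphF\<close> does not depend on it.\<close>
  have T: "openin (prod_topology (prod_topology (weak_star X) (top_of_set {0..1})) (prod_topology (weak_star X) (top_of_set {0..1})))
      ((O1 \<times> {0..1}) \<times> (O1 \<times> O2))"
    using O1 O2 I by (simp add: openin_prod_Times_iff)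
  have mem: "((\<mu>, y), (\<mu>, y)) \<in> (O1 \<times> {0..1}) \<times> (O1 \<times> O2)" using \<mu>O y \<eta> by (simp add: O2_def)
  obtain P where P: "P \<in> graphF X A q g" "P \<in> (O1 \<times> {0..1}) \<times> (O1 \<times> O2)"
    using cl[unfolded in_closure_of, THEN conjunct2, rule_format, OF conjI[OF mem T]] by (elim exE conjE)
  from P(1) obtain u y' \<sigma> where P_eq: "P = ((emb u, y'), (emb (bind_pmf u (\<lambda>x. bind_pmf (\<sigma> x) (q x))),
        measure_pmf.expectation u (\<lambda>x. measure_pmf.expectation (\<sigma> x) (g x))))"
    and u: "fin_on X u" and \<sigma>: "\<And>x. x \<in> X \<Longrightarrow> fin_on A (\<sigma> x)"
    unfolding graphF_def fin_on_def by blast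
  define K where "K = bind_pmf u (\<lambda>x. map_pmf (Pair x) (\<sigma> x))"
  have aK: "adm K" unfolding K_def
    by (rule fin_on_bind[OF u], rule fin_on_map[OF \<sigma>]) auto
  have fK: "map_pmf fst K = u" unfolding K_def by (rule fst_kernel)
  have nK: "nxt K = bind_pmf u (\<lambda>x. bind_pmf (\<sigma> x) (q x))"
    by (simp add: K_def nxt_def bind_assoc_pmf bind_map_pmf)
  have pK: "pay K = expect u (\<lambda>x. expect (\<sigma> x) (g x))"
    unfolding pay_def K_def using u \<sigma> by (subst expect_bind) (auto simp: fin_on_def)
  have P2: "emb (map_pmf fst K) \<in> O1" "emb (nxt K) \<in> O1" "pay K \<in> O2"
    using P(2) by (simp_all add: P_eq fK nK pK)
  have close: "\<bar>expect u' f - set_lebesgue_integral \<mu> X f\<bar> < \<eta>" if "emb u' \<in> O1" "fin_on X u'" "f \<in> F" for u' f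
  proof -
    have "set_lebesgue_integral (emb u') X f \<in> ball (set_lebesgue_integral \<mu> X f) \<eta>"
      using that by (auto simp: O1_def G_def)
    then show ?thesis
      using that F(2) set_integral_emb[OF compact_X, of f u'] by (simp add: dist_real_def abs_minus_commute)
  qed
  show ?thesis
  proof (rule that[OF aK])
    show "\<bar>pay K - y\<bar> < \<eta>" using P2(3) by (simp add: O2_def dist_real_def abs_minus_commute)
    show "\<bar>expect (map_pmf fst K) f - set_lebesgue_integral \<mu> X f\<bar> < \<eta>" if "f \<in> F" for f
      by (rule close[OF P2(1) fin_on_fst[OF aK] that])
    show "\<bar>expect (nxt K) f - set_lebesgue_integral \<mu> X f\<bar> < \<eta>" if "f \<in> F" for f
      by (rule close[OF P2(2) fin_on_nxt[OF aK] that])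
  qed
qed

text \<open>The almost invariant law \<open>K\<close> is repeated at every stage, and a flow tracks
  this constant sequence from its state marginal. The error per stage is constant, but the horizon
  is fixed; including \<open>v (unif n)\<close> among the tested functions links the marginal to
  \<mu>.\<close>

lemma RR_le_integral_v:
  assumes R: "(\<mu>, y) \<in> RR X A q g" shows "y \<le> set_lebesgue_integral \<mu> X (v (unif n))"
proof (rule field_le_epsilon)
  fix \<epsilon> :: real assume \<epsilon>: "0 < \<epsilon>"
  \<comment> \<open>Chosen so that the tracking loss \<open>8 * \<eta> * Suc n\<close> plus
    \<open>2 * \<eta>\<close>, for comparing the payoff with \<open>y\<close> and the marginal with
    \<mu>, equals \<epsilon>.\<close>
  define \<eta> where "\<eta> = \<epsilon> / (8 * real n + 10)"
  have \<eta>: "0 < \<eta>" using \<epsilon> by (simp add: \<eta>_def)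
  have \<mu>: "\<mu> \<in> DeltaX X" using R by (auto simp: RR_def Let_def)
  obtain F where F: "finite F" "F \<subseteq> D1X" "\<And>f. f \<in> D1X \<Longrightarrow> \<exists>f'\<in>F. \<forall>x\<in>X. \<bar>f x - f' x\<bar> \<le> \<eta>"
    using D1X_net[OF \<eta>] by blast
  have "finite (insert (v (unif n)) F)" "\<And>f. f \<in> insert (v (unif n)) F \<Longrightarrow> continuous_on X f"
    using F D1X_continuous v_continuous[OF evaluation_unif] by auto
  from RR_approx[OF R this \<eta>] obtain K where K: "adm K"
    "\<And>f. f \<in> insert (v (unif n)) F \<Longrightarrow> \<bar>expect (map_pmf fst K) f - set_lebesgue_integral \<mu> X f\<bar> < \<eta>"
    "\<And>f. f \<in> insert (v (unif n)) F \<Longrightarrow> \<bar>expect (nxt K) f - set_lebesgue_integral \<mu> X f\<bar> < \<eta>" "\<bar>pay K - y\<bar> < \<eta>"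
    by blast
  define z where "z = map_pmf fst K"
  have z: "fin_on X z" unfolding z_def by (rule fin_on_fst[OF K(1)])
  have "\<exists>J. flow z J \<and> (\<forall>t. pay K \<le> pay (J t) + 0 + 2 * (\<Sum>s\<le>t. 4 * \<eta>))"
  proof (rule track[where K="\<lambda>_. K" and e="\<lambda>_. 4 * \<eta>"])
    fix f assume f: "f \<in> D1X"
    obtain f' where f': "f' \<in> F" "\<And>x. x \<in> X \<Longrightarrow> \<bar>f x - f' x\<bar> \<le> \<eta>" using F(3)[OF f] by blast
    have close: "\<bar>expect u f - expect u f'\<bar> \<le> \<eta>" if "fin_on X u" for u
    proof -
      have "\<bar>expect u (\<lambda>x. f x - f' x)\<bar> \<le> \<eta>"
        by (rule expect_abs_le) (use that f' in \<open>auto simp: fin_on_def\<close>)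
      then show ?thesis using that by (simp add: expect_diff fin_on_def)
    qed
    \<comment> \<open>Two errors \<open>\<eta>\<close> come from replacing \<open>f\<close> by a net
      function, two from comparing the marginals with \<mu>.\<close>
    show "expect (map_pmf fst K) f \<le> expect (nxt K) f + 4 * \<eta>"
      using close[OF fin_on_fst[OF K(1)]] close[OF fin_on_nxt[OF K(1)]] K(2)[of f'] K(3)[of f'] f'(1)
      unfolding insert_iff by linarith
  qed (use K(1) \<eta> z in \<open>auto simp: z_def\<close>)
  then obtain J where J: "flow z J" "\<And>t. pay K \<le> pay (J t) + 8 * \<eta> * Suc t" by (auto simp: algebra_simps)
  have "pay K - 8 * \<eta> * Suc n \<le> pay (J t)" if "t \<le> n" for t
  proof -
    have "8 * \<eta> * Suc t \<le> 8 * \<eta> * Suc n" using that \<eta> by (intro mult_left_mono) auto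
    then show ?thesis using J(2)[of t] by linarith
  qed
  then have "(\<Sum>t\<le>n. pay K - 8 * \<eta> * Suc n) \<le> (\<Sum>t\<le>n. pay (J t))" by (intro sum_mono) auto
  then have "Suc n * (pay K - 8 * \<eta> * Suc n) \<le> (\<Sum>t\<le>n. pay (J t))" by (simp only: sum_constant card_atMost)
  then have "pay K - 8 * \<eta> * Suc n \<le> (\<Sum>t\<le>n. pay (J t)) / Suc n" by (subst pos_le_divide_eq) (simp_all add: mult.commute)
  also have "\<dots> = gam (unif n) J" using sums_unique[OF unif_sums[of n "\<lambda>k. pay (J k)"]] by (simp add: gam_def)
  also have "\<dots> \<le> expect z (v (unif n))" by (rule gam_le_expect_v[OF evaluation_unif z J(1)])
  finally have "pay K - 8 * \<eta> * Suc n \<le> expect z (v (unif n))" .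
  moreover have "\<bar>expect z (v (unif n)) - set_lebesgue_integral \<mu> X (v (unif n))\<bar> < \<eta>" using K(2) by (simp add: z_def)
  ultimately have "y \<le> set_lebesgue_integral \<mu> X (v (unif n)) + (8 * \<eta> * Suc n + 2 * \<eta>)" using K(4) by linarith
  also have "8 * \<eta> * Suc n + 2 * \<eta> = \<epsilon>"
  proof -
    have "8 * \<eta> * Suc n + 2 * \<eta> = \<eta> * (8 * real n + 10)" by (simp add: algebra_simps)
    then show ?thesis by (simp add: \<eta>_def)
  qed
  finally show "y \<le> set_lebesgue_integral \<mu> X (v (unif n)) + \<epsilon>" .
qed

lemma RR_le_integral_V:
  assumes R: "(\<mu>, y) \<in> RR X A q g" shows "y \<le> set_lebesgue_integral \<mu> X V"
proof -
  have \<mu>: "\<mu> \<in> DeltaX X" using R by (auto simp: RR_def Let_def)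
  have "(\<lambda>n. set_lebesgue_integral \<mu> X (v (unif n))) \<longlonglongrightarrow> set_lebesgue_integral \<mu> X V"
    by (rule DeltaX_dominated_convergence[OF compact_X \<mu>, where c=1])
      (auto simp: v_continuous evaluation_unif V_continuous v_unif_limit v_range abs_le_iff intro: order_trans[OF _ v_range(1)])
  then show ?thesis using RR_le_integral_v[OF R] by (intro LIMSEQ_le_const) auto
qed

definition admissible :: "((real ^ 'k) measure \<Rightarrow> real) \<Rightarrow> bool" where
  "admissible w \<longleftrightarrow> (\<forall>\<mu>\<in>DeltaX X. w \<mu> \<in> {0..1}) \<and>
      affine_on_DeltaX X w \<and>
      continuous_map (weak_star X) euclideanreal w \<and>
      (\<forall>x'\<in>X. (SUP a\<in>A. w (emb (q x' a))) \<le> w (return borel x')) \<and>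
      (\<forall>(u, y)\<in>RR X A q g. y \<le> w u)"

lemma integral_V_return: "x \<in> X \<Longrightarrow> set_lebesgue_integral (return borel x) X V = V x"
  by (simp add: return_eq_emb set_integral_emb[OF compact_X V_continuous fin_on_return])

lemma integral_V_admissible: "admissible (\<lambda>\<mu>. set_lebesgue_integral \<mu> X V)"
  unfolding admissible_def
proof (intro conjI ballI)
  show "set_lebesgue_integral \<mu> X V \<in> {0..1}" if "\<mu> \<in> DeltaX X" for \<mu>
    using DeltaX_integral_bounds[OF compact_X that V_continuous] V_range by auto
  show "affine_on_DeltaX X (\<lambda>\<mu>. set_lebesgue_integral \<mu> X V)"
    unfolding affine_on_DeltaX_def
    using integral_mix[OF compact_X _ _ _ _ V_continuous V_range(1)] by auto
  show "continuous_map (weak_star X) euclideanreal (\<lambda>\<mu>. set_lebesgue_integral \<mu> X V)"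
    unfolding continuous_map_def using openin_weak_star_basic[OF V_continuous] by auto
  show "(SUP a\<in>A. set_lebesgue_integral (emb (q x a)) X V) \<le> set_lebesgue_integral (return borel x) X V" if x: "x \<in> X" for x
    by (rule cSUP_least[OF A_ne])
      (simp add: integral_V_return[OF x] set_integral_emb[OF compact_X V_continuous q_fin[OF x]] V_excessive[OF x])
  show "case p of (u, y) \<Rightarrow> y \<le> set_lebesgue_integral u X V" if "p \<in> RR X A q g" for p
    using RR_le_integral_V that by (cases p) auto
qed

text \<open>By condition (1) and affinity, the expectation of \<open>h\<close> never increases along
  a flow, so every occupation law has \<open>w\<close> at most \<open>h x\<close>. Continuity passes
  this bound to the limit \<mu>, where condition (2) puts \<open>w\<close> above \<open>y\<close>,
  hence above \<open>V x\<close>.\<close>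

lemma V_le_admissible:
  assumes w: "admissible w" and x: "x \<in> X" shows "V x \<le> w (return borel x)"
proof -
  obtain J \<kappa> N K \<mu> y where J: "\<And>n. flow (return_pmf x) (J n)" and \<kappa>: "\<And>n. set_pmf (\<kappa> n) \<subseteq> {..<N n :: nat}"
    and K: "\<And>n. K n = bind_pmf (\<kappa> n) (J n)" and aK: "\<And>n. adm (K n)" and \<mu>: "\<mu> \<in> DeltaX X"
    and lim: "\<And>h. continuous_on X h \<Longrightarrow> (\<lambda>n. expect (map_pmf fst (K n)) h) \<longlonglongrightarrow> set_lebesgue_integral \<mu> X h"
      "\<And>h. continuous_on X h \<Longrightarrow> (\<lambda>n. expect (nxt (K n)) h) \<longlonglongrightarrow> set_lebesgue_integral \<mu> X h"
    and y: "(\<lambda>n. pay (K n)) \<longlonglongrightarrow> y" "V x \<le> y" "0 \<le> y" "y \<le> 1"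
    using limit_occupation[OF x] by metis
  obtain a0 where a0: "a0 \<in> A" using A_ne by blast
  have weak: "limitin (weak_star X) (\<lambda>n. emb (u n)) \<mu> sequentially"
    if u: "\<And>n. fin_on X (u n)" and l: "\<And>h. continuous_on X h \<Longrightarrow> (\<lambda>n. expect (u n) h) \<longlonglongrightarrow> set_lebesgue_integral \<mu> X h" for u
    by (rule limitin_weak_star[OF \<mu> emb_in_DeltaX[OF compact_X u]]) (simp add: set_integral_emb[OF compact_X _ u] l)
  note w1 = weak[OF fin_on_fst[OF aK] lim(1)] and w2 = weak[OF fin_on_nxt[OF aK] lim(2)]
  \<comment> \<open>The first payoff is set to \<open>y\<close> from the start, as the graph allows;
    only the second one has to converge.\<close>
  define P where "P n = ((emb (map_pmf fst (K n)), y), (emb (nxt (K n)), pay (K n)))" for n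
  have graph: "P n \<in> graphF X A q g" for n
  proof -
    obtain \<sigma> where \<sigma>: "\<And>x. fin_on A (\<sigma> x)" "K n = bind_pmf (map_pmf fst (K n)) (\<lambda>x. map_pmf (Pair x) (\<sigma> x))"
      using pmf_disintegration[OF aK a0] by blast
    define u where "u = map_pmf fst (K n)"
    have u: "fin_on X u" unfolding u_def by (rule fin_on_fst[OF aK])
    have Kn: "K n = bind_pmf u (\<lambda>x. map_pmf (Pair x) (\<sigma> x))" using \<sigma>(2) by (simp add: u_def)
    have "nxt (K n) = bind_pmf u (\<lambda>x. bind_pmf (\<sigma> x) (q x))"
      unfolding Kn by (simp add: nxt_def bind_assoc_pmf bind_map_pmf)
    moreover have "pay (K n) = expect u (\<lambda>x. expect (\<sigma> x) (g x))"
      unfolding Kn pay_def using u \<sigma>(1) by (subst expect_bind) (auto simp: fin_on_def)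
    ultimately have "P n = ((emb u, y), (emb (bind_pmf u (\<lambda>x. bind_pmf (\<sigma> x) (q x))),
        expect u (\<lambda>x. expect (\<sigma> x) (g x))))" by (simp add: P_def u_def)
    then show ?thesis using u \<sigma>(1) y unfolding graphF_def fin_on_def by auto
  qed
  have top: "limitin (top_of_set {0..1::real}) f l sequentially"
    if "f \<longlonglongrightarrow> l" "\<And>n. f n \<in> {0..1}" "l \<in> {0..1}" for f l
    using that by (simp add: limitin_subtopology)
  have "limitin (prod_topology (prod_topology (weak_star X) (top_of_set {0..1})) (prod_topology (weak_star X) (top_of_set {0..1}))) P ((\<mu>, y), (\<mu>, y)) sequentially"
    unfolding limitin_pairwise using w1 w2 top[OF y(1)] top[of "\<lambda>_. y" y] y(3,4) pay_range[OF aK] by (simp add: P_def o_def)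
  then have "((\<mu>, y), (\<mu>, y)) \<in> (prod_topology (prod_topology (weak_star X) (top_of_set {0..1})) (prod_topology (weak_star X) (top_of_set {0..1}))) closure_of graphF X A q g"
    unfolding in_closure_of limitin_def using graph by (metis eventually_happens' trivial_limit_sequentially)
  then have R: "(\<mu>, y) \<in> RR X A q g" using \<mu> y by (simp add: RR_def Let_def)
  have aff: "affine_on_DeltaX X w" using w by (simp add: admissible_def)
  define h where "h z = w (return borel z)" for z
  have exc: "expect (q z a) h \<le> h z" if "z \<in> X" "a \<in> A" for z a
  proof -
    have "expect (q z a) h = w (emb (q z a))" unfolding h_def by (rule affine_emb[OF compact_X aff q_fin[OF that], symmetric])
    also have "\<dots> \<le> (SUP a\<in>A. w (emb (q z a)))"
    proof (rule cSUP_upper[OF that(2)], rule bdd_aboveI2)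
      fix b assume "b \<in> A"
      then have "emb (q z b) \<in> DeltaX X" using that by (intro emb_in_DeltaX compact_X q_fin) auto
      then show "w (emb (q z b)) \<le> 1" using w by (auto simp: admissible_def)
    qed
    also have "\<dots> \<le> h z" using w that by (simp add: admissible_def h_def)
    finally show ?thesis .
  qed
  have dec: "expect (map_pmf fst (J n t)) h \<le> h x" for n t
  proof (induction t)
    case 0 then show ?case using J[of n] by (simp add: flow_def)
  next
    case (Suc t)
    have "expect (map_pmf fst (J n (Suc t))) h = expect (J n t) (\<lambda>(z, a). expect (q z a) h)"
      by (simp only: flow_Suc[OF J] expect_nxt[OF flow_adm[OF J]])
    also have "\<dots> \<le> expect (J n t) (\<lambda>p. h (fst p))"
      using flow_adm[OF J, of n t] exc by (intro expect_mono) (auto simp: fin_on_def subset_iff)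
    also have "\<dots> = expect (map_pmf fst (J n t)) h" by simp
    finally show ?case using Suc by linarith
  qed
  have wK: "w (emb (map_pmf fst (K n))) \<le> h x" for n
  proof -
    have fin: "finite (set_pmf (\<kappa> n))" using \<kappa> finite_subset by blast
    have "w (emb (map_pmf fst (K n))) = expect (map_pmf fst (K n)) h"
      unfolding h_def by (rule affine_emb[OF compact_X aff fin_on_fst[OF aK]])
    also have "\<dots> = expect (\<kappa> n) (\<lambda>t. expect (map_pmf fst (J n t)) h)"
      unfolding K map_bind_pmf using fin fin_on_fst[OF flow_adm[OF J]] by (intro expect_bind) (auto simp: fin_on_def)
    also have "\<dots> \<le> expect (\<kappa> n) (\<lambda>_. h x)" using fin dec by (intro expect_mono) auto
    finally show ?thesis by simp
  qed
  have "limitin euclideanreal (w \<circ> (\<lambda>n. emb (map_pmf fst (K n)))) (w \<mu>) sequentially"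
    by (rule continuous_map_limit[OF _ w1]) (use w in \<open>simp add: admissible_def\<close>)
  then have "(\<lambda>n. w (emb (map_pmf fst (K n)))) \<longlonglongrightarrow> w \<mu>" by (simp add: o_def)
  then have "w \<mu> \<le> h x" using wK by (intro LIMSEQ_le_const2) auto
  moreover have "y \<le> w \<mu>" using w R by (auto simp: admissible_def)
  ultimately show ?thesis using y(2) by (simp add: h_def)
qed

lemma vstar_eq_V:
  assumes x: "x \<in> X" shows "vstar X A q g x = V x"
proof -
  have "vstar X A q g x = Inf {w (return borel x) | w. admissible w}"
    unfolding vstar_def admissible_def ..
  also have "\<dots> = V x"
  proof (rule cInf_eq_minimum)
    show "V x \<in> {w (return borel x) | w. admissible w}"
      unfolding mem_Collect_eq
      by (rule exI[of _ "\<lambda>\<mu>. set_lebesgue_integral \<mu> X V"])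
        (simp only: integral_V_admissible integral_V_return[OF x] simp_thms)
    show "V x \<le> c" if "c \<in> {w (return borel x) | w. admissible w}" for c
      using that V_le_admissible[OF _ x] by auto
  qed
  finally show ?thesis .
qed

lemma vstar_general_uniform_value: "general_uniform_value X A q g (vstar X A q g)"
  using V_general_uniform_value vstar_eq_V
  unfolding general_uniform_value_def general_limit_value_def by simp

end

theorem theorem4:
  fixes X :: "(real ^ 'k::finite) set"
    and A :: "'a set"
    and q :: "real ^ 'k \<Rightarrow> 'a \<Rightarrow> (real ^ 'k) pmf"
    and g :: "real ^ 'k \<Rightarrow> 'a \<Rightarrow> real"
  assumes "compact X" and "X \<subseteq> DeltaK" and "A \<noteq> {}"
    and "\<And>x a. x \<in> X \<Longrightarrow> a \<in> A \<Longrightarrow> finite (set_pmf (q x a)) \<and> set_pmf (q x a) \<subseteq> X"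
    and "\<And>x a. x \<in> X \<Longrightarrow> a \<in> A \<Longrightarrow> g x a \<in> {0..1}"
    and "\<And>x y a f \<alpha> \<beta>. x \<in> X \<Longrightarrow> y \<in> X \<Longrightarrow> a \<in> A \<Longrightarrow> f \<in> D1 \<Longrightarrow> 0 \<le> \<alpha> \<Longrightarrow> 0 \<le> \<beta> \<Longrightarrow>
           \<bar>\<alpha> * lin_ext f (q x a) - \<beta> * lin_ext f (q y a)\<bar> \<le> norm1 (\<alpha> *\<^sub>R x - \<beta> *\<^sub>R y)"
    and "\<And>x y a \<alpha> \<beta>. x \<in> X \<Longrightarrow> y \<in> X \<Longrightarrow> a \<in> A \<Longrightarrow> 0 \<le> \<alpha> \<Longrightarrow> 0 \<le> \<beta> \<Longrightarrow>
           \<bar>\<alpha> * g x a - \<beta> * g y a\<bar> \<le> norm1 (\<alpha> *\<^sub>R x - \<beta> *\<^sub>R y)"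
  shows "general_uniform_value X A q g (vstar X A q g)"
proof -
  interpret nonexpansive_mdp X A q g
    by (unfold_locales; (unfold fin_on_def)?; fact assms)
  show ?thesis by (rule vstar_general_uniform_value)
qed

end
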